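(* Let $S$ be a simply connected analytic submanifold of $\mathbb{R}^{n-1}$ and let $P\in\mathbb{R}[\mathbf{x};x_n]$ have degree $d_n$ in $x_n$. Assume $P$ never nullifies on $S$, and that $\mathrm{Disc}^{d_n}_{x_n}(P)$ is not the zero polynomial and is order-invariant on $S$. Then $P$ is projectively delineable on $S$ and $H^{d_n}(P)$ is order-invariant on each projective $P$-section over $S$.
   Context: Write $\mathbf{x}=(x_1,\dots,x_{n-1})$; $E_{\mathbf{x}_0}P$ is the polynomial in $x_n$ obtained by substituting $\mathbf{x}_0$ for $\mathbf{x}$. "$P$ never nullifies on $S$" means $E_{\mathbf{x}}P\ne0$ for every $\mathbf{x}\in S$. $\mathrm{Disc}^{d}_{x_n}(P)\in\mathbb{R}[\mathbf{x}]$ is the discriminant with respect to $x_n$ for formal degree $d$, so that $E_{\mathbf{x}}\mathrm{Disc}^d_{x_n}(P)$ is the discriminant of $E_{\mathbf{x}}P$ regarded as a polynomial of formal degree $d$. For a polynomial $f$ in $m$ variables and $v\in\mathbb{R}^m$, $\mathrm{ord}(f,v)$ is the least total order of a partial derivative of $f$ nonzero at $v$; order-invariant on a set means $\mathrm{ord}(f,\cdot)$ is constant there. $\mathbb{RP}^1$ is the quotient of $\mathbb{R}^2\setminus\{(0,0)\}$ by proportionality with the quotient topology; $(u:v)$ is the class of $(u,v)$. $H^{d}(P)(\mathbf{x},x_n,y)=\sum_kc_k(\mathbf{x})x_n^ky^{d-k}$ for $P=\sum_kc_k(\mathbf{x})x_n^k$. A projective root of a binary form $g(u,v)$ is $(u_0:v_0)$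 with $g(u_0,v_0)=0$, of multiplicity (for $g\ne0$) the largest $m$ with $(v_0u-u_0v)^m\mid g$. $Z_{\mathbb{RP}^1}(P,S)=\{(\mathbf{x},(x_n:y))\in S\times\mathbb{RP}^1: H^{d_n}(P)(\mathbf{x},x_n,y)=0\}$. $P$ is projectively delineable on $S$ if there are $k\in\mathbb{N}$ and continuous $\theta_1,\dots,\theta_k:S\to\mathbb{RP}^1$ such that $Z_{\mathbb{RP}^1}(P,S)$ is the disjoint union of their graphs and, for each $l$, there is $m_l\ge1$ with $\theta_l(\mathbf{x})$ a projective root of $E_{\mathbf{x}}H^{d_n}(P)$ of multiplicity $m_l$ for all $\mathbf{x}\in S$; the graphs are the projective $P$-sections. Order-invariance of $H^{d_n}(P)$ on the section of $\theta_l$ means $\mathbf{x}\mapsto\mathrm{ord}(H^{d_n}(P),(\mathbf{x},u,v))$ is constant on $S$ for representatives $(u,v)$ of $\theta_l(\mathbf{x})$. *)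

theory Defs
  imports "HOL-Analysis.Analysis" "HOL-Library.Poly_Mapping" "Subresultants.Resultant_Prelim"
begin

type_synonym 'v mpoly = "('v \<Rightarrow>\<^sub>0 nat) \<Rightarrow>\<^sub>0 real"

definition mp_const :: "real \<Rightarrow> 'v mpoly" where
  "mp_const c = Poly_Mapping.single 0 c"

definition mp_var :: "'v \<Rightarrow> 'v mpoly" where
  "mp_var i = Poly_Mapping.single (Poly_Mapping.single i 1) 1"

definition mp_eval :: "('v \<Rightarrow> real) \<Rightarrow> 'v mpoly \<Rightarrow> real" where
  "mp_eval a p = (\<Sum>m\<in>Poly_Mapping.keys p. Poly_Mapping.lookup p m * (\<Prod>i\<in>Poly_Mapping.keys m. a i ^ Poly_Mapping.lookup m i))"

definition mp_pderiv :: "'v \<Rightarrow> 'v mpoly \<Rightarrow> 'v mpoly" where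
  "mp_pderiv i p = (\<Sum>m\<in>Poly_Mapping.keys p.
      Poly_Mapping.single (m - Poly_Mapping.single i 1) (of_nat (Poly_Mapping.lookup m i) * Poly_Mapping.lookup p m))"

definition mp_rename :: "('a \<Rightarrow> 'b) \<Rightarrow> 'a mpoly \<Rightarrow> 'b mpoly" where
  "mp_rename f p = (\<Sum>m\<in>Poly_Mapping.keys p.
      Poly_Mapping.single (\<Sum>i\<in>Poly_Mapping.keys m. Poly_Mapping.single (f i) (Poly_Mapping.lookup m i)) (Poly_Mapping.lookup p m))"

definition mp_ord :: "'v mpoly \<Rightarrow> ('v \<Rightarrow> real) \<Rightarrow> nat" where
  "mp_ord f a = (LEAST k. \<exists>is. length is = k \<and> mp_eval a (foldr mp_pderiv is f) \<noteq> 0)"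

definition mp_order_invariant :: "'v mpoly \<Rightarrow> ('v \<Rightarrow> real) set \<Rightarrow> bool" where
  "mp_order_invariant f T \<longleftrightarrow> (\<forall>a\<in>T. \<forall>b\<in>T. mp_ord f a = mp_ord f b)"

text \<open>P :: 'n mpoly poly is a polynomial in x_n whose coefficients are polynomials in
  x = (x_i)_{i :: 'n}, where 'n is a finite type with CARD('n) = n - 1.\<close>

definition eval_x :: "(real^'n) \<Rightarrow> 'n mpoly poly \<Rightarrow> real poly" where
  "eval_x x P = map_poly (mp_eval (($) x)) P"

definition never_nullifies :: "'n mpoly poly \<Rightarrow> (real^'n) set \<Rightarrow> bool" where
  "never_nullifies P S \<longleftrightarrow> (\<forall>x\<in>S. eval_x x P \<noteq> 0)"

definition deriv_xn :: "'a::comm_semiring_1 poly \<Rightarrow> 'a poly" where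
  "deriv_xn p = (\<Sum>k\<in>{1..degree p}. monom (of_nat k * coeff p k) (k - 1))"

text \<open>Discriminant for formal degree d:
  Res^{d,d-1}(P, dP/dx_n) = (-1)^(d(d-1)/2) * c_d * Disc^d(P)  (exact division in R[x]);
  Disc^0 = 1.\<close>
definition disc_xn :: "nat \<Rightarrow> 'n mpoly poly \<Rightarrow> 'n mpoly" where
  "disc_xn d P = (if d = 0 then 1 else
     (THE D. coeff P d * D =
        (-1) ^ (d * (d - 1) div 2) * Determinant.det (sylvester_mat_sub d (d - 1) P (deriv_xn P))))"

text \<open>Homogenisation H^d(P)(x, x_n, y); variables: Inl i = x_i, Inr False = x_n, Inr True = y.\<close>
definition hom_poly :: "nat \<Rightarrow> 'n mpoly poly \<Rightarrow> ('n + bool) mpoly" where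
  "hom_poly d P = (\<Sum>k\<le>d. mp_rename Inl (coeff P k) * mp_var (Inr False) ^ k * mp_var (Inr True) ^ (d - k))"

definition hpt :: "(real^'n) \<Rightarrow> real \<Rightarrow> real \<Rightarrow> ('n + bool \<Rightarrow> real)" where
  "hpt x u v = case_sum (($) x) (\<lambda>b. if b then v else u)"

text \<open>E_x H^d(P): binary form in (u, v); variable False = u, True = v.\<close>
definition binform :: "nat \<Rightarrow> 'n mpoly poly \<Rightarrow> (real^'n) \<Rightarrow> bool mpoly" where
  "binform d P x = (\<Sum>k\<le>d. mp_const (mp_eval (($) x) (coeff P k)) * mp_var False ^ k * mp_var True ^ (d - k))"

definition bpt :: "real \<Rightarrow> real \<Rightarrow> (bool \<Rightarrow> real)" where
  "bpt u v = (\<lambda>b. if b then v else u)"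

definition rp_class :: "real \<times> real \<Rightarrow> (real \<times> real) set" where
  "rp_class p = {(t * fst p, t * snd p) | t. t \<noteq> 0}"

definition RP1 :: "(real \<times> real) set set" where
  "RP1 = rp_class ` (- {(0, 0)})"

text \<open>Quotient topology: W is open iff its preimage under the quotient map is open in R^2 - {0}.\<close>
definition RP1_top :: "(real \<times> real) set topology" where
  "RP1_top = topology (\<lambda>W. W \<subseteq> RP1 \<and> openin (top_of_set (- {(0, 0)})) (\<Union>W))"

definition is_proj_root_mult :: "bool mpoly \<Rightarrow> (real \<times> real) set \<Rightarrow> nat \<Rightarrow> bool" where
  "is_proj_root_mult g c m \<longleftrightarrow> c \<in> RP1 \<and> g \<noteq> 0 \<and>
     (\<forall>(u0, v0)\<in>c. mp_eval (bpt u0 v0) g = 0 \<and>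
        (GREATEST j. (mp_const v0 * mp_var False - mp_const u0 * mp_var True) ^ j dvd g) = m)"

definition Z_RP1 :: "'n mpoly poly \<Rightarrow> (real^'n) set \<Rightarrow> ((real^'n) \<times> (real \<times> real) set) set" where
  "Z_RP1 P S = {(x, c). x \<in> S \<and> c \<in> RP1 \<and>
      (\<forall>(u, v)\<in>c. mp_eval (hpt x u v) (hom_poly (degree P) P) = 0)}"

definition proj_delineable_by ::
  "'n mpoly poly \<Rightarrow> (real^'n) set \<Rightarrow> nat \<Rightarrow> (nat \<Rightarrow> real^'n \<Rightarrow> (real \<times> real) set) \<Rightarrow> bool" where
  "proj_delineable_by P S k \<theta> \<longleftrightarrow>
     (\<forall>l<k. continuous_map (top_of_set S) RP1_top (\<theta> l)) \<and>
     Z_RP1 P S = (\<Union>l<k. {(x, \<theta> l x) | x. x \<in> S}) \<and>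
     (\<forall>l<k. \<forall>l'<k. l \<noteq> l' \<longrightarrow> {(x, \<theta> l x) | x. x \<in> S} \<inter> {(x, \<theta> l' x) | x. x \<in> S} = {}) \<and>
     (\<forall>l<k. \<exists>m\<ge>1. \<forall>x\<in>S. is_proj_root_mult (binform (degree P) P x) (\<theta> l x) m)"

definition proj_delineable :: "'n mpoly poly \<Rightarrow> (real^'n) set \<Rightarrow> bool" where
  "proj_delineable P S \<longleftrightarrow> (\<exists>k \<theta>. proj_delineable_by P S k \<theta>)"

definition H_order_invariant_on_section ::
  "'n mpoly poly \<Rightarrow> (real^'n) set \<Rightarrow> (real^'n \<Rightarrow> (real \<times> real) set) \<Rightarrow> bool" where
  "H_order_invariant_on_section P S th \<longleftrightarrow>
     (\<exists>c. \<forall>x\<in>S. \<forall>(u, v)\<in>th x. mp_ord (hom_poly (degree P) P) (hpt x u v) = c)"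

definition real_analytic_on :: "(real^'n) set \<Rightarrow> (real^'n \<Rightarrow> real) \<Rightarrow> bool" where
  "real_analytic_on U f \<longleftrightarrow> (\<forall>a\<in>U. \<exists>r>0. \<exists>c :: ('n \<Rightarrow>\<^sub>0 nat) \<Rightarrow> real.
      \<forall>x\<in>ball a r. ((\<lambda>\<alpha>. c \<alpha> * (\<Prod>i\<in>UNIV. (x $ i - a $ i) ^ Poly_Mapping.lookup \<alpha> i)) has_sum f x) UNIV)"

definition analytic_diffeo :: "(real^'n) set \<Rightarrow> (real^'n) set \<Rightarrow> (real^'n \<Rightarrow> real^'n) \<Rightarrow> bool" where
  "analytic_diffeo U V \<phi> \<longleftrightarrow> open U \<and> open V \<and> bij_betw \<phi> U V \<and>
     (\<forall>i. real_analytic_on U (\<lambda>x. \<phi> x $ i)) \<and>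
     (\<exists>\<psi>. (\<forall>i. real_analytic_on V (\<lambda>y. \<psi> y $ i)) \<and> (\<forall>x\<in>U. \<psi> (\<phi> x) = x))"

definition analytic_submanifold :: "(real^'n) set \<Rightarrow> bool" where
  "analytic_submanifold S \<longleftrightarrow> (\<forall>p\<in>S. \<exists>U V \<phi> I. p \<in> U \<and> analytic_diffeo U V \<phi> \<and>
      \<phi> ` (S \<inter> U) = V \<inter> {y. \<forall>i. i \<notin> I \<longrightarrow> y $ i = 0})"

end

theory Submission
  imports Defs "HOL-Complex_Analysis.Complex_Analysis" "HOL-Computational_Algebra.Fundamental_Theorem_Algebra"
begin

text \<open>
  Write \<open>D\<close> for the discriminant and fix \<open>x0\<close> in \<open>S\<close>. Since \<open>D\<close> has the same order \<open>\<mu>\<close> at all points of \<open>S\<close>,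
  for a suitable real direction \<open>w\<close> one has \<open>D(p + s w) = s^\<mu> E(p, s)\<close> with \<open>E\<close> nowhere zero for \<open>p\<close> in \<open>S\<close> near \<open>x0\<close>
  and small complex \<open>s\<close>. So in an affine chart of the projective line containing all roots over \<open>x0\<close>, the \<open>d\<close> complex
  roots over \<open>p + s w\<close> are simple for \<open>s \<noteq> 0\<close>, and with \<open>s = \<sigma>^N\<close>, \<open>N = d!\<close>, they are holomorphic functions
  \<open>z_1(\<sigma>), \<dots>, z_d(\<sigma>)\<close> on a disc whose differences have no zeros except possibly \<open>0\<close>. As \<open>p\<close> varies, these functions
  vary continuously on a circle around \<open>0\<close>, so by the minimum modulus principle the order of vanishing at \<open>0\<close> of
  \<open>z_i - z_j\<close> cannot drop. Hence roots that coincide over \<open>x0\<close> still coincide over nearby \<open>p\<close> in \<open>S\<close>; this is local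
  delineability, and simple connectedness of \<open>S\<close> globalises it through the theory of covering spaces.

  For the order of \<open>H\<close>, apply the same argument to \<open>z_i(\<omega> \<sigma>) - z_i(\<sigma>)\<close> with \<open>\<omega>\<close> a primitive \<open>N\<close>-th root of unity. It
  shows that \<open>min N (ord (z_i - z_i(0)))\<close> cannot drop, and the sum of these numbers over the branches through a root is \<open>N\<close>
  times the order of \<open>H\<close> there. So the order of \<open>H\<close> along a section is lower semicontinuous, and it is upper semicontinuous
  because partial derivatives are continuous.
\<close>

text \<open>Roots collide over \<open>x0\<close>, so they cannot be told apart on \<open>S\<close>
  itself; leaving \<open>S\<close> along a line separates them. Branches over different points are
  compared on one disc, so a single exponent must serve all nearby \<open>p\<close>. Monodromy
  permutes \<open>d\<close> roots and its cycle lengths divide \<open>d!\<close>: this is where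
  \<open>N\<close> comes from.

  The order of \<open>H\<close> at a point concerns all lines through it, whereas the branches over
  \<open>x0\<close> are expanded in one direction \<open>w\<close>. Two devices close the gap. The
  parameter is the pair \<open>(p, w)\<close>, so the comparison reaches all directions near
  \<open>w\<close>, and these suffice to determine the order of a polynomial. Moreover, order is
  handled as a rate of growth: a bound along lines over \<open>x0\<close> in direction
  \<open>w\<close> becomes a bound on the exponents of the branches, the exponents pass to the
  nearby pair, and there they yield a bound along every curve through the root that has a limiting
  slope.

  Real roots are followed inside the complex ones: the root near a real root is unique, hence equal
  to its conjugate. Lifting to a covering also requires local path connectedness, which the
  submanifold structure supplies.\<close>

hide_const (open) Poly_Mapping.degree

section \<open>Evaluation and derivatives of multivariate polynomials\<close>

text \<open>One evaluation map for several targets: \<open>h\<close> is the identity for real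
  points, \<open>complex_of_real\<close> for complex points, and the embedding of constants when
  polynomials are substituted, as in the restriction to a line.\<close>

definition mp_eval_hom :: "(real \<Rightarrow> 'a) \<Rightarrow> ('v \<Rightarrow> 'a) \<Rightarrow> 'v mpoly \<Rightarrow> 'a::comm_ring_1" where
  "mp_eval_hom h a p = (\<Sum>m\<in>Poly_Mapping.keys p.
     h (Poly_Mapping.lookup p m) * (\<Prod>i\<in>Poly_Mapping.keys m. a i ^ Poly_Mapping.lookup m i))"

lemma mp_eval_hom_id: "mp_eval_hom (\<lambda>c. c) a p = mp_eval a p"
  unfolding mp_eval_hom_def mp_eval_def by simp

lemma prod_keys_superset:
  fixes a :: "'v \<Rightarrow> 'a::comm_ring_1"
  assumes "finite A" "Poly_Mapping.keys m \<subseteq> A"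
  shows "(\<Prod>i\<in>Poly_Mapping.keys m. a i ^ Poly_Mapping.lookup m i) = (\<Prod>i\<in>A. a i ^ Poly_Mapping.lookup m i)"
  by (rule prod.mono_neutral_left) (use assms in \<open>auto simp: in_keys_iff\<close>)

lemma prod_keys_add:
  fixes a :: "'v \<Rightarrow> 'a::comm_ring_1"
  shows "(\<Prod>i\<in>Poly_Mapping.keys (m + n). a i ^ Poly_Mapping.lookup (m + n) i)
    = (\<Prod>i\<in>Poly_Mapping.keys m. a i ^ Poly_Mapping.lookup m i) * (\<Prod>i\<in>Poly_Mapping.keys n. a i ^ Poly_Mapping.lookup n i)"
proof -
  let ?A = "Poly_Mapping.keys m \<union> Poly_Mapping.keys n"
  have f: "finite ?A" by simp
  have mn: "Poly_Mapping.keys (m + n) \<subseteq> ?A" by (rule keys_add)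
  show ?thesis
    unfolding prod_keys_superset[OF f Un_upper1] prod_keys_superset[OF f Un_upper2] prod_keys_superset[OF f mn]
    by (simp add: lookup_add power_add prod.distrib)
qed

lemma prod_keys_sum_single:
  fixes a :: "'v \<Rightarrow> 'a::comm_ring_1" and f :: "'w \<Rightarrow> 'v"
  shows "(\<Prod>j\<in>Poly_Mapping.keys (\<Sum>i\<in>A. Poly_Mapping.single (f i) (g i)).
       a j ^ Poly_Mapping.lookup (\<Sum>i\<in>A. Poly_Mapping.single (f i) (g i)) j) = (\<Prod>i\<in>A. a (f i) ^ g i)"
proof (induction A rule: infinite_finite_induct)
  case (insert x A)
  have "(\<Prod>j\<in>Poly_Mapping.keys (Poly_Mapping.single (f x) (g x)).
     a j ^ Poly_Mapping.lookup (Poly_Mapping.single (f x) (g x)) j) = a (f x) ^ g x"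
    by (cases "g x = 0") auto
  then show ?case
    unfolding sum.insert[OF insert.hyps] prod.insert[OF insert.hyps] prod_keys_add insert.IH by (rule arg_cong)
qed auto

locale real_hom =
  fixes h :: "real \<Rightarrow> 'a::comm_ring_1"
  assumes h_add: "h (x + y) = h x + h y" and h_mult: "h (x * y) = h x * h y" and h_one: "h 1 = 1"
begin

lemma h_zero: "h 0 = 0"
  using h_add[of 0 0] by simp

lemma eval_superset:
  assumes "finite A" "Poly_Mapping.keys p \<subseteq> A"
  shows "mp_eval_hom h a p = (\<Sum>m\<in>A. h (Poly_Mapping.lookup p m) * (\<Prod>i\<in>Poly_Mapping.keys m. a i ^ Poly_Mapping.lookup m i))"
  unfolding mp_eval_hom_def
  by (rule sum.mono_neutral_left) (use assms in \<open>auto simp: in_keys_iff h_zero\<close>)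

lemma eval_zero [simp]: "mp_eval_hom h a 0 = 0"
  by (simp add: mp_eval_hom_def)

lemma eval_add: "mp_eval_hom h a (p + q) = mp_eval_hom h a p + mp_eval_hom h a q"
proof -
  let ?A = "Poly_Mapping.keys p \<union> Poly_Mapping.keys q"
  have f: "finite ?A" by simp
  have pq: "Poly_Mapping.keys (p + q) \<subseteq> ?A" by (rule keys_add)
  show ?thesis
    unfolding eval_superset[OF f Un_upper1] eval_superset[OF f Un_upper2] eval_superset[OF f pq]
    by (simp add: lookup_add h_add distrib_right sum.distrib)
qed

lemma eval_sum: "mp_eval_hom h a (sum f A) = (\<Sum>x\<in>A. mp_eval_hom h a (f x))"
  by (induction A rule: infinite_finite_induct) (auto simp: eval_add)

lemma eval_single:
  "mp_eval_hom h a (Poly_Mapping.single m c) = h c * (\<Prod>i\<in>Poly_Mapping.keys m. a i ^ Poly_Mapping.lookup m i)"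
  by (cases "c = 0") (auto simp: mp_eval_hom_def h_zero)

lemma eval_uminus: "mp_eval_hom h a (- p) = - mp_eval_hom h a p"
  using eval_add[of a p "- p"] by (simp add: eq_neg_iff_add_eq_0 add.commute)

lemma eval_diff: "mp_eval_hom h a (p - q) = mp_eval_hom h a p - mp_eval_hom h a q"
  using eval_add[of a p "- q"] by (simp add: eval_uminus)

lemma eval_one [simp]: "mp_eval_hom h a 1 = 1"
  using eval_single[of a 0 1] by (simp add: h_one)

end

lemma mpoly_as_sum: "p = (\<Sum>m\<in>Poly_Mapping.keys p. Poly_Mapping.single m (Poly_Mapping.lookup p m))"
proof (rule poly_mapping_eqI)
  fix k
  show "Poly_Mapping.lookup p k = Poly_Mapping.lookup (\<Sum>m\<in>Poly_Mapping.keys p. Poly_Mapping.single m (Poly_Mapping.lookup p m)) k"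
    by (auto simp: lookup_sum lookup_single when_def in_keys_iff sum.delta)
qed

context real_hom begin

lemma eval_mult: "mp_eval_hom h a (p * q) = mp_eval_hom h a p * mp_eval_hom h a q"
proof -
  have "p * q = (\<Sum>m\<in>Poly_Mapping.keys p. \<Sum>n\<in>Poly_Mapping.keys q.
      Poly_Mapping.single (m + n) (Poly_Mapping.lookup p m * Poly_Mapping.lookup q n))"
    using arg_cong2[OF mpoly_as_sum[of p] mpoly_as_sum[of q], of "(*)"] by (simp only: sum_product mult_single)
  then have "mp_eval_hom h a (p * q) = (\<Sum>m\<in>Poly_Mapping.keys p. \<Sum>n\<in>Poly_Mapping.keys q.
      (h (Poly_Mapping.lookup p m) * (\<Prod>i\<in>Poly_Mapping.keys m. a i ^ Poly_Mapping.lookup m i)) *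
      (h (Poly_Mapping.lookup q n) * (\<Prod>i\<in>Poly_Mapping.keys n. a i ^ Poly_Mapping.lookup n i)))"
    by (simp add: eval_sum eval_single h_mult prod_keys_add ac_simps)
  then show ?thesis
    by (simp add: mp_eval_hom_def sum_product)
qed

lemma eval_power: "mp_eval_hom h a (p ^ k) = mp_eval_hom h a p ^ k"
  by (induction k) (auto simp: eval_mult)

lemma eval_const [simp]: "mp_eval_hom h a (mp_const c) = h c"
  unfolding mp_const_def by (simp add: eval_single)

lemma eval_var [simp]: "mp_eval_hom h a (mp_var i) = a i"
  unfolding mp_var_def by (simp add: eval_single h_one)

lemma eval_of_nat: "mp_eval_hom h a (of_nat n) = of_nat n"
  by (induction n) (auto simp: eval_add)

lemma eval_rename: "mp_eval_hom h a (mp_rename f p) = mp_eval_hom h (\<lambda>i. a (f i)) p"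
  unfolding mp_rename_def eval_sum eval_single prod_keys_sum_single
  by (rule mp_eval_hom_def[symmetric])

end

interpretation rid: real_hom "\<lambda>c. c"
  by unfold_locales auto

interpretation rcomplex: real_hom "complex_of_real"
  by unfold_locales auto

lemma real_hom_const_poly: "real_hom (\<lambda>c. [:c:] :: real poly)"
proof
  show "[:x * y:] = [:x:] * [:y:]" for x y :: real
    by (rule poly_eqI) (simp add: coeff_pCons split: nat.split)
  show "[:x + y:] = [:x:] + [:y:]" for x y :: real
    by (rule add_pCons[of x 0 y 0, simplified add_0_left, symmetric])
  show "[:1:] = (1 :: real poly)" by (rule pCons_one)
qed

interpretation rpoly: real_hom "\<lambda>c. [:c:] :: real poly"
  by (rule real_hom_const_poly)

lemmas mp_eval_simps = rid.eval_add[unfolded mp_eval_hom_id] rid.eval_mult[unfolded mp_eval_hom_id]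
  rid.eval_power[unfolded mp_eval_hom_id] rid.eval_sum[unfolded mp_eval_hom_id] rid.eval_diff[unfolded mp_eval_hom_id]
  rid.eval_const[unfolded mp_eval_hom_id] rid.eval_var[unfolded mp_eval_hom_id] rid.eval_one[unfolded mp_eval_hom_id]
  rid.eval_zero[unfolded mp_eval_hom_id] rid.eval_rename[unfolded mp_eval_hom_id] rid.eval_uminus[unfolded mp_eval_hom_id]

text \<open>Truncated subtraction of exponents leaves a monomial free of variable \<open>i\<close>
  unchanged, but such a monomial carries the factor 0. Hence exactly one monomial of
  \<open>f\<close> contributes to each coefficient.\<close>

lemma lookup_mp_pderiv:
  "Poly_Mapping.lookup (mp_pderiv i f) m =
    real (Poly_Mapping.lookup m i + 1) * Poly_Mapping.lookup f (m + Poly_Mapping.single i 1)"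
proof -
  let ?e = "Poly_Mapping.single i (1::nat)"
  have "Poly_Mapping.lookup (mp_pderiv i f) m = (\<Sum>k\<in>Poly_Mapping.keys f.
      (real (Poly_Mapping.lookup k i) * Poly_Mapping.lookup f k when k - ?e = m))"
    by (simp add: mp_pderiv_def lookup_sum lookup_single)
  also have "\<dots> = (\<Sum>k\<in>Poly_Mapping.keys f. if k = m + ?e then real (Poly_Mapping.lookup k i) * Poly_Mapping.lookup f k else 0)"
  proof (rule sum.cong[OF refl])
    fix k
    have 1: "k = m + ?e" if km: "k - ?e = m" and ki: "Poly_Mapping.lookup k i \<noteq> 0"
    proof (rule poly_mapping_eqI)
      fix j
      have "Poly_Mapping.lookup m j = Poly_Mapping.lookup k j - Poly_Mapping.lookup ?e j"
        unfolding km[symmetric] by (rule lookup_minus)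
      then show "Poly_Mapping.lookup k j = Poly_Mapping.lookup (m + ?e) j"
        using ki by (cases "i = j") (simp_all add: lookup_add lookup_single)
    qed
    have 2: "(k - ?e = m) = (k = m + ?e)" if "Poly_Mapping.lookup k i \<noteq> 0"
    proof
      show "k - ?e = m" if "k = m + ?e" unfolding that by (rule add_diff_cancel_right')
    qed (rule 1[OF _ that])
    show "(real (Poly_Mapping.lookup k i) * Poly_Mapping.lookup f k when k - ?e = m) =
       (if k = m + ?e then real (Poly_Mapping.lookup k i) * Poly_Mapping.lookup f k else 0)"
    proof (cases "Poly_Mapping.lookup k i = 0")
      case False
      show ?thesis unfolding 2[OF False] by (simp only: when_def)
    qed auto
  qed
  also have "\<dots> = real (Poly_Mapping.lookup m i + 1) * Poly_Mapping.lookup f (m + ?e)"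
    by (auto simp: sum.delta in_keys_iff lookup_add)
  finally show ?thesis .
qed

lemma mp_pderiv_commute: "mp_pderiv i (mp_pderiv j f) = mp_pderiv j (mp_pderiv i f)"
  by (rule poly_mapping_eqI, cases "i = j") (auto simp: lookup_mp_pderiv lookup_add lookup_single ac_simps)

lemma mp_pderiv_add: "mp_pderiv i (f + g) = mp_pderiv i f + mp_pderiv i g"
  by (rule poly_mapping_eqI) (auto simp: lookup_mp_pderiv lookup_add algebra_simps)

lemma mp_pderiv_zero [simp]: "mp_pderiv i 0 = 0"
  by (rule poly_mapping_eqI) (auto simp: lookup_mp_pderiv)

lemma mp_pderiv_sum: "mp_pderiv i (sum f A) = (\<Sum>x\<in>A. mp_pderiv i (f x))"
  by (induction A rule: infinite_finite_induct) (auto simp: mp_pderiv_add)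

lemma mp_pderiv_single: "mp_pderiv i (Poly_Mapping.single m c) =
   Poly_Mapping.single (m - Poly_Mapping.single i 1) (real (Poly_Mapping.lookup m i) * c)"
  by (cases "c = 0") (auto simp: mp_pderiv_def)

lemma mp_eval_single_finite:
  fixes a :: "'v::finite \<Rightarrow> real"
  shows "mp_eval a (Poly_Mapping.single m c) = c * (\<Prod>i\<in>UNIV. a i ^ Poly_Mapping.lookup m i)"
  using rid.eval_single[of a m c] by (simp add: mp_eval_hom_id prod_keys_superset[of UNIV])

text \<open>Ties the formal partial derivatives to analysis. Both sides are additive in
  \<open>f\<close>, and on a monomial this is the product rule.\<close>

lemma mp_eval_line_deriv:
  fixes a e :: "'v::finite \<Rightarrow> real"
  shows "((\<lambda>s. mp_eval (\<lambda>i. a i + s * e i) f) has_real_derivative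
     (\<Sum>i\<in>UNIV. e i * mp_eval (\<lambda>i. a i + s * e i) (mp_pderiv i f))) (at s)"
proof -
  have single: "((\<lambda>s. mp_eval (\<lambda>i. a i + s * e i) (Poly_Mapping.single m c)) has_real_derivative
     (\<Sum>i\<in>UNIV. e i * mp_eval (\<lambda>i. a i + s * e i) (mp_pderiv i (Poly_Mapping.single m c)))) (at s)" for m c
  proof -
    let ?f = "\<lambda>i s. (a i + s * e i) ^ Poly_Mapping.lookup m i"
    let ?f' = "\<lambda>i. real (Poly_Mapping.lookup m i) * (a i + s * e i) ^ (Poly_Mapping.lookup m i - 1) * e i"
    have d: "(?f i has_real_derivative ?f' i) (at s)" for i
      by (auto intro!: derivative_eq_intros)
    have "((\<lambda>s. \<Prod>i\<in>UNIV. ?f i s) has_real_derivative (\<Sum>i\<in>UNIV. ?f' i * (\<Prod>j\<in>UNIV - {i}. ?f j s))) (at s)"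
      by (rule has_field_derivative_prod) (rule d)
    then have "((\<lambda>s. c * (\<Prod>i\<in>UNIV. ?f i s)) has_real_derivative (c * (\<Sum>i\<in>UNIV. ?f' i * (\<Prod>j\<in>UNIV - {i}. ?f j s)))) (at s)"
      by (rule DERIV_cmult)
    moreover have "c * (\<Sum>i\<in>UNIV. ?f' i * (\<Prod>j\<in>UNIV - {i}. ?f j s)) =
       (\<Sum>i\<in>UNIV. e i * mp_eval (\<lambda>i. a i + s * e i) (mp_pderiv i (Poly_Mapping.single m c)))"
      unfolding sum_distrib_left
    proof (rule sum.cong[OF refl])
      fix i :: 'v
      have "(\<Prod>j\<in>UNIV. (a j + s * e j) ^ Poly_Mapping.lookup (m - Poly_Mapping.single i 1) j) =
        (a i + s * e i) ^ (Poly_Mapping.lookup m i - 1) * (\<Prod>j\<in>UNIV - {i}. ?f j s)"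
        by (subst prod.remove[of _ i]) (auto simp: lookup_minus lookup_single intro!: prod.cong)
      then show "c * (?f' i * (\<Prod>j\<in>UNIV - {i}. ?f j s)) = e i * mp_eval (\<lambda>i. a i + s * e i) (mp_pderiv i (Poly_Mapping.single m c))"
        unfolding mp_pderiv_single mp_eval_single_finite by (simp add: ac_simps)
    qed
    ultimately show ?thesis
      by (simp add: mp_eval_single_finite)
  qed
  have "((\<lambda>s. \<Sum>m\<in>Poly_Mapping.keys f. mp_eval (\<lambda>i. a i + s * e i) (Poly_Mapping.single m (Poly_Mapping.lookup f m))) has_real_derivative
     (\<Sum>m\<in>Poly_Mapping.keys f. \<Sum>i\<in>UNIV. e i * mp_eval (\<lambda>i. a i + s * e i) (mp_pderiv i (Poly_Mapping.single m (Poly_Mapping.lookup f m))))) (at s)"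
    by (rule DERIV_sum) (rule single)
  moreover have "(\<Sum>m\<in>Poly_Mapping.keys f. mp_eval b (Poly_Mapping.single m (Poly_Mapping.lookup f m))) = mp_eval b f" for b
    using arg_cong[OF mpoly_as_sum[of f], of "mp_eval b"] by (simp only: mp_eval_simps)
  moreover have "(\<Sum>m\<in>Poly_Mapping.keys f. \<Sum>i\<in>UNIV. e i * mp_eval b (mp_pderiv i (Poly_Mapping.single m (Poly_Mapping.lookup f m))))
    = (\<Sum>i\<in>UNIV. e i * mp_eval b (mp_pderiv i f))" for b
  proof -
    have "mp_eval b (mp_pderiv i f) =
      (\<Sum>m\<in>Poly_Mapping.keys f. mp_eval b (mp_pderiv i (Poly_Mapping.single m (Poly_Mapping.lookup f m))))" for i
      using arg_cong[OF mpoly_as_sum[of f], of "\<lambda>p. mp_eval b (mp_pderiv i p)"]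
      by (simp only: mp_pderiv_sum mp_eval_simps)
    then show ?thesis
      by (subst sum.swap) (simp add: sum_distrib_left)
  qed
  ultimately show ?thesis by simp
qed

section \<open>Order of vanishing and restriction to lines\<close>

definition line_poly :: "('v \<Rightarrow> real) \<Rightarrow> ('v \<Rightarrow> real) \<Rightarrow> 'v mpoly \<Rightarrow> real poly" where
  "line_poly a w f = mp_eval_hom (\<lambda>c. [:c:]) (\<lambda>i. [:a i, w i:]) f"

text \<open>The homogeneous part of degree \<open>k\<close> of the Taylor expansion of
  \<open>f\<close> at \<open>a\<close>, as a function of the direction \<open>w\<close>.\<close>

definition taylor_form :: "nat \<Rightarrow> 'v mpoly \<Rightarrow> ('v \<Rightarrow> real) \<Rightarrow> ('v \<Rightarrow> real) \<Rightarrow> real" where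
  "taylor_form k f a w = coeff (line_poly a w f) k"

lemma poly_line_poly: "poly (line_poly a w f) s = mp_eval (\<lambda>i. a i + s * w i) f"
  unfolding line_poly_def mp_eval_hom_def mp_eval_def
  by (simp add: poly_sum poly_prod)

interpretation of_real_poly: map_poly_inj_idom_hom complex_of_real ..

lemma poly_of_real_line_poly:
  "poly (map_poly complex_of_real (line_poly a w f)) s =
    mp_eval_hom complex_of_real (\<lambda>i. of_real (a i) + s * of_real (w i)) f"
  unfolding line_poly_def mp_eval_hom_def
  unfolding of_real_poly.hom_sum of_real_poly.hom_prod of_real_poly.hom_mult of_real_poly.hom_power
  by (simp add: poly_sum poly_prod of_real_hom.map_poly_pCons_hom)

lemma line_poly_mult: "line_poly a w (f * g) = line_poly a w f * line_poly a w g"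
  unfolding line_poly_def by (rule rpoly.eval_mult)

lemma pderiv_line_poly:
  fixes a w :: "'v::finite \<Rightarrow> real"
  shows "pderiv (line_poly a w f) = (\<Sum>i\<in>UNIV. Polynomial.smult (w i) (line_poly a w (mp_pderiv i f)))"
proof -
  have "poly (pderiv (line_poly a w f)) s = poly (\<Sum>i\<in>UNIV. Polynomial.smult (w i) (line_poly a w (mp_pderiv i f))) s" for s
  proof -
    have "(poly (line_poly a w f) has_real_derivative (\<Sum>i\<in>UNIV. w i * mp_eval (\<lambda>i. a i + s * w i) (mp_pderiv i f))) (at s)"
      using mp_eval_line_deriv[of a w f s] unfolding poly_line_poly[of a w f, symmetric] .
    from DERIV_unique[OF poly_DERIV this] show ?thesis
      by (simp add: poly_sum poly_line_poly)
  qed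
  then show ?thesis by (simp add: poly_eq_poly_eq_iff[symmetric] fun_eq_iff)
qed

lemma taylor_form_0: "taylor_form 0 f a w = mp_eval a f"
  using poly_line_poly[of a w f 0] by (simp add: taylor_form_def poly_0_coeff_0)

text \<open>Euler's relation for the Taylor forms, read off from the derivative of the restriction
  to a line.\<close>

lemma taylor_form_Suc:
  fixes a w :: "'v::finite \<Rightarrow> real"
  shows "real (Suc k) * taylor_form (Suc k) f a w = (\<Sum>i\<in>UNIV. w i * taylor_form k (mp_pderiv i f) a w)"
proof -
  have "coeff (pderiv (line_poly a w f)) k = (\<Sum>i\<in>UNIV. w i * taylor_form k (mp_pderiv i f) a w)"
    by (simp add: pderiv_line_poly coeff_sum taylor_form_def)
  then show ?thesis by (simp add: coeff_pderiv taylor_form_def)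
qed

lemma taylor_form_Suc':
  fixes a w :: "'v::finite \<Rightarrow> real"
  shows "taylor_form (Suc k) f a w = (\<Sum>i\<in>UNIV. w i * taylor_form k (mp_pderiv i f) a w) / real (Suc k)"
  using taylor_form_Suc[of k f a w] by (simp add: field_simps)

text \<open>Differentiating a Taylor form in the direction amounts to differentiating
  \<open>f\<close>. This is how vanishing on a set of directions is converted into vanishing of
  partial derivatives at \<open>a\<close>.\<close>

lemma taylor_form_deriv_direction:
  fixes a w :: "'v::finite \<Rightarrow> real"
  shows "((\<lambda>t. taylor_form (Suc k) f a (w(j := t))) has_real_derivative
     taylor_form k (mp_pderiv j f) a (w(j := t))) (at t)"
proof (induction k arbitrary: f)
  case 0
  have "((\<lambda>t. \<Sum>i\<in>UNIV. (w(j := t)) i * mp_eval a (mp_pderiv i f)) has_real_derivative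
    (\<Sum>i\<in>UNIV. (if i = j then 1 else 0) * mp_eval a (mp_pderiv i f))) (at t)"
  proof (rule DERIV_sum)
    fix i
    show "((\<lambda>t. (w(j := t)) i * mp_eval a (mp_pderiv i f)) has_real_derivative
       (if i = j then 1 else 0) * mp_eval a (mp_pderiv i f)) (at t)"
      by (cases "i = j") (auto intro!: derivative_eq_intros)
  qed
  then show ?case by (simp add: taylor_form_Suc' taylor_form_0 if_distrib[of "\<lambda>c. c * _"] cong: if_cong)
next
  case (Suc k)
  let ?T = "\<lambda>k f. taylor_form k f a (w(j := t))"
  have "((\<lambda>t. \<Sum>i\<in>UNIV. (w(j := t)) i * taylor_form (Suc k) (mp_pderiv i f) a (w(j := t))) has_real_derivative
    (\<Sum>i\<in>UNIV. (if i = j then 1 else 0) * ?T (Suc k) (mp_pderiv i f) + (w(j := t)) i * ?T k (mp_pderiv j (mp_pderiv i f)))) (at t)"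
  proof (rule DERIV_sum)
    fix i
    have "((\<lambda>t. (w(j := t)) i) has_real_derivative (if i = j then 1 else 0)) (at t)"
      by (cases "i = j") (auto intro!: derivative_eq_intros)
    from DERIV_cong[OF DERIV_mult[OF this Suc.IH[of "mp_pderiv i f"]]]
    show "((\<lambda>t. (w(j := t)) i * taylor_form (Suc k) (mp_pderiv i f) a (w(j := t))) has_real_derivative
       (if i = j then 1 else 0) * ?T (Suc k) (mp_pderiv i f) + (w(j := t)) i * ?T k (mp_pderiv j (mp_pderiv i f))) (at t)"
      by (simp only: mult.commute)
  qed
  moreover have "(\<Sum>i\<in>UNIV. (if i = j then 1 else 0) * ?T (Suc k) (mp_pderiv i f) + (w(j := t)) i * ?T k (mp_pderiv j (mp_pderiv i f)))
    = ?T (Suc k) (mp_pderiv j f) + (\<Sum>i\<in>UNIV. (w(j := t)) i * ?T k (mp_pderiv i (mp_pderiv j f)))"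
    unfolding sum.distrib mp_pderiv_commute[of j]
    by (simp add: if_distrib[of "\<lambda>c. c * _"] cong: if_cong)
  moreover have "(\<Sum>i\<in>UNIV. (w(j := t)) i * ?T k (mp_pderiv i (mp_pderiv j f))) = real (Suc k) * ?T (Suc k) (mp_pderiv j f)"
    by (rule taylor_form_Suc[symmetric])
  \<comment> \<open>One copy comes from differentiating the coordinate \<open>w j\<close>, the other
    \<open>k + 1\<close> copies from Euler's relation for \<open>mp_pderiv j f\<close>; together
    they cancel the denominator \<open>k + 2\<close> of the recursion.\<close>
  moreover have "?T (Suc k) (mp_pderiv j f) + real (Suc k) * ?T (Suc k) (mp_pderiv j f) = real (Suc (Suc k)) * ?T (Suc k) (mp_pderiv j f)"
    by (simp add: algebra_simps)
  ultimately have "((\<lambda>t. \<Sum>i\<in>UNIV. (w(j := t)) i * taylor_form (Suc k) (mp_pderiv i f) a (w(j := t))) has_real_derivative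
     real (Suc (Suc k)) * ?T (Suc k) (mp_pderiv j f)) (at t)" by simp
  from DERIV_cdivide[OF this, of "real (Suc (Suc k))"] show ?case
    by (subst taylor_form_Suc') simp
qed

text \<open>Openness along each coordinate line separately. Taylor forms are differentiated one
  coordinate at a time, and for that this suffices.\<close>

definition coord_open :: "('v \<Rightarrow> real) set \<Rightarrow> bool" where
  "coord_open W \<longleftrightarrow> (\<forall>w\<in>W. \<forall>j. \<exists>\<delta>>0. \<forall>t. \<bar>w j - t\<bar> < \<delta> \<longrightarrow> w(j := t) \<in> W)"

lemma coord_open_UNIV [simp]: "coord_open UNIV"
  by (auto simp: coord_open_def intro: exI[of _ 1])

lemma isCont_taylor_form_direction:
  fixes a w :: "'v::finite \<Rightarrow> real"
  shows "isCont (\<lambda>t. taylor_form k f a (w(j := t))) t"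
  by (cases k) (auto simp: taylor_form_0 intro: DERIV_isCont[OF taylor_form_deriv_direction])

lemma coord_open_taylor_form_nonzero:
  fixes a :: "'v::finite \<Rightarrow> real"
  shows "coord_open {w. taylor_form k f a w \<noteq> 0}"
  unfolding coord_open_def
proof (intro ballI allI)
  fix w :: "'v \<Rightarrow> real" and j
  assume w: "w \<in> {w. taylor_form k f a w \<noteq> 0}"
  from continuous_at_avoid[OF isCont_taylor_form_direction[where k = k and f = f and a = a and w = w and j = j and t = "w j"], of 0] w
  obtain e where e: "e > 0" "\<And>y. dist (w j) y < e \<Longrightarrow> taylor_form k f a (w(j := y)) \<noteq> 0"
    by auto
  then show "\<exists>\<delta>>0. \<forall>t. \<bar>w j - t\<bar> < \<delta> \<longrightarrow> w(j := t) \<in> {w. taylor_form k f a w \<noteq> 0}"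
    by (auto simp: dist_real_def)
qed

text \<open>A form that vanishes on a coordinatewise open set has vanishing coordinate derivatives
  there, so every entry of the list lowers the degree by one until only a value at \<open>a\<close>
  remains. The induction removes the last entry because \<open>foldr\<close> applies that one
  first.\<close>

lemma partial_derivs_zero_if_taylor_form_zero:
  fixes a :: "'v::finite \<Rightarrow> real"
  assumes W: "coord_open W" "w \<in> W"
  shows "\<forall>w\<in>W. taylor_form (length is) f a w = 0 \<Longrightarrow> mp_eval a (foldr mp_pderiv is f) = 0"
proof (induction "is" arbitrary: f rule: rev_induct)
  case Nil
  then show ?case using W(2) by (auto simp: taylor_form_0)
next
  case (snoc j js)
  have "taylor_form (length js) (mp_pderiv j f) a v = 0" if "v \<in> W" for v
  proof -
    from W(1) that obtain \<delta> where \<delta>: "\<delta> > 0" "\<And>t. \<bar>v j - t\<bar> < \<delta> \<Longrightarrow> v(j := t) \<in> W"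
      unfolding coord_open_def by blast
    have "((\<lambda>t. taylor_form (Suc (length js)) f a (v(j := t))) has_real_derivative
        taylor_form (length js) (mp_pderiv j f) a (v(j := v j))) (at (v j))"
      by (rule taylor_form_deriv_direction)
    then have "taylor_form (length js) (mp_pderiv j f) a (v(j := v j)) = 0"
      by (rule DERIV_local_const[OF _ \<delta>(1)]) (use snoc.prems \<delta>(2) that in auto)
    then show ?thesis by simp
  qed
  with snoc.IH show ?case by simp
qed

lemma taylor_form_zero_if_partial_derivs_zero:
  fixes a w :: "'v::finite \<Rightarrow> real"
  assumes "\<And>is. length is = k \<Longrightarrow> mp_eval a (foldr mp_pderiv is f) = 0"
  shows "taylor_form k f a w = 0"
  using assms
proof (induction k arbitrary: f)
  case 0
  from 0[of "[]"] show ?case by (simp add: taylor_form_0)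
next
  case (Suc k)
  have "taylor_form k (mp_pderiv i f) a w = 0" for i
    by (rule Suc.IH) (use Suc.prems[of "_ @ [i]"] in simp)
  then show ?case by (simp add: taylor_form_Suc')
qed

lemma lookup_total_degree_pderiv:
  assumes "\<And>m. Poly_Mapping.lookup f m \<noteq> 0 \<Longrightarrow> (\<Sum>i\<in>UNIV. Poly_Mapping.lookup m (i::'v::finite)) \<le> Suc n"
    and "Poly_Mapping.lookup (mp_pderiv j f) m \<noteq> 0"
  shows "(\<Sum>i\<in>UNIV. Poly_Mapping.lookup m i) \<le> n"
proof -
  have "(\<Sum>i\<in>UNIV. Poly_Mapping.lookup (m + Poly_Mapping.single j 1) i) \<le> Suc n"
    using assms by (auto simp: lookup_mp_pderiv)
  moreover have "(\<Sum>i\<in>UNIV. Poly_Mapping.lookup (m + Poly_Mapping.single j 1) i) = (\<Sum>i\<in>UNIV. Poly_Mapping.lookup m i) + 1"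
    by (simp add: lookup_add sum.distrib lookup_single when_def)
  ultimately show ?thesis by simp
qed

text \<open>Gives the \<open>LEAST\<close> in \<open>mp_ord\<close> a meaning. Induction on a bound
  for the total degree: either some partial derivative is nonzero and has a smaller bound, or all of
  them vanish and \<open>f\<close> is a nonzero constant.\<close>

lemma ex_nonzero_partial_deriv:
  fixes f :: "('v::finite) mpoly"
  assumes "f \<noteq> 0"
  shows "\<exists>is. mp_eval a (foldr mp_pderiv is f) \<noteq> 0"
proof -
  have "\<exists>is. mp_eval a (foldr mp_pderiv is f) \<noteq> 0"
    if "f \<noteq> 0" "\<And>m. Poly_Mapping.lookup f m \<noteq> 0 \<Longrightarrow> (\<Sum>i\<in>UNIV. Poly_Mapping.lookup m i) \<le> n" for f :: "'v mpoly" and n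
    using that
  proof (induction n arbitrary: f)
    case 0
    have "m = 0" if "Poly_Mapping.lookup f m \<noteq> 0" for m
      using 0(2)[OF that] by (intro poly_mapping_eqI) auto
    then have k: "Poly_Mapping.keys f \<subseteq> {0}" by (auto simp: in_keys_iff)
    with 0(1) have "Poly_Mapping.keys f = {0}" by (metis keys_eq_empty subset_singletonD)
    then have "mp_eval a f \<noteq> 0" by (auto simp: mp_eval_def in_keys_iff[symmetric])
    then show ?case by (intro exI[of _ "[]"]) simp
  next
    case (Suc n)
    show ?case
    proof (cases "\<exists>j. mp_pderiv j f \<noteq> 0")
      case True
      then obtain j where j: "mp_pderiv j f \<noteq> 0" by blast
      obtain is' where "mp_eval a (foldr mp_pderiv is' (mp_pderiv j f)) \<noteq> 0"
        using Suc.IH[OF j] lookup_total_degree_pderiv[OF Suc.prems(2)] by blast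
      then show ?thesis by (intro exI[of _ "is' @ [j]"]) simp
    next
      case False
      have "m = 0" if m: "Poly_Mapping.lookup f m \<noteq> 0" for m
      proof (rule ccontr)
        assume "m \<noteq> 0"
        then obtain j where j: "Poly_Mapping.lookup m j \<noteq> 0" by (metis poly_mapping_eqI lookup_zero)
        let ?m = "m - Poly_Mapping.single j 1"
        have "?m + Poly_Mapping.single j 1 = m"
          using j by (intro poly_mapping_eqI) (auto simp: lookup_add lookup_minus lookup_single when_def)
        then have "Poly_Mapping.lookup (mp_pderiv j f) ?m \<noteq> 0"
          unfolding lookup_mp_pderiv using m by simp
        with False show False by auto
      qed
      then have k: "Poly_Mapping.keys f \<subseteq> {0}" by (auto simp: in_keys_iff)
      with Suc.prems(1) have "Poly_Mapping.keys f = {0}" by (metis keys_eq_empty subset_singletonD)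
      then have "mp_eval a f \<noteq> 0" by (auto simp: mp_eval_def in_keys_iff[symmetric])
      then show ?thesis by (intro exI[of _ "[]"]) simp
    qed
  qed
  moreover have "(\<Sum>i\<in>UNIV. Poly_Mapping.lookup m i) \<le> (\<Sum>m\<in>Poly_Mapping.keys f. \<Sum>i\<in>UNIV. Poly_Mapping.lookup m i)"
    if "Poly_Mapping.lookup f m \<noteq> 0" for m
    using that by (intro member_le_sum) (auto simp: in_keys_iff)
  ultimately show ?thesis using assms by blast
qed

lemma mp_ord_attained:
  fixes f :: "('v::finite) mpoly"
  assumes "f \<noteq> 0"
  shows "\<exists>is. length is = mp_ord f a \<and> mp_eval a (foldr mp_pderiv is f) \<noteq> 0"
  unfolding mp_ord_def by (rule LeastI_ex) (use ex_nonzero_partial_deriv[OF assms] in blast)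

lemma partial_deriv_below_mp_ord:
  "length is < mp_ord f a \<Longrightarrow> mp_eval a (foldr mp_pderiv is f) = 0"
  unfolding mp_ord_def using not_less_Least by blast

lemma mp_ord_le: "mp_eval a (foldr mp_pderiv is f) \<noteq> 0 \<Longrightarrow> mp_ord f a \<le> length is"
  using partial_deriv_below_mp_ord not_le by blast

lemma taylor_form_below_mp_ord:
  fixes a w :: "'v::finite \<Rightarrow> real"
  shows "k < mp_ord f a \<Longrightarrow> taylor_form k f a w = 0"
  by (rule taylor_form_zero_if_partial_derivs_zero) (simp add: partial_deriv_below_mp_ord)

text \<open>The order is detected inside any nonempty coordinatewise open set of directions. This
  allows the directions to be confined later to a neighbourhood of one fixed
  \<open>w\<close>.\<close>

lemma ex_taylor_form_mp_ord_nonzero: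
  fixes f :: "('v::finite) mpoly"
  assumes "f \<noteq> 0" "coord_open W" "W \<noteq> {}"
  shows "\<exists>w\<in>W. taylor_form (mp_ord f a) f a w \<noteq> 0"
proof (rule ccontr)
  assume "\<not> ?thesis"
  moreover obtain js where "length js = mp_ord f a" "mp_eval a (foldr mp_pderiv js f) \<noteq> 0"
    using mp_ord_attained[OF assms(1)] by blast
  moreover obtain w where "w \<in> W" using assms(3) by blast
  ultimately show False using partial_derivs_zero_if_taylor_form_zero[OF assms(2), of w js f a] by auto
qed

lemma mp_ord_geI:
  fixes f :: "('v::finite) mpoly"
  assumes "f \<noteq> 0" "coord_open W" "W \<noteq> {}" "\<And>k w. k < n \<Longrightarrow> w \<in> W \<Longrightarrow> taylor_form k f a w = 0"
  shows "n \<le> mp_ord f a"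
  using ex_taylor_form_mp_ord_nonzero[OF assms(1-3), of a] assms(4) by (meson not_le)

text \<open>There is a direction in which the lowest Taylor forms of both factors at the origin are
  nonzero; restricting to that line reduces the claim to univariate polynomials.\<close>

lemma mpoly_no_zero_divisors:
  fixes f g :: "('v::finite) mpoly"
  assumes "f \<noteq> 0" "g \<noteq> 0"
  shows "f * g \<noteq> 0"
proof
  assume fg: "f * g = 0"
  let ?a = "\<lambda>i::'v. 0::real"
  let ?W = "{w. taylor_form (mp_ord f ?a) f ?a w \<noteq> 0}"
  have "?W \<noteq> {}" using ex_taylor_form_mp_ord_nonzero[OF assms(1), of UNIV ?a] by auto
  then obtain w where w: "w \<in> ?W" "taylor_form (mp_ord g ?a) g ?a w \<noteq> 0"
    using ex_taylor_form_mp_ord_nonzero[OF assms(2) coord_open_taylor_form_nonzero] by blast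
  then have "line_poly ?a w f \<noteq> 0" "line_poly ?a w g \<noteq> 0" by (auto simp: taylor_form_def)
  then have "line_poly ?a w (f * g) \<noteq> 0" by (simp add: line_poly_mult)
  then show False using fg by (simp add: line_poly_def)
qed

lemma mpoly_eqI:
  fixes f g :: "('v::finite) mpoly"
  assumes "\<And>a. mp_eval a f = mp_eval a g"
  shows "f = g"
proof (rule ccontr)
  assume "f \<noteq> g"
  then have ne: "f - g \<noteq> 0" by simp
  have "line_poly (\<lambda>_. 0) w (f - g) = 0" for w
    by (simp add: poly_eq_poly_eq_iff[symmetric] fun_eq_iff poly_line_poly mp_eval_simps assms)
  then have "taylor_form k (f - g) (\<lambda>_. 0) w = 0" for k w by (simp add: taylor_form_def)
  then show False using ex_taylor_form_mp_ord_nonzero[OF ne, of UNIV "\<lambda>_. 0"] by auto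
qed

text \<open>The bound is uniform in base point and direction, so the restrictions to all lines are
  sums over one fixed index range, with coefficients that vary continuously.\<close>

lemma degree_line_poly_bound: "\<exists>M. \<forall>a w. degree (line_poly a w f) \<le> M"
proof -
  let ?M = "\<Sum>m\<in>Poly_Mapping.keys f. \<Sum>i\<in>Poly_Mapping.keys m. Poly_Mapping.lookup m i"
  have "degree (line_poly a w f) \<le> ?M" for a w
    unfolding line_poly_def mp_eval_hom_def
  proof (rule degree_sum_le)
    fix m assume m: "m \<in> Poly_Mapping.keys f"
    have "degree ([:Poly_Mapping.lookup f m:] * (\<Prod>i\<in>Poly_Mapping.keys m. [:a i, w i:] ^ Poly_Mapping.lookup m i))
       \<le> degree (\<Prod>i\<in>Poly_Mapping.keys m. [:a i, w i:] ^ Poly_Mapping.lookup m i)"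
      by simp
    also have "\<dots> \<le> (\<Sum>i\<in>Poly_Mapping.keys m. degree ([:a i, w i:] ^ Poly_Mapping.lookup m i))"
      using degree_prod_sum_le[OF finite_keys, of "\<lambda>i. [:a i, w i:] ^ Poly_Mapping.lookup m i"] by (simp add: o_def)
    also have "\<dots> \<le> (\<Sum>i\<in>Poly_Mapping.keys m. Poly_Mapping.lookup m i)"
    proof (rule sum_mono)
      fix i
      have "degree ([:a i, w i:] ^ Poly_Mapping.lookup m i) \<le> degree [:a i, w i:] * Poly_Mapping.lookup m i"
        by (rule degree_power_le)
      also have "\<dots> \<le> 1 * Poly_Mapping.lookup m i" by (intro mult_right_mono) auto
      finally show "degree ([:a i, w i:] ^ Poly_Mapping.lookup m i) \<le> Poly_Mapping.lookup m i" by simp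
    qed
    also have "\<dots> \<le> ?M" using m by (intro member_le_sum) auto
    finally show "degree ([:Poly_Mapping.lookup f m:] * (\<Prod>i\<in>Poly_Mapping.keys m. [:a i, w i:] ^ Poly_Mapping.lookup m i)) \<le> ?M" .
  qed simp
  then show ?thesis by blast
qed

lemma continuous_on_mp_eval:
  assumes "\<And>i. continuous_on A (\<lambda>x. g x i)"
  shows "continuous_on A (\<lambda>x. mp_eval (g x) f)"
  unfolding mp_eval_def by (intro continuous_intros assms)

lemma continuous_on_mp_eval_complex:
  assumes "\<And>i. continuous_on A (\<lambda>x. g x i)"
  shows "continuous_on A (\<lambda>x. mp_eval_hom complex_of_real (g x) f)"
  unfolding mp_eval_hom_def by (intro continuous_intros assms)

lemma mp_eval_of_real: "mp_eval_hom complex_of_real (\<lambda>i. of_real (a i)) f = of_real (mp_eval a f)"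
  by (simp add: mp_eval_hom_def mp_eval_def)

text \<open>Order of vanishing as a growth rate. In this form orders can be passed between real
  lines and Puiseux branches, where only \<open>s > 0\<close> and its positive root matter.\<close>

lemma poly_bound_at_right_iff:
  fixes q :: "real poly"
  shows "(\<exists>C. \<forall>\<^sub>F s in at_right 0. \<bar>poly q s\<bar> \<le> C * s ^ n) \<longleftrightarrow> (\<forall>k<n. coeff q k = 0)"
proof
  assume "\<forall>k<n. coeff q k = 0"
  then have "monom 1 n dvd q" by (simp add: monom_1_dvd_iff')
  then obtain r where r: "q = monom 1 n * r" by (elim dvdE)
  have "((\<lambda>s. \<bar>poly r s\<bar>) \<longlongrightarrow> \<bar>poly r 0\<bar>) (at_right 0)"
    by (intro tendsto_intros)
  then have "\<forall>\<^sub>F s in at_right 0. \<bar>poly r s\<bar> < \<bar>poly r 0\<bar> + 1"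
    by (rule order_tendstoD) simp
  moreover have "\<forall>\<^sub>F s in at_right (0::real). s > 0" by (rule eventually_at_right_less)
  ultimately have "\<forall>\<^sub>F s in at_right 0. \<bar>poly q s\<bar> \<le> (\<bar>poly r 0\<bar> + 1) * s ^ n"
    by eventually_elim (simp add: r poly_monom abs_mult mult.commute mult_right_mono)
  then show "\<exists>C. \<forall>\<^sub>F s in at_right 0. \<bar>poly q s\<bar> \<le> C * s ^ n" by blast
next
  assume "\<exists>C. \<forall>\<^sub>F s in at_right 0. \<bar>poly q s\<bar> \<le> C * s ^ n"
  then obtain C where C: "\<forall>\<^sub>F s in at_right 0. \<bar>poly q s\<bar> \<le> C * s ^ n" by blast
  show "\<forall>k<n. coeff q k = 0"
  proof (rule ccontr)
    assume "\<not> (\<forall>k<n. coeff q k = 0)"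
    then obtain k0 where "k0 < n \<and> coeff q k0 \<noteq> 0" by blast
    then obtain k where k: "k < n" "coeff q k \<noteq> 0" and min: "\<And>j. j < k \<Longrightarrow> \<not> (j < n \<and> coeff q j \<noteq> 0)"
      using exists_least_iff[of "\<lambda>k. k < n \<and> coeff q k \<noteq> 0"] by blast
    then have "\<forall>j<k. coeff q j = 0" by auto
    then have "monom 1 k dvd q" by (simp add: monom_1_dvd_iff')
    then obtain r where r: "q = monom 1 k * r" by (elim dvdE)
    have r0: "poly r 0 \<noteq> 0" using k(2) by (simp add: r coeff_monom_mult poly_0_coeff_0)
    have "\<forall>\<^sub>F s in at_right (0::real). s > 0" by (rule eventually_at_right_less)
    with C have "\<forall>\<^sub>F s in at_right 0. \<bar>poly r s\<bar> \<le> C * s ^ (n - k)"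
    proof eventually_elim
      case (elim s)
      have "s ^ k * \<bar>poly r s\<bar> \<le> s ^ k * (C * s ^ (n - k))"
        using elim k(1) by (simp add: r poly_monom abs_mult power_add[symmetric] mult.left_commute)
      then show ?case using elim(2) by simp
    qed
    moreover have "((\<lambda>s. \<bar>poly r s\<bar>) \<longlongrightarrow> \<bar>poly r 0\<bar>) (at_right 0)"
      by (intro tendsto_intros)
    moreover have "((\<lambda>s. C * s ^ (n - k)) \<longlongrightarrow> C * 0 ^ (n - k)) (at_right 0)"
      by (intro tendsto_intros)
    ultimately have "\<bar>poly r 0\<bar> \<le> C * 0 ^ (n - k)"
      by (intro tendsto_le[OF trivial_limit_at_right_real]) auto
    then show False using r0 k(1) by (simp add: power_0_left)
  qed
qed

section \<open>The discriminant\<close>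

text \<open>The Sylvester matrix of \<open>P\<close> and its derivative with the leading coefficient cancelled from
  the first column; its determinant is the discriminant up to sign.\<close>

definition disc_mat :: "nat \<Rightarrow> 'a::comm_ring_1 poly \<Rightarrow> 'a mat" where
  "disc_mat d P = mat (d + (d - 1)) (d + (d - 1)) (\<lambda>(i, j).
     if j = 0 then (if i = 0 then 1 else if i = d - 1 then of_nat d else 0)
     else sylvester_mat_sub d (d - 1) P (deriv_xn P) $$ (i, j))"

lemma coeff_deriv_xn: "coeff (deriv_xn P) k = of_nat (Suc k) * coeff P (Suc k)"
proof -
  have "coeff (deriv_xn P) k = (\<Sum>j\<in>{1..degree P}. if j = Suc k then of_nat j * coeff P j else 0)"
    unfolding deriv_xn_def coeff_sum by (intro sum.cong) auto
  also have "\<dots> = of_nat (Suc k) * coeff P (Suc k)"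
    by (auto simp: sum.delta coeff_eq_0)
  finally show ?thesis .
qed

lemma sylvester_first_column:
  fixes P :: "'a::comm_ring_1 poly"
  assumes "d \<ge> 1" "i < d + (d - 1)"
  shows "sylvester_mat_sub d (d - 1) P (deriv_xn P) $$ (i, 0) = coeff P d * disc_mat d P $$ (i, 0)"
proof -
  have *: "coeff (deriv_xn P) (d - Suc 0) = of_nat d * coeff P d"
    using assms(1) by (simp add: coeff_deriv_xn del: of_nat_Suc)
  show ?thesis
    using assms by (auto simp: sylvester_mat_sub_index disc_mat_def * mult.commute)
qed

lemma det_sylvester_deriv:
  fixes P :: "'a::comm_ring_1 poly"
  assumes d: "d \<ge> 1"
  shows "Determinant.det (sylvester_mat_sub d (d - 1) P (deriv_xn P)) = coeff P d * Determinant.det (disc_mat d P)"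
proof -
  let ?n = "d + (d - 1)"
  let ?S = "sylvester_mat_sub d (d - 1) P (deriv_xn P)"
  let ?M = "disc_mat d P"
  have M: "?M \<in> carrier_mat ?n ?n" by (simp add: disc_mat_def)
  have S: "?S \<in> carrier_mat ?n ?n" by (rule sylvester_mat_sub_carrier)
  \<comment> \<open>Transposed because \<open>det_multrow\<close> scales a row, whereas the common
    factor sits in a column.\<close>
  have "transpose_mat ?S = mat_multrow_gen (*) 0 (coeff P d) (transpose_mat ?M)"
  proof (rule eq_matI)
    fix i j assume "i < dim_row (mat_multrow_gen (*) 0 (coeff P d) (transpose_mat ?M))"
      "j < dim_col (mat_multrow_gen (*) 0 (coeff P d) (transpose_mat ?M))"
    then have ij: "i < ?n" "j < ?n" by (simp_all add: disc_mat_def)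
    show "transpose_mat ?S $$ (i, j) = mat_multrow_gen (*) 0 (coeff P d) (transpose_mat ?M) $$ (i, j)"
    proof (cases "i = 0")
      case True
      then show ?thesis using ij M S sylvester_first_column[OF d ij(2)] by simp
    next
      case False
      then have "?M $$ (j, i) = ?S $$ (j, i)" using ij by (simp add: disc_mat_def)
      then show ?thesis using ij M S False by simp
    qed
  qed (use M S in auto)
  then have "Determinant.det (transpose_mat ?S) = coeff P d * Determinant.det (transpose_mat ?M)"
    using det_multrow[of 0 ?n "transpose_mat ?M" "coeff P d"] d M by simp
  then show ?thesis unfolding det_transpose[OF M] det_transpose[OF S] .
qed

text \<open>The leading coefficient is not a zero divisor, so the quotient selected by
  \<open>THE\<close> is unique, and \<open>disc_mat\<close> exhibits it.\<close>

lemma disc_xn_eq: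
  fixes P :: "('n::finite) mpoly poly"
  assumes d: "d = degree P" "d \<ge> 1"
  shows "disc_xn d P = (-1) ^ (d * (d - 1) div 2) * Determinant.det (disc_mat d P)"
proof -
  let ?c = "coeff P d"
  have c: "?c \<noteq> 0" using d by (metis leading_coeff_0_iff degree_0 not_one_le_zero)
  have "(THE D. ?c * D = (-1) ^ (d * (d - 1) div 2) * Determinant.det (sylvester_mat_sub d (d - 1) P (deriv_xn P)))
    = (-1) ^ (d * (d - 1) div 2) * Determinant.det (disc_mat d P)"
  proof (rule the_equality)
    show "?c * ((-1) ^ (d * (d - 1) div 2) * Determinant.det (disc_mat d P)) =
      (-1) ^ (d * (d - 1) div 2) * Determinant.det (sylvester_mat_sub d (d - 1) P (deriv_xn P))"
      unfolding det_sylvester_deriv[OF d(2)] by (rule mult.left_commute)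
    fix D
    assume "?c * D = (-1) ^ (d * (d - 1) div 2) * Determinant.det (sylvester_mat_sub d (d - 1) P (deriv_xn P))"
    then have "?c * (D - (-1) ^ (d * (d - 1) div 2) * Determinant.det (disc_mat d P)) = 0"
      unfolding det_sylvester_deriv[OF d(2)] right_diff_distrib by (simp only: mult.left_commute diff_self)
    then show "D = (-1) ^ (d * (d - 1) div 2) * Determinant.det (disc_mat d P)"
      using mpoly_no_zero_divisors[OF c] by (metis eq_iff_diff_eq_0)
  qed
  then show ?thesis using d(2) unfolding disc_xn_def by simp
qed

lemma comm_ring_hom_mp_eval_complex: "comm_ring_hom (mp_eval_hom complex_of_real a)"
  by unfold_locales (simp_all add: rcomplex.eval_add rcomplex.eval_mult)

text \<open>A kernel vector is exhibited. For a common root \<open>z\<close> of \<open>F\<close> and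
  its derivative it consists of powers of \<open>z\<close>, with entry 0 multiplied by
  \<open>coeff F d\<close> to make up for the factor taken out of the first column. The second
  alternative is a double root at infinity, which a discriminant of formal degree \<open>d\<close>
  must also see; there the second column is zero.\<close>

lemma det_disc_mat_zero:
  fixes F :: "complex poly"
  assumes d: "d \<ge> 2"
    and root: "(\<exists>z. (\<Sum>k\<le>d. coeff F k * z ^ k) = 0 \<and> (\<Sum>k\<le>d-1. of_nat (Suc k) * coeff F (Suc k) * z ^ k) = 0) \<or>
      (coeff F d = 0 \<and> coeff F (d - 1) = 0)"
  shows "Determinant.det (disc_mat d F) = 0"
proof -
  let ?n = "d + (d - 1)"
  let ?S = "sylvester_mat_sub d (d - 1) F (deriv_xn F)"
  let ?M = "disc_mat d F"
  have M: "?M \<in> carrier_mat ?n ?n" by (simp add: disc_mat_def)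
  have "\<exists>v. v \<in> carrier_vec ?n \<and> v \<noteq> 0\<^sub>v ?n \<and> ?M *\<^sub>v v = 0\<^sub>v ?n"
    using root
  proof
    assume "\<exists>z. (\<Sum>k\<le>d. coeff F k * z ^ k) = 0 \<and> (\<Sum>k\<le>d-1. of_nat (Suc k) * coeff F (Suc k) * z ^ k) = 0"
    then obtain z where z: "(\<Sum>k\<le>d. coeff F k * z ^ k) = 0"
      and z': "(\<Sum>k\<le>d-1. of_nat (Suc k) * coeff F (Suc k) * z ^ k) = 0" by blast
    let ?v = "vec ?n (\<lambda>j. if j = 0 then coeff F d * z ^ (2 * d - 2) else z ^ (2 * d - 2 - j))"
    \<comment> \<open>\<open>d >= 2\<close> keeps the last entry apart from the modified entry 0, so
      it is \<open>z ^ 0 = 1\<close> even if \<open>z = 0\<close>.\<close>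
    have v: "?v $ (2 * d - 2) = 1" using d by simp
    moreover have "0\<^sub>v ?n $ (2 * d - 2) = (0 :: complex)" using d by simp
    ultimately have "?v \<noteq> 0\<^sub>v ?n" by auto
    moreover have "?M *\<^sub>v ?v = 0\<^sub>v ?n"
    proof (rule eq_vecI)
      fix i assume "i < dim_vec (0\<^sub>v ?n :: complex vec)"
      then have i: "i < ?n" by simp
      have "(?M *\<^sub>v ?v) $ i = (\<Sum>j\<in>{0..<?n}. ?M $$ (i, j) * ?v $ j)"
        using M i by (simp add: scalar_prod_def)
      also have "\<dots> = (\<Sum>j\<in>{0..<?n}. ?S $$ (i, j) * z ^ (2 * d - 2 - j))"
      proof (rule sum.cong[OF refl])
        fix j assume "j \<in> {0..<?n}"
        then have j: "j < ?n" by simp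
        show "?M $$ (i, j) * ?v $ j = ?S $$ (i, j) * z ^ (2 * d - 2 - j)"
        proof (cases "j = 0")
          case True
          then show ?thesis using d j sylvester_first_column[of d i F] i by simp
        next
          case False
          then show ?thesis using i j by (simp add: disc_mat_def)
        qed
      qed
      also have "\<dots> = 0"
      proof (cases "i < d - 1")
        case True
        have "(\<Sum>j\<in>{0..<?n}. ?S $$ (i, j) * z ^ (2 * d - 2 - j)) = (\<Sum>j\<in>{i..i+d}. coeff F (d + i - j) * z ^ (2 * d - 2 - j))"
          by (rule sum.mono_neutral_cong_right) (use i True in \<open>auto simp: sylvester_mat_sub_index split: if_splits\<close>)
        also have "\<dots> = (\<Sum>k\<le>d. coeff F k * z ^ k * z ^ (d - 2 - i))"
          by (rule sum.reindex_bij_witness[of _ "\<lambda>k. d + i - k" "\<lambda>j. d + i - j"])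
            (use True in \<open>auto simp: power_add[symmetric] mult_2\<close>)
        also have "\<dots> = 0" using z by (simp add: sum_distrib_right[symmetric])
        finally show ?thesis .
      next
        case False
        have "(\<Sum>j\<in>{0..<?n}. ?S $$ (i, j) * z ^ (2 * d - 2 - j)) =
            (\<Sum>j\<in>{i-(d-1)..i}. of_nat (Suc (i - j)) * coeff F (Suc (i - j)) * z ^ (2 * d - 2 - j))"
          by (rule sum.mono_neutral_cong_right) (use i False in \<open>auto simp: sylvester_mat_sub_index coeff_deriv_xn\<close>)
        also have "\<dots> = (\<Sum>k\<le>d-1. of_nat (Suc k) * coeff F (Suc k) * z ^ k * z ^ (2 * d - 2 - i))"
          by (rule sum.reindex_bij_witness[of _ "\<lambda>k. i - k" "\<lambda>j. i - j"])
            (use i False in \<open>auto simp: power_add[symmetric]\<close>)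
        also have "\<dots> = 0" using z' by (simp add: sum_distrib_right[symmetric])
        finally show ?thesis .
      qed
      finally show "(?M *\<^sub>v ?v) $ i = 0\<^sub>v ?n $ i" using i by simp
    qed (use M in auto)
    ultimately show ?thesis by (intro exI[of _ ?v]) auto
  next
    assume c: "coeff F d = 0 \<and> coeff F (d - 1) = 0"
    let ?v = "unit_vec ?n 1 :: complex vec"
    have "?v \<noteq> 0\<^sub>v ?n" using d by simp
    moreover have "?M *\<^sub>v ?v = 0\<^sub>v ?n"
    proof (rule eq_vecI)
      fix i assume "i < dim_vec (0\<^sub>v ?n :: complex vec)"
      then have i: "i < ?n" by simp
      have 1: "1 < ?n" using d by simp
      have "(?M *\<^sub>v ?v) $ i = ?M $$ (i, 1)"
        using M i 1 by (simp add: scalar_prod_right_unit row_def)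
      also have "\<dots> = ?S $$ (i, 1)" using i 1 by (simp add: disc_mat_def)
      also have "\<dots> = 0"
      proof (cases "i < d - 1")
        case True
        have "d + i - 1 = d - 1 \<or> d + i - 1 = d" if "i \<le> 1" using that d by auto
        then show ?thesis using c True i 1 by (auto simp: sylvester_mat_sub_index)
      next
        case False
        have "Suc (i - 1) = d - 1 \<or> Suc (i - 1) = d" if "i - (d - 1) \<le> 1" "1 \<le> i" using that False d by auto
        then show ?thesis using c False i 1 by (auto simp: sylvester_mat_sub_index coeff_deriv_xn)
      qed
      finally show "(?M *\<^sub>v ?v) $ i = 0\<^sub>v ?n $ i" using i by simp
    qed (use M in auto)
    ultimately show ?thesis by (intro exI[of _ ?v]) auto
  qed
  then show ?thesis using det_0_iff_vec_prod_zero_field[OF M] by blast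
qed

text \<open>The sizes in \<open>sylvester_mat_sub\<close> are formal degrees, so substituting a
  complex point commutes with the determinant even where the leading coefficient vanishes.\<close>

lemma disc_xn_eval_zero:
  fixes P :: "('n::finite) mpoly poly" and y :: "'n \<Rightarrow> complex"
  defines "C \<equiv> \<lambda>k. mp_eval_hom complex_of_real y (coeff P k)"
  assumes d: "d = degree P" "d \<ge> 2"
    and root: "(\<exists>z. (\<Sum>k\<le>d. C k * z ^ k) = 0 \<and> (\<Sum>k\<le>d-1. of_nat (Suc k) * C (Suc k) * z ^ k) = 0) \<or>
      (C d = 0 \<and> C (d - 1) = 0)"
  shows "mp_eval_hom complex_of_real y (disc_xn d P) = 0"
proof -
  interpret h: comm_ring_hom "mp_eval_hom complex_of_real y" by (rule comm_ring_hom_mp_eval_complex)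
  let ?F = "map_poly (mp_eval_hom complex_of_real y) P"
  have F: "coeff ?F k = C k" for k by (simp add: C_def coeff_map_poly)
  have D: "deriv_xn ?F = map_poly (mp_eval_hom complex_of_real y) (deriv_xn P)"
    by (rule poly_eqI) (simp add: coeff_deriv_xn coeff_map_poly rcomplex.eval_mult rcomplex.eval_add rcomplex.eval_of_nat)
  have "map_mat (mp_eval_hom complex_of_real y) (disc_mat d P) = disc_mat d ?F"
  proof (rule eq_matI)
    fix i j assume ij: "i < dim_row (disc_mat d ?F)" "j < dim_col (disc_mat d ?F)"
    then have "i < d + (d - 1)" "j < d + (d - 1)" by (simp_all add: disc_mat_def)
    then show "map_mat (mp_eval_hom complex_of_real y) (disc_mat d P) $$ (i, j) = disc_mat d ?F $$ (i, j)"
      unfolding disc_mat_def D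
      by (auto simp: sylvester_mat_sub_index coeff_map_poly rcomplex.eval_of_nat)
  qed (auto simp: disc_mat_def)
  then have "mp_eval_hom complex_of_real y (Determinant.det (disc_mat d P)) = Determinant.det (disc_mat d ?F)"
    by (metis h.hom_det)
  also have "\<dots> = 0" by (rule det_disc_mat_zero[OF d(2)]) (use root in \<open>simp only: F\<close>)
  finally show ?thesis
    using d by (simp add: disc_xn_eq rcomplex.eval_mult)
qed

text \<open>The form of degree \<open>d\<close> with coefficients \<open>C\<close>, restricted to the affine chart \<open>(z : 1 + c z)\<close>.\<close>

definition chart_poly :: "nat \<Rightarrow> 'a::comm_ring_1 \<Rightarrow> (nat \<Rightarrow> 'a) \<Rightarrow> 'a poly" where
  "chart_poly d c C = (\<Sum>k\<le>d. [:C k:] * [:0, 1:] ^ k * [:1, c:] ^ (d - k))"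

lemma poly_chart_poly: "poly (chart_poly d c C) z = (\<Sum>k\<le>d. C k * z ^ k * (1 + c * z) ^ (d - k))"
  by (simp add: chart_poly_def poly_sum ac_simps)

text \<open>At a multiple root \<open>z\<close> both partial derivatives of the form vanish at
  \<open>(z, t)\<close> with \<open>t = 1 + c z\<close>: the derivative of the chart polynomial and
  Euler's relation are two linear equations for them with determinant \<open>t - c z = 1\<close>. So
  the form has a multiple root there, namely \<open>z / t\<close>, or infinity if
  \<open>t = 0\<close>, and the discriminant vanishes.\<close>

lemma chart_poly_rsquarefree:
  fixes P :: "('n::finite) mpoly poly" and y :: "'n \<Rightarrow> complex"
  defines "C \<equiv> \<lambda>k. mp_eval_hom complex_of_real y (coeff P k)"
  assumes d: "d = degree P" and lc: "coeff (chart_poly d c C) d \<noteq> 0" "degree (chart_poly d c C) \<le> d"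
    and D: "mp_eval_hom complex_of_real y (disc_xn d P) \<noteq> 0"
  shows "rsquarefree (chart_poly d c C)"
  unfolding rsquarefree_roots
proof (intro allI notI, elim conjE)
  fix z assume z: "poly (chart_poly d c C) z = 0" and z': "poly (pderiv (chart_poly d c C)) z = 0"
  have deg: "degree (chart_poly d c C) = d" using lc by (simp add: le_antisym le_degree)
  have d2: "d \<ge> 2"
  proof (rule ccontr)
    assume "\<not> d \<ge> 2"
    then consider "d = 0" | "d = 1" by linarith
    then show False
    proof cases
      case 1
      then obtain a where "chart_poly d c C = [:a:]" using deg by (metis degree_eq_zeroE)
      then show ?thesis using z lc by simp
    next
      case 2
      then obtain a b where ab: "chart_poly d c C = [:a, b:]" using deg by (metis degree1_coeffs)
      then show ?thesis using z' lc 2 by (simp add: pderiv_pCons)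
    qed
  qed
  define t where "t = 1 + c * z"
  \<comment> \<open>\<open>A\<close> and \<open>B\<close> are the partial derivatives of the form
    with respect to its first and second variable at \<open>(z, t)\<close>.\<close>
  define A where "A = (\<Sum>k\<le>d. of_nat k * C k * z ^ (k - 1) * t ^ (d - k))"
  define B where "B = (\<Sum>k\<le>d. of_nat (d - k) * C k * z ^ k * t ^ (d - k - 1))"
  have "((\<lambda>z. \<Sum>k\<le>d. C k * z ^ k * (1 + c * z) ^ (d - k)) has_field_derivative
     (\<Sum>k\<le>d. of_nat k * C k * z ^ (k - 1) * t ^ (d - k) + c * (of_nat (d - k) * C k * z ^ k * t ^ (d - k - 1)))) (at z)"
  proof (rule DERIV_sum)
    fix k
    show "((\<lambda>z. C k * z ^ k * (1 + c * z) ^ (d - k)) has_field_derivative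
      of_nat k * C k * z ^ (k - 1) * t ^ (d - k) + c * (of_nat (d - k) * C k * z ^ k * t ^ (d - k - 1))) (at z)"
      by (auto intro!: derivative_eq_intros simp: t_def algebra_simps)
  qed
  moreover have "(\<lambda>z. \<Sum>k\<le>d. C k * z ^ k * (1 + c * z) ^ (d - k)) = poly (chart_poly d c C)"
    by (simp add: poly_chart_poly fun_eq_iff)
  ultimately have "poly (pderiv (chart_poly d c C)) z = A + c * B"
    using DERIV_unique[OF poly_DERIV] by (simp add: A_def B_def sum.distrib sum_distrib_left)
  with z' have 1: "A + c * B = 0" by simp
  have "z * A + t * B = (\<Sum>k\<le>d. of_nat d * (C k * z ^ k * t ^ (d - k)))"
    unfolding A_def B_def sum_distrib_left sum.distrib[symmetric]
  proof (rule sum.cong[OF refl])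
    fix k assume k: "k \<in> {..d}"
    have e1: "z * (of_nat k * C k * z ^ (k - 1) * t ^ (d - k)) = of_nat k * (C k * z ^ k * t ^ (d - k))"
      by (cases k) (auto simp: algebra_simps)
    have e2: "t * (of_nat (d - k) * C k * z ^ k * t ^ (d - k - 1)) = of_nat (d - k) * (C k * z ^ k * t ^ (d - k))"
      by (cases "d - k") (auto simp: algebra_simps)
    show "z * (of_nat k * C k * z ^ (k - 1) * t ^ (d - k)) + t * (of_nat (d - k) * C k * z ^ k * t ^ (d - k - 1)) =
      of_nat d * (C k * z ^ k * t ^ (d - k))"
      unfolding e1 e2 distrib_right[symmetric] of_nat_add[symmetric] using k by simp
  qed
  also have "\<dots> = of_nat d * poly (chart_poly d c C) z"
    by (simp add: poly_chart_poly sum_distrib_left t_def)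
  finally have 2: "z * A + t * B = 0" using z by simp
  have "(t - c * z) * B = z * A + t * B - z * (A + c * B)" by (simp add: algebra_simps)
  then have B0: "B = 0" unfolding 1 2 by (simp add: t_def)
  then have A0: "A = 0" using 1 by simp
  have "(\<exists>z. (\<Sum>k\<le>d. C k * z ^ k) = 0 \<and> (\<Sum>k\<le>d-1. of_nat (Suc k) * C (Suc k) * z ^ k) = 0) \<or>
      (C d = 0 \<and> C (d - 1) = 0)"
  proof (cases "t = 0")
    case True
    have z0: "z \<noteq> 0" using True by (auto simp: t_def)
    have "(\<Sum>k\<le>d. C k * z ^ k * t ^ (d - k)) = (\<Sum>k\<in>{d}. C k * z ^ k * t ^ (d - k))"
      by (rule sum.mono_neutral_right) (auto simp: True)
    then have "C d * z ^ d = 0" using z by (simp add: poly_chart_poly t_def)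
    moreover have "B = (\<Sum>k\<in>{d - 1}. of_nat (d - k) * C k * z ^ k * t ^ (d - k - 1))"
      unfolding B_def
    proof (rule sum.mono_neutral_right)
      show "\<forall>i\<in>{..d} - {d - 1}. of_nat (d - i) * C i * z ^ i * t ^ (d - i - 1) = 0"
      proof
        fix i assume "i \<in> {..d} - {d - 1}"
        then have "i = d \<or> d - i - 1 > 0" by auto
        then show "of_nat (d - i) * C i * z ^ i * t ^ (d - i - 1) = 0" using True by auto
      qed
    qed auto
    then have "C (d - 1) * z ^ (d - 1) = 0" using B0 d2 by (simp add: Suc_diff_le)
    ultimately show ?thesis using z0 by auto
  next
    case False
    have "(\<Sum>k\<le>d. C k * (z / t) ^ k) * t ^ d = poly (chart_poly d c C) z"
      unfolding poly_chart_poly sum_distrib_right t_def[symmetric]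
    proof (rule sum.cong[OF refl])
      fix k assume k: "k \<in> {..d}"
      then have "t ^ d = t ^ k * t ^ (d - k)" by (simp add: power_add[symmetric])
      then show "C k * (z / t) ^ k * t ^ d = C k * z ^ k * t ^ (d - k)"
        using False by (simp add: power_divide)
    qed
    then have r1: "(\<Sum>k\<le>d. C k * (z / t) ^ k) = 0" using z False by simp
    have "A = (\<Sum>k\<in>{1..d}. of_nat k * C k * z ^ (k - 1) * t ^ (d - k))"
      unfolding A_def by (rule sum.mono_neutral_right) auto
    also have "\<dots> = (\<Sum>k\<le>d-1. of_nat (Suc k) * C (Suc k) * z ^ k * t ^ (d - Suc k))"
      by (rule sum.reindex_bij_witness[of _ Suc "\<lambda>k. k - 1"]) (use d2 in auto)
    also have "\<dots> = (\<Sum>k\<le>d-1. of_nat (Suc k) * C (Suc k) * (z / t) ^ k) * t ^ (d - 1)"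
      unfolding sum_distrib_right
    proof (rule sum.cong[OF refl])
      fix k assume k: "k \<in> {..d - 1}"
      then have "t ^ (d - 1) = t ^ k * t ^ (d - Suc k)" using d2 by (simp add: power_add[symmetric])
      then show "of_nat (Suc k) * C (Suc k) * z ^ k * t ^ (d - Suc k) = of_nat (Suc k) * C (Suc k) * (z / t) ^ k * t ^ (d - 1)"
        using False by (simp add: power_divide)
    qed
    finally have "(\<Sum>k\<le>d-1. of_nat (Suc k) * C (Suc k) * (z / t) ^ k) = 0" using A0 False by simp
    with r1 show ?thesis by blast
  qed
  then have "mp_eval_hom complex_of_real y (disc_xn d P) = 0"
    unfolding C_def by (rule disc_xn_eval_zero[OF d d2])
  with D show False by simp
qed

section \<open>Finite coverings and continuity of roots\<close>

text \<open>Expresses that the sets \<open>R x\<close> are the fibres of a finite covering of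
  \<open>S\<close>. Sheets are listed as functions with distinct values because continuity of roots
  delivers them in this form; the number \<open>k\<close> may depend on the point.\<close>

definition local_sections :: "'a::topological_space set \<Rightarrow> ('a \<Rightarrow> 'b::topological_space set) \<Rightarrow> bool" where
  "local_sections S R \<longleftrightarrow> (\<forall>x0\<in>S. \<exists>U k f. open U \<and> x0 \<in> U \<and> (\<forall>i<k::nat. continuous_on (S \<inter> U) (f i)) \<and>
     (\<forall>x\<in>S \<inter> U. inj_on (\<lambda>i. f i x) {..<k} \<and> R x = (\<lambda>i. f i x) ` {..<k}))"

lemma covering_space_local_sections:
  fixes S :: "'a::real_normed_vector set" and R :: "'a \<Rightarrow> 'b::real_normed_vector set"
  assumes loc: "local_sections S R" and ne: "\<And>x. x \<in> S \<Longrightarrow> R x \<noteq> {}"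
  shows "covering_space (Sigma S R) fst S"
  unfolding covering_space_def
proof (intro conjI ballI)
  show "continuous_on (Sigma S R) fst" by (intro continuous_intros)
  show "fst ` Sigma S R = S" using ne by force
  fix x0 assume "x0 \<in> S"
  then obtain U k f where U: "open U" "x0 \<in> U" and cont: "\<And>i. i < (k::nat) \<Longrightarrow> continuous_on (S \<inter> U) (f i)"
    and fib: "\<And>x. x \<in> S \<inter> U \<Longrightarrow> inj_on (\<lambda>i. f i x) {..<k} \<and> R x = (\<lambda>i. f i x) ` {..<k}"
    using loc unfolding local_sections_def by metis
  let ?E = "Sigma S R"
  let ?T = "S \<inter> U"
  let ?u = "\<lambda>i. (\<lambda>x. (x, f i x)) ` ?T"
  let ?ET = "?E \<inter> fst -` ?T"
  have ET: "openin (top_of_set ?E) ?ET"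
  proof -
    have "?ET = ?E \<inter> fst -` U" by auto
    moreover have "openin (top_of_set ?E) (?E \<inter> fst -` U)"
      by (rule continuous_openin_preimage_gen) (auto intro!: continuous_intros U)
    ultimately show ?thesis by simp
  qed
  have openu: "openin (top_of_set ?E) (?u i)" if i: "i < k" for i
  proof -
    \<comment> \<open>Sheet \<open>i\<close> is what remains of the part over \<open>?T\<close> once
      the points on the other sheets are removed. Each of these is closed and there are finitely
      many, hence the sheet is open.\<close>
    let ?A = "\<lambda>j. ?ET \<inter> (\<lambda>p. snd p - f j (fst p)) -` (- {0})"
    have A: "openin (top_of_set ?ET) (?A j)" if "j < k" for j
    proof (rule continuous_openin_preimage_gen)
      have "continuous_on ?ET (\<lambda>p. f j (fst p))"
        by (rule continuous_on_compose2[OF cont[OF that]]) (auto intro!: continuous_intros)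
      then show "continuous_on ?ET (\<lambda>p. snd p - f j (fst p))" by (intro continuous_intros)
    qed auto
    have "?u i = (\<Inter>j\<in>{..<k} - {i}. ?A j) \<inter> ?ET"
    proof (intro equalityI subsetI)
      fix p assume "p \<in> ?u i"
      then show "p \<in> (\<Inter>j\<in>{..<k} - {i}. ?A j) \<inter> ?ET"
        using fib i by (auto simp: inj_on_def)
    next
      fix p assume p: "p \<in> (\<Inter>j\<in>{..<k} - {i}. ?A j) \<inter> ?ET"
      then have "fst p \<in> ?T" "snd p \<in> R (fst p)" by auto
      then obtain j where "j < k" "snd p = f j (fst p)" using fib[of "fst p"] by auto
      have "j = i"
      proof (rule ccontr)
        assume "j \<noteq> i"
        then have "j \<in> {..<k} - {i}" using \<open>j < k\<close> by simp
        from INT_D[OF IntD1[OF p] this] show False using \<open>snd p = f j (fst p)\<close> by simp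
      qed
      with \<open>snd p = f j (fst p)\<close> have "p = (fst p, f i (fst p))" by (simp add: prod_eq_iff)
      then show "p \<in> ?u i" using \<open>fst p \<in> ?T\<close> by (rule image_eqI)
    qed
    moreover have "openin (top_of_set ?ET) ((\<Inter>j\<in>{..<k} - {i}. ?A j) \<inter> topspace (top_of_set ?ET))"
      by (rule openin_INT) (use A in auto)
    ultimately have "openin (top_of_set ?ET) (?u i)" by simp
    then show ?thesis using ET openin_trans by blast
  qed
  show "\<exists>T. x0 \<in> T \<and> openin (top_of_set S) T \<and>
       (\<exists>v. \<Union>v = ?E \<inter> fst -` T \<and> (\<forall>u\<in>v. openin (top_of_set ?E) u) \<and> pairwise disjnt v \<and>
          (\<forall>u\<in>v. \<exists>q. homeomorphism u T fst q))"
  proof (intro exI[of _ ?T] conjI exI[of _ "?u ` {..<k}"] ballI)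
    show "x0 \<in> ?T" using U \<open>x0 \<in> S\<close> by auto
    show "openin (top_of_set S) ?T" using U by (simp add: openin_open_Int)
    show "\<Union> (?u ` {..<k}) = ?E \<inter> fst -` ?T"
    proof (intro equalityI subsetI)
      fix p assume "p \<in> ?E \<inter> fst -` ?T"
      then have p: "fst p \<in> ?T" "snd p \<in> R (fst p)" by auto
      then obtain j where j: "j < k" "snd p = f j (fst p)" using fib[of "fst p"] by auto
      then have "p = (fst p, f j (fst p))" by (simp add: prod_eq_iff)
      then have "p \<in> ?u j" using p(1) by (rule image_eqI)
      then show "p \<in> \<Union> (?u ` {..<k})" using j by blast
    next
      fix p assume "p \<in> \<Union> (?u ` {..<k})"
      then obtain i x where ix: "i < k" "x \<in> ?T" "p = (x, f i x)" by blast
      then have "f i x \<in> R x" using fib[OF ix(2)] by blast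
      then show "p \<in> ?E \<inter> fst -` ?T" using ix by simp
    qed
    show "openin (top_of_set ?E) u" if "u \<in> ?u ` {..<k}" for u using that openu by blast
    show "pairwise disjnt (?u ` {..<k})"
    proof (rule pairwiseI)
      fix a b assume "a \<in> ?u ` {..<k}" "b \<in> ?u ` {..<k}" "a \<noteq> b"
      then obtain i j where ij: "i < k" "j < k" "a = ?u i" "b = ?u j" "i \<noteq> j" by blast
      show "disjnt a b"
        unfolding disjnt_iff
      proof (intro allI notI, elim conjE)
        fix p assume "p \<in> a" "p \<in> b"
        then obtain x where x: "x \<in> ?T" "f i x = f j x" unfolding ij(3,4) by blast
        then show False using inj_onD[OF conjunct1[OF fib[OF x(1)]] x(2)] ij by simp
      qed
    qed
    show "\<exists>q. homeomorphism u ?T fst q" if "u \<in> ?u ` {..<k}" for u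
    proof -
      from that obtain i where i: "i < k" "u = ?u i" by auto
      have "homeomorphism u ?T fst (\<lambda>x. (x, f i x))"
        unfolding homeomorphism_def i(2)
        by (intro conjI ballI continuous_on_fst continuous_on_id continuous_on_Pair cont[OF i(1)]) (auto simp: image_image)
      then show ?thesis by blast
    qed
  qed
qed

text \<open>The identity of \<open>S\<close> lifts through every point of the covering. The lifts
  through the fibre over \<open>x0\<close> stay disjoint by uniqueness, and they exhaust each fibre
  because the lift through any given point also passes over \<open>x0\<close>.\<close>

lemma global_sections:
  fixes S :: "'a::real_normed_vector set" and R :: "'a \<Rightarrow> 'b::real_normed_vector set"
  assumes loc: "local_sections S R" and S: "simply_connected S" "locally path_connected S"
  obtains k :: nat and g where "\<And>i. i < k \<Longrightarrow> continuous_on S (g i)"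
    "\<And>x. x \<in> S \<Longrightarrow> inj_on (\<lambda>i. g i x) {..<k} \<and> R x = (\<lambda>i. g i x) ` {..<k}"
proof (cases "\<exists>x\<in>S. R x \<noteq> {}")
  case False
  then show ?thesis by (intro that[of 0 "\<lambda>_ _. 0"]) auto
next
  case True
  then obtain x0 where x0: "x0 \<in> S" "R x0 \<noteq> {}" by blast
  have fst_snd: "snd p \<in> R x" if "p \<in> Sigma S R" "fst p = x" for p x using that by auto
  have conn: "connected S" using S(1) by (rule simply_connected_imp_connected)
  \<comment> \<open>A covering projection is surjective, so empty fibres must be excluded. Emptiness
    is locally constant, and \<open>S\<close> is connected.\<close>
  have "(\<lambda>x. R x = {}) constant_on S"
  proof (rule locally_constant_imp_constant[OF conn])
    fix a assume "a \<in> S"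
    then obtain U k f where U: "open U" "a \<in> U" and fib: "\<And>x. x \<in> S \<inter> U \<Longrightarrow> R x = (\<lambda>i::nat. f i x) ` {..<k}"
      using loc unfolding local_sections_def by metis
    have eq: "(R x = {}) = (R a = {})" if "x \<in> S \<inter> U" for x
      using fib[OF that] fib[of a] U \<open>a \<in> S\<close> by simp
    have "openin (top_of_set S) (S \<inter> U)" "a \<in> S \<inter> U"
      using U \<open>a \<in> S\<close> by (simp_all add: openin_open_Int)
    then show "\<exists>T. openin (top_of_set S) T \<and> a \<in> T \<and> (\<forall>x\<in>T. (R x = {}) = (R a = {}))"
      using eq by blast
  qed
  then have ne: "\<And>x. x \<in> S \<Longrightarrow> R x \<noteq> {}" using x0 unfolding constant_on_def by metis
  note cov = covering_space_local_sections[OF loc ne]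
  obtain k f where fib0: "inj_on (\<lambda>i::nat. f i x0) {..<k} \<and> R x0 = (\<lambda>i. f i x0) ` {..<k}"
    using loc x0(1) unfolding local_sections_def by (metis IntI)
  have lift: "\<exists>h. continuous_on S h \<and> h \<in> S \<rightarrow> Sigma S R \<and> h (fst a) = a \<and> (\<forall>y\<in>S. fst (h y) = y)"
    if a: "a \<in> Sigma S R" for a
  proof -
    obtain h where "continuous_on S h" "h \<in> S \<rightarrow> Sigma S R" "h (fst a) = a" "\<And>y. y \<in> S \<Longrightarrow> fst (h y) = y"
      by (rule covering_space_lift_strong[OF cov a, of "fst a" S "\<lambda>x. x"])
        (use a S in \<open>auto intro!: continuous_intros\<close>)
    then show ?thesis by blast
  qed
  have uniq: "h1 x = h2 x"
    if "continuous_on S h1" "h1 \<in> S \<rightarrow> Sigma S R" "\<forall>y\<in>S. fst (h1 y) = y"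
      "continuous_on S h2" "h2 \<in> S \<rightarrow> Sigma S R" "\<forall>y\<in>S. fst (h2 y) = y" "a \<in> S" "x \<in> S" "h1 a = h2 a" for h1 h2 a x
    by (rule covering_space_lift_unique[OF cov, of h1 a h2 S "\<lambda>x. x"])
      (use that conn in \<open>auto intro!: continuous_intros\<close>)
  have "\<forall>i\<in>{..<k}. \<exists>h. continuous_on S h \<and> h \<in> S \<rightarrow> Sigma S R \<and> h x0 = (x0, f i x0) \<and> (\<forall>y\<in>S. fst (h y) = y)"
    using lift[of "(x0, f _ x0)"] fib0 x0 by auto
  then obtain h where h: "\<And>i. i < k \<Longrightarrow> continuous_on S (h i) \<and> h i \<in> S \<rightarrow> Sigma S R \<and> h i x0 = (x0, f i x0) \<and> (\<forall>y\<in>S. fst (h i y) = y)"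
    by (metis lessThan_iff)
  show ?thesis
  proof (rule that[of k "\<lambda>i x. snd (h i x)"])
    show "continuous_on S (\<lambda>x. snd (h i x))" if "i < k" for i
      using h[OF that] by (intro continuous_intros) auto
    fix x assume x: "x \<in> S"
    have mem: "snd (h i x) \<in> R x" if "i < k" for i
    proof -
      have "h i x \<in> Sigma S R" "fst (h i x) = x" using h[OF that] x by auto
      then show ?thesis by (rule fst_snd)
    qed
    show "inj_on (\<lambda>i. snd (h i x)) {..<k} \<and> R x = (\<lambda>i. snd (h i x)) ` {..<k}"
    proof (intro conjI equalityI subsetI inj_onI)
      fix i j assume ij: "i \<in> {..<k}" "j \<in> {..<k}" "snd (h i x) = snd (h j x)"
      then have "h i x = h j x" using h[of i] h[of j] x by (simp add: prod_eq_iff)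
      then have "h i x0 = h j x0"
        using uniq[of "h i" "h j" x x0] h ij(1,2) x x0 by auto
      then show "i = j" using h ij fib0 by (auto simp: inj_on_def)
    next
      fix y assume y: "y \<in> R x"
      obtain h' where h': "continuous_on S h'" "h' \<in> S \<rightarrow> Sigma S R" "h' x = (x, y)" "\<forall>y\<in>S. fst (h' y) = y"
        using lift[of "(x, y)"] x y by auto
      then have "h' x0 \<in> Sigma S R" "fst (h' x0) = x0" using x0 by auto
      then have "snd (h' x0) \<in> R x0" by (rule fst_snd)
      then obtain i where i: "i < k" "snd (h' x0) = f i x0" using fib0 by auto
      then have "h' x0 = h i x0" using h[OF i(1)] \<open>fst (h' x0) = x0\<close> by (simp add: prod_eq_iff)
      then have "h' x = h i x" using uniq[of h' "h i" x0 x] h[OF i(1)] h' x x0 by auto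
      moreover have "y = snd (h' x)" using h'(3) by simp
      ultimately show "y \<in> (\<lambda>i. snd (h i x)) ` {..<k}" using i(1) by (intro image_eqI[of _ _ i]) auto
    qed (use mem in auto)
  qed
qed

section \<open>Continuity of the roots of complex polynomials\<close>

lemma root_near_if_poly_small:
  fixes p :: "complex poly"
  assumes "norm (poly p r) < norm (lead_coeff p) * \<eta> ^ degree p" "\<eta> > 0"
  shows "\<exists>z. poly p z = 0 \<and> dist z r < \<eta>"
proof -
  obtain root where root: "Polynomial.smult (lead_coeff p) (\<Prod>i<degree p. [:-root i, 1:]) = p"
    using complex_poly_decompose' by blast
  have ev: "poly p z = lead_coeff p * (\<Prod>i<degree p. (z - root i))" for z
    by (subst root[symmetric]) (simp add: poly_prod)
  show ?thesis
  proof (rule ccontr)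
    assume n: "\<not> ?thesis"
    have "dist (root i) r \<ge> \<eta>" if "i < degree p" for i
    proof -
      have "poly p (root i) = 0" unfolding ev using that by (auto intro!: bexI[of _ i])
      with n have "\<not> dist (root i) r < \<eta>" by blast
      then show ?thesis by simp
    qed
    then have "(\<Prod>i<degree p. \<eta>) \<le> (\<Prod>i<degree p. norm (r - root i))"
      using assms(2) by (intro prod_mono) (auto simp: dist_norm norm_minus_commute)
    then have "norm (lead_coeff p) * \<eta> ^ degree p \<le> norm (poly p r)"
      unfolding ev by (simp add: norm_mult prod_norm[symmetric] mult_left_mono)
    with assms(1) show False by simp
  qed
qed

text \<open>Constant degree keeps the leading coefficient away from 0, so no root can escape to
  infinity and smallness of the value at \<open>r\<close> forces a root close to
  \<open>r\<close>.\<close>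

lemma eventually_root_near:
  fixes Q :: "'a::metric_space \<Rightarrow> complex poly"
  assumes cont: "\<And>k. continuous_on A (\<lambda>x. coeff (Q x) k)" and deg: "\<And>x. x \<in> A \<Longrightarrow> degree (Q x) = d"
    and x0: "x0 \<in> A" "Q x0 \<noteq> 0" and r: "poly (Q x0) r = 0" and \<eta>: "\<eta> > 0"
  shows "\<exists>e>0. \<forall>x\<in>A. dist x x0 < e \<longrightarrow> (\<exists>z. poly (Q x) z = 0 \<and> dist z r < \<eta>)"
proof -
  define g where "g x = norm (\<Sum>k\<le>d. coeff (Q x) k * r ^ k) - norm (coeff (Q x) d) * \<eta> ^ d" for x
  have contg: "continuous_on A g" unfolding g_def by (intro continuous_intros cont)
  have f: "g x = norm (poly (Q x) r) - norm (lead_coeff (Q x)) * \<eta> ^ degree (Q x)" if "x \<in> A" for x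
    unfolding g_def poly_altdef deg[OF that] ..
  have g0: "g x0 < 0" unfolding f[OF x0(1)] using r x0(2) \<eta> by simp
  obtain e where e: "e > 0" "\<And>x. x \<in> A \<Longrightarrow> dist x x0 < e \<Longrightarrow> dist (g x) (g x0) < - g x0"
    using contg[unfolded continuous_on_iff, rule_format, OF x0(1), of "- g x0"] g0 by auto
  have "\<exists>z. poly (Q x) z = 0 \<and> dist z r < \<eta>" if "x \<in> A" "dist x x0 < e" for x
  proof (rule root_near_if_poly_small[OF _ \<eta>])
    have "g x < 0" using e(2)[OF that] unfolding dist_real_def by linarith
    then show "norm (poly (Q x) r) < norm (lead_coeff (Q x)) * \<eta> ^ degree (Q x)"
      unfolding f[OF that(1)] by simp
  qed
  with e(1) show ?thesis by blast
qed

lemma finite_set_separated: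
  fixes Z :: "'a::metric_space set"
  assumes "finite Z"
  obtains \<delta> where "\<delta> > 0" "\<And>y z. y \<in> Z \<Longrightarrow> z \<in> Z \<Longrightarrow> y \<noteq> z \<Longrightarrow> \<delta> \<le> dist y z"
proof -
  \<comment> \<open>The extra 1 keeps the minimum defined when \<open>Z\<close> has fewer than two
    points.\<close>
  let ?D = "insert 1 ((\<lambda>(y, z). dist y z) ` {(y, z) \<in> Z \<times> Z. y \<noteq> z})"
  have "finite {(y, z) \<in> Z \<times> Z. y \<noteq> z}"
    by (rule finite_subset[of _ "Z \<times> Z"]) (use assms in auto)
  then have fin: "finite ?D" by simp
  show ?thesis
  proof (rule that[of "Min ?D"])
    show "Min ?D > 0" using fin by (auto simp: Min_gr_iff)
    show "Min ?D \<le> dist y z" if "y \<in> Z" "z \<in> Z" "y \<noteq> z" for y z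
      using fin that by (intro Min_le) auto
  qed
qed

lemma card_roots_rsquarefree:
  fixes p :: "complex poly"
  assumes "rsquarefree p"
  shows "card {z. poly p z = 0} = degree p" "finite {z. poly p z = 0}"
proof -
  have p0: "p \<noteq> 0" using assms by (auto simp: rsquarefree_def)
  show fin: "finite {z. poly p z = 0}" using p0 poly_roots_finite by blast
  have "degree p = degree (Polynomial.smult (lead_coeff p) (\<Prod>z|poly p z = 0. [:-z, 1:]))"
    using complex_poly_decompose_rsquarefree[OF assms] by simp
  also have "\<dots> = degree (\<Prod>z|poly p z = 0. [:-z, 1:])" using p0 by simp
  also have "\<dots> = card {z. poly p z = 0}"
    by (subst degree_prod_eq_sum_degree) auto
  finally show "card {z. poly p z = 0} = degree p" by simp
qed

text \<open>Each of the \<open>d\<close> roots over \<open>x0\<close> attracts at least one root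
  over a nearby \<open>x\<close>. There are only \<open>d\<close> roots over \<open>x\<close>, so it
  attracts exactly one, and that root is the value of the section.\<close>

lemma local_sections_simple_roots:
  fixes Q :: "'a::metric_space \<Rightarrow> complex poly"
  assumes cont: "\<And>k. continuous_on A (\<lambda>x. coeff (Q x) k)" and deg: "\<And>x. x \<in> A \<Longrightarrow> degree (Q x) = d"
    and sq: "\<And>x. x \<in> A \<Longrightarrow> rsquarefree (Q x)"
  shows "local_sections A (\<lambda>x. {z. poly (Q x) z = 0})"
  unfolding local_sections_def
proof
  fix x0 assume x0: "x0 \<in> A"
  let ?Z = "\<lambda>x. {z. poly (Q x) z = 0}"
  have Z: "finite (?Z x)" "card (?Z x) = d" if "x \<in> A" for x
    using card_roots_rsquarefree[OF sq[OF that]] deg[OF that] by auto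
  have Q0: "Q x \<noteq> 0" if "x \<in> A" for x using sq[OF that] by (auto simp: rsquarefree_def)
  obtain y where y: "bij_betw y {..<d} (?Z x0)"
    using ex_bij_betw_nat_finite[OF Z(1)[OF x0]] Z(2)[OF x0] by (auto simp: atLeast0LessThan)
  then have yroot: "poly (Q x0) (y i) = 0" if "i < d" for i
    using that by (auto simp: bij_betw_def)
  obtain \<delta> where \<delta>: "\<delta> > 0" "\<And>u v. u \<in> ?Z x0 \<Longrightarrow> v \<in> ?Z x0 \<Longrightarrow> u \<noteq> v \<Longrightarrow> \<delta> \<le> dist u v"
    using finite_set_separated[OF Z(1)[OF x0]] by metis
  have \<delta>y: "\<delta> \<le> dist (y i) (y j)" if "i < d" "j < d" "i \<noteq> j" for i j
    using \<delta>(2)[of "y i" "y j"] yroot that y by (auto simp: bij_betw_def inj_on_def)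
  have "\<forall>i. \<exists>e>0. i < d \<longrightarrow> (\<forall>x\<in>A. dist x x0 < e \<longrightarrow> (\<exists>z. poly (Q x) z = 0 \<and> dist z (y i) < \<delta> / 2))"
  proof
    fix i
    show "\<exists>e>0. i < d \<longrightarrow> (\<forall>x\<in>A. dist x x0 < e \<longrightarrow> (\<exists>z. poly (Q x) z = 0 \<and> dist z (y i) < \<delta> / 2))"
    proof (cases "i < d")
      case True
      have "\<delta> / 2 > 0" using \<delta>(1) by simp
      from eventually_root_near[OF cont deg x0 Q0[OF x0] yroot[OF True] this] show ?thesis by auto
    next
      case False
      then show ?thesis by (intro exI[of _ 1]) simp
    qed
  qed
  then obtain e where e: "\<And>i. e i > 0"
    "\<And>i x. i < d \<Longrightarrow> x \<in> A \<Longrightarrow> dist x x0 < e i \<Longrightarrow> \<exists>z. poly (Q x) z = 0 \<and> dist z (y i) < \<delta> / 2" by metis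
  define e0 where "e0 = Min (insert 1 (e ` {..<d}))"
  have e0: "e0 > 0" "\<And>i. i < d \<Longrightarrow> e0 \<le> e i" using e(1) by (auto simp: e0_def)
  let ?U = "ball x0 e0"
  define f where "f i x = (SOME z. poly (Q x) z = 0 \<and> dist z (y i) < \<delta> / 2)" for i x
  have f: "poly (Q x) (f i x) = 0" "dist (f i x) (y i) < \<delta> / 2" if "x \<in> A \<inter> ?U" "i < d" for i x
  proof -
    have "\<exists>z. poly (Q x) z = 0 \<and> dist z (y i) < \<delta> / 2"
      using e(2)[OF that(2), of x] e0(2)[OF that(2)] that(1) by (auto simp: dist_commute)
    from someI_ex[OF this] show "poly (Q x) (f i x) = 0" "dist (f i x) (y i) < \<delta> / 2"
      by (auto simp: f_def)
  qed
  have inj: "inj_on (\<lambda>i. f i x) {..<d}" if "x \<in> A \<inter> ?U" for x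
  proof (rule inj_onI, rule ccontr)
    fix i j assume ij: "i \<in> {..<d}" "j \<in> {..<d}" "f i x = f j x" "i \<noteq> j"
    have "dist (y i) (y j) \<le> dist (f i x) (y i) + dist (f j x) (y j)"
      using ij(3) by (metis dist_commute dist_triangle)
    also have "\<dots> < \<delta>" using f(2)[OF that, of i] f(2)[OF that, of j] ij by auto
    finally show False using \<delta>y[of i j] ij by auto
  qed
  have img: "?Z x = (\<lambda>i. f i x) ` {..<d}" if "x \<in> A \<inter> ?U" for x
  proof (rule sym, rule card_subset_eq)
    show "finite (?Z x)" using Z that by auto
    show "(\<lambda>i. f i x) ` {..<d} \<subseteq> ?Z x" using f(1)[OF that] by auto
    show "card ((\<lambda>i. f i x) ` {..<d}) = card (?Z x)"
      using card_image[OF inj[OF that]] Z(2)[of x] that by simp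
  qed
  have uniq: "z = f i x" if x: "x \<in> A \<inter> ?U" and i: "i < d" and z: "poly (Q x) z = 0" "dist z (y i) < \<delta> / 2" for x i z
  proof -
    obtain j where j: "j < d" "z = f j x" using img[OF x] z(1) by auto
    have "j = i"
    proof (rule ccontr)
      assume "j \<noteq> i"
      have "dist (y j) (y i) \<le> dist z (y j) + dist z (y i)" by (metis dist_commute dist_triangle)
      also have "\<dots> < \<delta>" using f(2)[OF x j(1)] z(2) j(2) by auto
      finally show False using \<delta>y[of j i] i j \<open>j \<noteq> i\<close> by auto
    qed
    then show ?thesis using j by simp
  qed
  show "\<exists>U k f. open U \<and> x0 \<in> U \<and> (\<forall>i<k::nat. continuous_on (A \<inter> U) (f i)) \<and>
     (\<forall>x\<in>A \<inter> U. inj_on (\<lambda>i. f i x) {..<k} \<and> ?Z x = (\<lambda>i. f i x) ` {..<k})"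
  proof (intro exI[of _ ?U] exI[of _ d] exI[of _ f] conjI allI impI ballI)
    show "x0 \<in> ?U" using e0 by simp
    fix i assume i: "i < d"
    show "continuous_on (A \<inter> ?U) (f i)"
      unfolding continuous_on_iff
    proof (intro ballI allI impI)
      fix x1 and \<eta> :: real assume x1: "x1 \<in> A \<inter> ?U" and \<eta>: "\<eta> > 0"
      \<comment> \<open>The second bound keeps a root found near \<open>f i x1\<close> within
        \<open>\<delta> / 2\<close> of \<open>y i\<close>, where \<open>uniq\<close> identifies it
        with \<open>f i x\<close>.\<close>
      define \<eta>' where "\<eta>' = min \<eta> (\<delta> / 2 - dist (f i x1) (y i))"
      have \<eta>': "\<eta>' > 0" using \<eta> f(2)[OF x1 i] by (simp add: \<eta>'_def)
      obtain e1 where e1: "e1 > 0" "\<And>x. x \<in> A \<Longrightarrow> dist x x1 < e1 \<Longrightarrow> \<exists>z. poly (Q x) z = 0 \<and> dist z (f i x1) < \<eta>'"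
        using eventually_root_near[OF cont deg _ Q0 f(1)[OF x1 i] \<eta>'] x1 by blast
      have "dist (f i x) (f i x1) < \<eta>" if x: "x \<in> A \<inter> ?U" "dist x x1 < e1" for x
      proof -
        obtain z where z: "poly (Q x) z = 0" "dist z (f i x1) < \<eta>'" using e1(2)[of x] x by auto
        have "dist z (y i) \<le> dist z (f i x1) + dist (f i x1) (y i)" by (rule dist_triangle)
        also have "\<dots> < \<delta> / 2" using z(2) by (simp add: \<eta>'_def)
        finally have "z = f i x" using uniq[OF x(1) i z(1)] by simp
        then show ?thesis using z(2) by (simp add: \<eta>'_def)
      qed
      then show "\<exists>d>0. \<forall>x'\<in>A \<inter> ?U. dist x' x1 < d \<longrightarrow> dist (f i x') (f i x1) < \<eta>"
        using e1(1) by blast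
    qed
  qed (use inj img in auto)
qed

section \<open>Puiseux branches\<close>

text \<open>Order at least \<open>k\<close> at 0, phrased as divisibility so that the zero function
  needs no exception.\<close>

definition vanishes_to :: "nat \<Rightarrow> (complex \<Rightarrow> complex) \<Rightarrow> real \<Rightarrow> bool" where
  "vanishes_to k f R \<longleftrightarrow> (\<exists>G. G holomorphic_on ball 0 R \<and> (\<forall>\<sigma>\<in>ball 0 R. f \<sigma> = \<sigma> ^ k * G \<sigma>))"

lemma vanishes_to_0: "f holomorphic_on ball 0 R \<Longrightarrow> vanishes_to 0 f R"
  unfolding vanishes_to_def by (intro exI[of _ f]) simp

lemma holomorphic_factor_zero:
  assumes f: "f holomorphic_on ball 0 R" and f0: "f 0 = 0"
  shows "\<exists>G. G holomorphic_on ball 0 R \<and> (\<forall>\<sigma>\<in>ball 0 R. f \<sigma> = \<sigma> * G \<sigma>)"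
proof -
  define G where "G \<sigma> = (if \<sigma> = 0 then deriv f 0 else f \<sigma> / \<sigma>)" for \<sigma>
  have "G holomorphic_on ball 0 R"
    by (rule pole_theorem_open_0[OF f open_ball, of 0]) (simp_all add: G_def f0)
  moreover have "f \<sigma> = \<sigma> * G \<sigma>" for \<sigma> by (simp add: G_def f0)
  ultimately show ?thesis by blast
qed

lemma max_modulus_circle:
  assumes h: "h holomorphic_on ball 0 R" and r: "0 < r" "r < R"
    and B: "\<And>\<sigma>. norm \<sigma> = r \<Longrightarrow> norm (h \<sigma>) \<le> B" and \<sigma>: "norm \<sigma> \<le> r"
  shows "norm (h \<sigma>) \<le> B"
proof (rule maximum_modulus_frontier[of h "cball 0 r"])
  have sub: "cball 0 r \<subseteq> ball (0::complex) R" using r by auto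
  have "ball 0 r \<subseteq> ball (0::complex) R" using r by auto
  then show "h holomorphic_on interior (cball 0 r)" using h holomorphic_on_subset by (metis interior_cball)
  show "continuous_on (closure (cball 0 r)) h"
    using continuous_on_subset[OF holomorphic_on_imp_continuous_on[OF h] sub] closure_closed[OF closed_cball] by metis
  show "bounded (cball (0::complex) r)" by simp
  show "norm (h z) \<le> B" if "z \<in> frontier (cball 0 r)" for z
    using that B by simp
  show "\<sigma> \<in> cball 0 r" using \<sigma> by simp
qed

lemma continuous_zero_at_0:
  fixes D :: "complex \<Rightarrow> complex"
  assumes "continuous_on (ball 0 R) D" "R > 0" "\<And>\<sigma>. \<sigma> \<in> ball 0 R - {0} \<Longrightarrow> D \<sigma> = 0"
  shows "D 0 = 0"
proof -
  have "isCont D 0" using assms(1,2) by (simp add: continuous_on_eq_continuous_at)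
  then have lim: "(D \<longlongrightarrow> D 0) (at 0)" by (simp add: isCont_def)
  have "\<forall>\<^sub>F \<sigma> in at 0. D \<sigma> = 0"
    unfolding eventually_at using assms(2,3) by (intro exI[of _ R]) (auto simp: dist_norm)
  then have "(D \<longlongrightarrow> 0) (at 0)" by (rule tendsto_eventually)
  with lim show ?thesis by (rule tendsto_unique[OF at_neq_bot])
qed

lemma vanishes_to_SucI:
  assumes f1: "vanishes_to k f1 R" and f: "\<And>\<sigma>. \<sigma> \<in> ball 0 R \<Longrightarrow> f \<sigma> = \<sigma> * f1 \<sigma>"
  shows "vanishes_to (Suc k) f R"
proof -
  obtain G where G: "G holomorphic_on ball 0 R" "\<And>\<sigma>. \<sigma> \<in> ball 0 R \<Longrightarrow> f1 \<sigma> = \<sigma> ^ k * G \<sigma>"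
    using f1 unfolding vanishes_to_def by blast
  have "f \<sigma> = \<sigma> ^ Suc k * G \<sigma>" if "\<sigma> \<in> ball 0 R" for \<sigma>
    unfolding f[OF that] G(2)[OF that] by simp
  with G(1) show ?thesis unfolding vanishes_to_def by blast
qed

text \<open>Minimum modulus: since \<open>f\<close> has no zeros off the origin, it must vanish at the origin at least as
  often as the function \<open>g\<close> to which it is close on a circle.\<close>

lemma vanishes_to_persists:
  assumes "f holomorphic_on ball 0 R" "0 < r" "r < R" "\<delta> > 0"
    and "\<And>\<sigma>. \<sigma> \<in> ball 0 R - {0} \<Longrightarrow> f \<sigma> \<noteq> 0"
    and "\<And>\<sigma>. norm \<sigma> = r \<Longrightarrow> norm (f \<sigma> - g \<sigma>) \<le> \<delta> / 3" and "\<And>\<sigma>. norm \<sigma> = r \<Longrightarrow> norm (g \<sigma>) \<ge> \<delta>"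
    and "vanishes_to k g R"
  shows "vanishes_to k f R"
  using assms
proof (induction k arbitrary: f g \<delta>)
  case 0
  then show ?case by (simp add: vanishes_to_0)
next
  case (Suc k)
  note holf = Suc.prems(1) and r = Suc.prems(2,3) and \<delta> = Suc.prems(4) and fne = Suc.prems(5)
  note close = Suc.prems(6) and gge = Suc.prems(7)
  obtain G where G: "G holomorphic_on ball 0 R" "\<And>\<sigma>. \<sigma> \<in> ball 0 R \<Longrightarrow> g \<sigma> = \<sigma> ^ Suc k * G \<sigma>"
    using Suc.prems(8) unfolding vanishes_to_def by blast
  have R: "R > 0" using r by simp
  define g1 where "g1 \<sigma> = \<sigma> ^ k * G \<sigma>" for \<sigma>
  have g1: "g1 holomorphic_on ball 0 R" unfolding g1_def by (intro holomorphic_intros G)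
  have gg1: "g \<sigma> = \<sigma> * g1 \<sigma>" if "\<sigma> \<in> ball 0 R" for \<sigma>
    unfolding G(2)[OF that] g1_def by simp
  \<comment> \<open>Otherwise \<open>f\<close> has no zeros at all. Comparison with
    \<open>g\<close>, which vanishes at 0, bounds the modulus of \<open>f 0\<close> by \<delta>/3,
    while the maximum principle for \<open>1/f\<close> makes it at least 2\<delta>/3.\<close>
  have f0: "f 0 = 0"
  proof (rule ccontr)
    assume "f 0 \<noteq> 0"
    then have fne': "f \<sigma> \<noteq> 0" if "\<sigma> \<in> ball 0 R" for \<sigma> using fne[of \<sigma>] that by (cases "\<sigma> = 0") auto
    have "norm (f 0 - 0 * g1 0) \<le> \<delta> / 3"
    proof (rule max_modulus_circle[of "\<lambda>\<sigma>. f \<sigma> - \<sigma> * g1 \<sigma>" R r])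
      show "(\<lambda>\<sigma>. f \<sigma> - \<sigma> * g1 \<sigma>) holomorphic_on ball 0 R" by (intro holomorphic_intros holf g1)
      show "norm (f \<sigma> - \<sigma> * g1 \<sigma>) \<le> \<delta> / 3" if "norm \<sigma> = r" for \<sigma>
        using close[OF that] gg1[of \<sigma>] that r by simp
    qed (use r in auto)
    then have 1: "norm (f 0) \<le> \<delta> / 3" by simp
    have "norm (inverse (f 0)) \<le> 3 / (2 * \<delta>)"
    proof (rule max_modulus_circle[of "\<lambda>\<sigma>. inverse (f \<sigma>)" R r])
      show "(\<lambda>\<sigma>. inverse (f \<sigma>)) holomorphic_on ball 0 R" by (intro holomorphic_intros holf fne')
      show "norm (inverse (f \<sigma>)) \<le> 3 / (2 * \<delta>)" if "norm \<sigma> = r" for \<sigma>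
      proof -
        have "norm (g \<sigma>) \<le> norm (f \<sigma>) + norm (f \<sigma> - g \<sigma>)"
          by (metis norm_triangle_sub norm_minus_commute add.commute)
        then have "2 * \<delta> / 3 \<le> norm (f \<sigma>)" using close[OF that] gge[OF that] by linarith
        then have "inverse (norm (f \<sigma>)) \<le> inverse (2 * \<delta> / 3)" using \<delta> by (intro le_imp_inverse_le) auto
        then show ?thesis by (simp add: norm_inverse)
      qed
    qed (use r in auto)
    then have "norm (f 0) * norm (inverse (f 0)) \<le> norm (f 0) * (3 / (2 * \<delta>))"
      by (intro mult_left_mono) auto
    moreover have "norm (f 0) * norm (inverse (f 0)) = 1" using \<open>f 0 \<noteq> 0\<close> by (simp add: norm_inverse)
    ultimately have "1 \<le> norm (f 0) * (3 / (2 * \<delta>))" by simp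
    also have "\<dots> \<le> \<delta> / 3 * (3 / (2 * \<delta>))" using 1 \<delta> by (intro mult_right_mono) auto
    also have "\<dots> < 1" using \<delta> by simp
    finally show False by simp
  qed
  obtain f1 where f1: "f1 holomorphic_on ball 0 R" "\<And>\<sigma>. \<sigma> \<in> ball 0 R \<Longrightarrow> f \<sigma> = \<sigma> * f1 \<sigma>"
    using holomorphic_factor_zero[OF holf f0] by blast
  \<comment> \<open>Dividing by \<sigma> divides both bounds on the circle by \<open>r\<close>, so
    their ratio, on which the argument depends, is unchanged.\<close>
  have "vanishes_to k f1 R"
  proof (rule Suc.IH[of f1 "\<delta> / r" g1])
    show "f1 \<sigma> \<noteq> 0" if "\<sigma> \<in> ball 0 R - {0}" for \<sigma> using fne[OF that] f1(2)[of \<sigma>] that by auto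
    show "vanishes_to k g1 R" unfolding vanishes_to_def g1_def using G(1) by blast
    fix \<sigma> :: complex assume \<sigma>: "norm \<sigma> = r"
    then have in_ball: "\<sigma> \<in> ball 0 R" using r by simp
    have "norm (f \<sigma> - g \<sigma>) = r * norm (f1 \<sigma> - g1 \<sigma>)"
      unfolding f1(2)[OF in_ball] gg1[OF in_ball] right_diff_distrib[symmetric] norm_mult \<sigma> ..
    then have "r * norm (f1 \<sigma> - g1 \<sigma>) \<le> \<delta> / 3" using close[OF \<sigma>] by simp
    then show "norm (f1 \<sigma> - g1 \<sigma>) \<le> \<delta> / r / 3" using r by (simp add: field_simps)
    have "norm (g \<sigma>) = r * norm (g1 \<sigma>)"
      unfolding gg1[OF in_ball] norm_mult \<sigma> ..
    then show "\<delta> / r \<le> norm (g1 \<sigma>)" using gge[OF \<sigma>] r by (simp add: field_simps)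
  qed (use f1(1) r \<delta> in auto)
  then show ?case using f1(2) by (rule vanishes_to_SucI)
qed

text \<open>Rotation by a primitive \<open>N\<close>-th root of unity detects all the Taylor coefficients of index below \<open>N\<close>
  except the constant one.\<close>

lemma vanishes_to_rotation:
  assumes z: "z holomorphic_on ball 0 R" and R: "R > 0"
    and \<omega>: "norm \<omega> = 1" "\<And>j. 0 < j \<Longrightarrow> j < N \<Longrightarrow> \<omega> ^ j \<noteq> 1"
    and k: "k \<le> N" and van: "vanishes_to k (\<lambda>\<sigma>. z (\<omega> * \<sigma>) - z \<sigma>) R"
  shows "vanishes_to k (\<lambda>\<sigma>. z \<sigma> - z 0) R"
proof -
  have "vanishes_to j (\<lambda>\<sigma>. z \<sigma> - z 0) R" if "j \<le> k" for j
    using that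
  proof (induction j)
    case 0
    show ?case by (rule vanishes_to_0) (intro holomorphic_intros z)
  next
    case (Suc j)
    then obtain Y where Y: "Y holomorphic_on ball 0 R" "\<And>\<sigma>. \<sigma> \<in> ball 0 R \<Longrightarrow> z \<sigma> - z 0 = \<sigma> ^ j * Y \<sigma>"
      unfolding vanishes_to_def by auto
    have Y0: "Y 0 = 0"
    proof (cases "j = 0")
      case True
      then show ?thesis using Y(2)[of 0] R by simp
    next
      case False
      obtain K where K: "K holomorphic_on ball 0 R" "\<And>\<sigma>. \<sigma> \<in> ball 0 R \<Longrightarrow> z (\<omega> * \<sigma>) - z \<sigma> = \<sigma> ^ k * K \<sigma>"
        using van unfolding vanishes_to_def by blast
      \<comment> \<open>The identity for \<open>z (\<omega> * \<sigma>) - z \<sigma>\<close> divided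
        by the \<open>j\<close>-th power of \<sigma>. It holds off 0, hence by continuity at 0,
        where \<open>j < k\<close> removes the last term and leaves
        \<open>(\<omega> ^ j - 1) * Y 0 = 0\<close>.\<close>
      define D where "D \<sigma> = \<omega> ^ j * Y (\<omega> * \<sigma>) - Y \<sigma> - \<sigma> ^ (k - j) * K \<sigma>" for \<sigma>
      have rot: "\<omega> * \<sigma> \<in> ball 0 R" if "\<sigma> \<in> ball 0 R" for \<sigma> using that \<omega>(1) by (simp add: norm_mult)
      have "continuous_on (ball 0 R) (\<lambda>\<sigma>. Y (\<omega> * \<sigma>))"
        by (rule continuous_on_compose2[OF holomorphic_on_imp_continuous_on[OF Y(1)]])
          (use rot in \<open>auto intro!: continuous_intros\<close>)
      then have "continuous_on (ball 0 R) D"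
        unfolding D_def
        by (intro continuous_intros holomorphic_on_imp_continuous_on[OF Y(1)] holomorphic_on_imp_continuous_on[OF K(1)])
      moreover have "D \<sigma> = 0" if \<sigma>: "\<sigma> \<in> ball 0 R - {0}" for \<sigma>
      proof -
        have b: "\<sigma> \<in> ball 0 R" and ne: "\<sigma> \<noteq> 0" using \<sigma> by auto
        have "\<sigma> ^ j * D \<sigma> = (\<omega> * \<sigma>) ^ j * Y (\<omega> * \<sigma>) - \<sigma> ^ j * Y \<sigma> - \<sigma> ^ (j + (k - j)) * K \<sigma>"
          unfolding D_def by (simp add: algebra_simps power_add power_mult_distrib)
        also have "\<dots> = (z (\<omega> * \<sigma>) - z 0) - (z \<sigma> - z 0) - \<sigma> ^ k * K \<sigma>"
          unfolding Y(2)[OF b] Y(2)[OF rot[OF b]] using Suc.prems by simp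
        also have "\<dots> = 0" unfolding K(2)[OF b, symmetric] by simp
        finally show ?thesis using ne by simp
      qed
      ultimately have "D 0 = 0" using continuous_zero_at_0 R by blast
      then have "(\<omega> ^ j - 1) * Y 0 = 0" using Suc.prems by (simp add: D_def algebra_simps power_0_left)
      moreover have "\<omega> ^ j \<noteq> 1" using \<omega>(2)[of j] False Suc.prems k by simp
      ultimately show ?thesis by simp
    qed
    obtain Y1 where Y1: "Y1 holomorphic_on ball 0 R" "\<And>\<sigma>. \<sigma> \<in> ball 0 R \<Longrightarrow> Y \<sigma> = \<sigma> * Y1 \<sigma>"
      using holomorphic_factor_zero[OF Y(1) Y0] by blast
    have "z \<sigma> - z 0 = \<sigma> ^ Suc j * Y1 \<sigma>" if "\<sigma> \<in> ball 0 R" for \<sigma>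
      unfolding Y(2)[OF that] Y1(2)[OF that] by simp
    then show ?case using Y1(1) unfolding vanishes_to_def by blast
  qed
  then show ?thesis by simp
qed

section \<open>From sections over a punctured disc to Puiseux branches\<close>

lemma section_unique:
  fixes S :: "'a::real_normed_vector set" and R :: "'a \<Rightarrow> 'b::real_normed_vector set"
  assumes loc: "local_sections S R" and conn: "connected S"
    and h1: "continuous_on S h1" "\<And>x. x \<in> S \<Longrightarrow> h1 x \<in> R x"
    and h2: "continuous_on S h2" "\<And>x. x \<in> S \<Longrightarrow> h2 x \<in> R x"
    and a: "a \<in> S" "h1 a = h2 a" and x: "x \<in> S"
  shows "h1 x = h2 x"
proof -
  have ne: "R x \<noteq> {}" if "x \<in> S" for x using h1(2)[OF that] by auto
  have "(x, h1 x) = (x, h2 x)"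
    by (rule covering_space_lift_unique[OF covering_space_local_sections[OF loc ne],
          of "\<lambda>x. (x, h1 x)" a "\<lambda>x. (x, h2 x)" S "\<lambda>x. x"])
      (use h1 h2 a x conn in \<open>auto intro!: continuous_intros\<close>)
  then show ?thesis by simp
qed

lemma poly_rsquarefree_eq_prod:
  fixes p :: "complex poly"
  assumes sq: "rsquarefree p" and inj: "inj_on y {..<d}" and roots: "{z. poly p z = 0} = y ` {..<d}" and deg: "degree p = d"
  shows "poly p x = coeff p d * (\<Prod>i<d. (x - y i))"
proof -
  have "poly p x = poly (Polynomial.smult (lead_coeff p) (\<Prod>z|poly p z = 0. [:-z, 1:])) x"
    by (simp only: complex_poly_decompose_rsquarefree[OF sq])
  also have "\<dots> = coeff p d * (\<Prod>z\<in>y ` {..<d}. (x - z))"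
    by (simp add: poly_prod roots deg)
  also have "(\<Prod>z\<in>y ` {..<d}. (x - z)) = (\<Prod>i<d. (x - y i))"
    by (simp add: prod.reindex[OF inj])
  finally show ?thesis .
qed

text \<open>Evaluating \<open>Q s\<close> at the fixed number \<open>a = g i s0\<close> isolates the
  factor \<open>a - g i s\<close>. The remaining factors are continuous and, the root being simple,
  nonzero at \<open>s0\<close>; so the difference quotient of \<open>g i\<close> converges together
  with that of the holomorphic function \<open>F\<close>.\<close>

lemma holomorphic_root_section:
  fixes Q :: "complex \<Rightarrow> complex poly"
  assumes U: "open U" and hol: "\<And>k. (\<lambda>s. coeff (Q s) k) holomorphic_on U"
    and deg: "\<And>s. s \<in> U \<Longrightarrow> degree (Q s) = d" and sq: "\<And>s. s \<in> U \<Longrightarrow> rsquarefree (Q s)"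
    and cont: "\<And>i. i < d \<Longrightarrow> continuous_on U (g i)"
    and fib: "\<And>s. s \<in> U \<Longrightarrow> inj_on (\<lambda>i. g i s) {..<d} \<and> {z. poly (Q s) z = 0} = (\<lambda>i. g i s) ` {..<d}"
    and i: "i < d"
  shows "g i holomorphic_on U"
proof -
  have prod: "poly (Q s) x = coeff (Q s) d * (\<Prod>j<d. (x - g j s))" if "s \<in> U" for s x
    using poly_rsquarefree_eq_prod[OF sq[OF that] _ _ deg[OF that], of "\<lambda>i. g i s"] fib[OF that] by blast
  have "g i field_differentiable (at s0)" if s0: "s0 \<in> U" for s0
  proof -
    define a where "a = g i s0"
    define F where "F s = (\<Sum>k\<le>d. coeff (Q s) k * a ^ k)" for s
    have FQ: "F s = poly (Q s) a" if "s \<in> U" for s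
      unfolding F_def poly_altdef deg[OF that] ..
    have "F holomorphic_on U" unfolding F_def by (intro holomorphic_intros hol)
    then have "F field_differentiable (at s0)" using holomorphic_on_imp_differentiable_at U s0 by blast
    then obtain F' where "(F has_field_derivative F') (at s0)" unfolding field_differentiable_def by blast
    then obtain A where A: "\<And>s. F s - F s0 = A s * (s - s0)" "isCont A s0" unfolding CARAT_DERIV by blast
    define W where "W s = coeff (Q s) d * (\<Prod>j\<in>{..<d} - {i}. (a - g j s))" for s
    have FW: "F s = (a - g i s) * W s" if "s \<in> U" for s
      unfolding FQ[OF that] prod[OF that] W_def using i by (simp add: prod.remove[of "{..<d}" i])
    have F0: "F s0 = 0" using FW[OF s0] by (simp add: a_def)
    have "continuous_on U W" unfolding W_def
      by (intro continuous_intros holomorphic_on_imp_continuous_on[OF hol] cont) auto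
    then have Wc: "isCont W s0" using U s0 by (simp add: continuous_on_eq_continuous_at)
    have "coeff (Q s0) d \<noteq> 0"
      using deg[OF s0] sq[OF s0] by (metis leading_coeff_0_iff rsquarefree_def)
    moreover have "a - g j s0 \<noteq> 0" if "j \<in> {..<d} - {i}" for j
      using inj_onD[OF conjunct1[OF fib[OF s0]], of i j] that i by (auto simp: a_def)
    ultimately have W0: "W s0 \<noteq> 0" unfolding W_def by simp
    have "((\<lambda>s. - A s / W s) \<longlongrightarrow> - A s0 / W s0) (at s0)"
      using A(2) Wc W0 unfolding isCont_def by (intro tendsto_intros)
    moreover have "\<forall>\<^sub>F s in at s0. - A s / W s = (g i s - g i s0) / (s - s0)"
    proof -
      have "\<forall>\<^sub>F s in at s0. W s \<noteq> 0" using Wc W0 unfolding isCont_def by (rule tendsto_imp_eventually_ne)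
      moreover have "\<forall>\<^sub>F s in at s0. s \<in> U" using U s0 by (rule eventually_at_in_open')
      moreover have "\<forall>\<^sub>F s in at s0. s \<noteq> s0" by (simp add: eventually_at_filter)
      ultimately show ?thesis
      proof eventually_elim
        case (elim s)
        have "(a - g i s) * W s = A s * (s - s0)" using FW[OF elim(2)] A(1)[of s] F0 by simp
        then show ?case using elim by (simp add: a_def field_simps)
      qed
    qed
    ultimately have "((\<lambda>s. (g i s - g i s0) / (s - s0)) \<longlongrightarrow> - A s0 / W s0) (at s0)"
      by (rule Lim_transform_eventually)
    then show ?thesis unfolding field_differentiable_def has_field_derivative_iff by blast
  qed
  then show ?thesis using U by (simp add: holomorphic_on_open field_differentiable_def)
qed

text \<open>The branches live in the variable \<sigma> with \<open>s = \<sigma> ^ N\<close>. They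
  are distinct off 0; at 0 they may meet, and the factorisation records with what
  multiplicity.\<close>

definition puiseux_branches ::
  "(complex \<Rightarrow> complex poly) \<Rightarrow> nat \<Rightarrow> nat \<Rightarrow> real \<Rightarrow> (nat \<Rightarrow> complex \<Rightarrow> complex) \<Rightarrow> bool" where
  "puiseux_branches Q d N R z \<longleftrightarrow> (\<forall>i<d. z i holomorphic_on ball 0 R) \<and>
     (\<forall>\<sigma>\<in>ball 0 R. \<forall>x. poly (Q (\<sigma> ^ N)) x = coeff (Q (\<sigma> ^ N)) d * (\<Prod>i<d. (x - z i \<sigma>))) \<and>
     (\<forall>\<sigma>\<in>ball 0 R - {0}. inj_on (\<lambda>i. z i \<sigma>) {..<d})"

text \<open>A Cauchy-type bound. It keeps the branches bounded near 0, so that they extend over the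
  puncture.\<close>

lemma root_bound:
  fixes p :: "complex poly"
  assumes root: "poly p x = 0" and deg: "degree p = d" and p0: "coeff p d \<noteq> 0"
  shows "norm x \<le> 1 + (\<Sum>k<d. norm (coeff p k)) / norm (coeff p d)"
proof (cases "norm x \<le> 1")
  case True
  then show ?thesis by (simp add: add_increasing2 sum_nonneg)
next
  case False
  let ?S = "\<Sum>k<d. norm (coeff p k)"
  have d: "d > 0"
  proof (rule ccontr)
    assume "\<not> d > 0"
    then obtain a where "p = [:a:]" using deg by (metis degree_eq_zeroE gr0I)
    then show False using root p0 deg by simp
  qed
  have "{..d} = insert d {..<d}" by auto
  then have "coeff p d * x ^ d + (\<Sum>k<d. coeff p k * x ^ k) = 0"
    using root unfolding poly_altdef deg by simp
  then have "norm (coeff p d * x ^ d) = norm (\<Sum>k<d. coeff p k * x ^ k)"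
    by (metis add_eq_0_iff norm_minus_cancel)
  also have "\<dots> \<le> (\<Sum>k<d. norm (coeff p k) * norm x ^ (d - 1))"
  proof (rule sum_norm_le)
    fix k assume "k \<in> {..<d}"
    then have "norm x ^ k \<le> norm x ^ (d - 1)" using False by (intro power_increasing) auto
    then show "norm (coeff p k * x ^ k) \<le> norm (coeff p k) * norm x ^ (d - 1)"
      by (simp add: norm_mult norm_power mult_left_mono)
  qed
  finally have "norm (coeff p d) * norm x ^ d \<le> ?S * norm x ^ (d - 1)"
    by (simp add: norm_mult norm_power sum_distrib_right)
  moreover have "norm x ^ d = norm x * norm x ^ (d - 1)" using d by (metis power_eq_if less_numeral_extra(3))
  ultimately have "(norm (coeff p d) * norm x) * norm x ^ (d - 1) \<le> ?S * norm x ^ (d - 1)"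
    by (simp only: mult.assoc)
  moreover have "norm x ^ (d - 1) > 0" by (rule zero_less_power) (use False in linarith)
  ultimately have "norm (coeff p d) * norm x \<le> ?S" by (rule mult_right_le_imp_le)
  then have "norm x \<le> ?S / norm (coeff p d)" using p0 by (simp add: field_simps)
  then show ?thesis by simp
qed

text \<open>The \<open>d + 1\<close> translates of a section by multiples of 2 pi i take values in
  the same \<open>d\<close>-element fibre, so two of them agree at one point and, by uniqueness of
  lifts, everywhere. This gives a period of \<open>m\<close> turns with \<open>m <= d\<close>, and
  \<open>m\<close> divides \<open>d!\<close>.\<close>

lemma periodic_section:
  fixes g :: "complex \<Rightarrow> complex"
  assumes loc: "local_sections H R" and conn: "connected H" and H: "\<And>\<zeta> t. \<zeta> \<in> H \<Longrightarrow> \<zeta> + of_real t * \<i> \<in> H"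
    and R: "\<And>\<zeta>. R (\<zeta> + of_real (2 * pi) * \<i>) = R \<zeta>" and fin: "\<And>\<zeta>. \<zeta> \<in> H \<Longrightarrow> finite (R \<zeta>) \<and> card (R \<zeta>) = d"
    and g: "continuous_on H g" "\<And>\<zeta>. \<zeta> \<in> H \<Longrightarrow> g \<zeta> \<in> R \<zeta>" and \<zeta>: "\<zeta> \<in> H"
  shows "g (\<zeta> + of_real (2 * pi * real (fact d) * of_int n) * \<i>) = g \<zeta>"
proof -
  define T where "T x = of_real (2 * pi * x) * \<i>" for x
  have TH: "\<xi> + T x \<in> H" if "\<xi> \<in> H" for \<xi> x using H[OF that, of "2 * pi * x"] unfolding T_def .
  have Tadd: "T (x + y) = T x + T y" for x y by (simp add: T_def algebra_simps)
  have RT: "R (\<xi> + T (real j)) = R \<xi>" for \<xi> j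
  proof (induction j)
    case (Suc j)
    have "\<xi> + T (real (Suc j)) = (\<xi> + T (real j)) + of_real (2 * pi) * \<i>" by (simp add: T_def algebra_simps)
    then show ?case by (simp only: R Suc.IH)
  qed (simp add: T_def)
  have "card ((\<lambda>j. g (\<zeta> + T (real j))) ` {..d}) \<le> card (R \<zeta>)"
  proof (rule card_mono)
    show "(\<lambda>j. g (\<zeta> + T (real j))) ` {..d} \<subseteq> R \<zeta>" using g(2)[OF TH[OF \<zeta>]] RT by auto
  qed (use fin[OF \<zeta>] in auto)
  then have "\<not> inj_on (\<lambda>j. g (\<zeta> + T (real j))) {..d}"
    using fin[OF \<zeta>] card_image[of "\<lambda>j. g (\<zeta> + T (real j))" "{..d}"] by auto
  then obtain j j' where j: "j < j'" "j' \<le> d" "g (\<zeta> + T (real j)) = g (\<zeta> + T (real j'))"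
    unfolding inj_on_def by (metis atMost_iff linorder_neqE_nat)
  have cont_shift: "continuous_on H (\<lambda>\<xi>. g (\<xi> + T (real j)))" for j
    by (rule continuous_on_compose2[OF g(1)]) (use TH in \<open>auto intro!: continuous_intros\<close>)
  have mem_shift: "g (\<xi> + T (real j)) \<in> R \<xi>" if "\<xi> \<in> H" for \<xi> j
    using g(2)[OF TH[OF that], of "real j"] unfolding RT .
  have "g (\<xi> + T (real j)) = g (\<xi> + T (real j'))" if "\<xi> \<in> H" for \<xi>
    by (rule section_unique[OF loc conn cont_shift mem_shift cont_shift mem_shift \<zeta> j(3) that])
  note shift = this
  define m where "m = j' - j"
  have m: "0 < m" "m \<le> d" using j by (auto simp: m_def)
  have per: "g (\<xi> + T (real m)) = g \<xi>" if "\<xi> \<in> H" for \<xi>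
  proof -
    have "\<xi> + T (- real j) \<in> H" by (rule TH[OF that])
    from shift[OF this] have "g (\<xi> + T (- real j + real j)) = g (\<xi> + T (- real j + real j'))"
      unfolding Tadd by (simp only: add.assoc)
    moreover have "- real j + real j' = real m" using j by (simp add: m_def)
    moreover have "T (- real j + real j) = 0" by (simp add: T_def)
    ultimately show ?thesis by (metis add_0_right)
  qed
  have pern: "g (\<xi> + T (real (m * k))) = g \<xi>" if "\<xi> \<in> H" for \<xi> k
  proof (induction k)
    case (Suc k)
    have "\<xi> + T (real (m * Suc k)) = (\<xi> + T (real (m * k))) + T (real m)" by (simp add: T_def algebra_simps)
    then show ?case by (simp only: per[OF TH[OF that]] Suc.IH)
  qed (simp add: T_def)
  have "m dvd fact d" using m by (simp add: dvd_fact)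
  then obtain q where q: "fact d = m * q" by (elim dvdE)
  have goal_eq: "of_real (2 * pi * real (fact d) * of_int n) * \<i> = T (real (fact d) * of_int n)"
    by (simp add: T_def mult.assoc)
  show ?thesis
    unfolding goal_eq
  proof (cases "n \<ge> 0")
    case True
    have "real (fact d) * of_int n = real (m * (q * nat n))" unfolding q using True by simp
    then show "g (\<zeta> + T (real (fact d) * of_int n)) = g \<zeta>" by (simp only: pern[OF \<zeta>])
  next
    case False
    have *: "- (real (fact d) * of_int n) = real (m * (q * nat (- n)))" unfolding q using False by simp
    let ?\<xi> = "\<zeta> + T (real (fact d) * of_int n)"
    have "g (?\<xi> + T (- (real (fact d) * of_int n))) = g ?\<xi>"
      unfolding * by (rule pern[OF TH[OF \<zeta>]])
    moreover have "?\<xi> + T (- (real (fact d) * of_int n)) = \<zeta>" by (simp add: T_def algebra_simps)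
    ultimately show "g (\<zeta> + T (real (fact d) * of_int n)) = g \<zeta>" by metis
  qed
qed

text \<open>\<open>exp\<close> maps the half-plane \<open>H\<close> onto the punctured disc. There
  the roots are simple, and since \<open>H\<close> is simply connected they are globally holomorphic
  functions. By \<open>periodic_section\<close> they depend only on the \<open>N\<close>-th root
  \<sigma> of \<open>s\<close>, and being bounded they extend to 0.\<close>

theorem puiseux_branches_exist:
  fixes Q :: "complex \<Rightarrow> complex poly"
  assumes \<rho>: "\<rho> > 0" and hol: "\<And>k. (\<lambda>s. coeff (Q s) k) holomorphic_on ball 0 \<rho>"
    and deg: "\<And>s. s \<in> ball 0 \<rho> \<Longrightarrow> degree (Q s) = d" and lc: "\<And>s. s \<in> ball 0 \<rho> \<Longrightarrow> coeff (Q s) d \<noteq> 0"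
    and sq: "\<And>s. s \<in> ball 0 \<rho> - {0} \<Longrightarrow> rsquarefree (Q s)"
    and N: "N = fact d" and R: "R > 0" "R ^ N \<le> \<rho>"
  shows "\<exists>z. puiseux_branches Q d N R z"
proof -
  define H where "H = {\<zeta>. Re \<zeta> < ln \<rho>}"
  have Hopen: "open H" and Hconv: "convex H" unfolding H_def
    by (auto simp: open_halfspace_Re_lt convex_halfspace_Re_lt)
  have Hexp: "exp \<zeta> \<in> ball 0 \<rho> - {0}" if "\<zeta> \<in> H" for \<zeta>
  proof -
    have "exp (Re \<zeta>) < exp (ln \<rho>)" using that unfolding H_def by simp
    then show ?thesis using \<rho> by (simp add: norm_exp_eq_Re)
  qed
  define Z where "Z \<zeta> = {x. poly (Q (exp \<zeta>)) x = 0}" for \<zeta>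
  have hole: "(\<lambda>\<zeta>. coeff (Q (exp \<zeta>)) k) holomorphic_on H" for k
  proof -
    have "exp ` H \<subseteq> ball 0 \<rho>" using Hexp by blast
    from holomorphic_on_compose_gen[OF holomorphic_on_exp[of H] hol[of k] this] show ?thesis by (simp add: o_def)
  qed
  have dege: "degree (Q (exp \<zeta>)) = d" if "\<zeta> \<in> H" for \<zeta> using deg Hexp[OF that] by blast
  have sqe: "rsquarefree (Q (exp \<zeta>))" if "\<zeta> \<in> H" for \<zeta> by (rule sq[OF Hexp[OF that]])
  have loc: "local_sections H Z"
    unfolding Z_def
    by (rule local_sections_simple_roots[OF holomorphic_on_imp_continuous_on[OF hole] dege sqe])
  obtain k g where gc: "\<And>i. i < k \<Longrightarrow> continuous_on H (g i)"
    and gfib: "\<And>\<zeta>. \<zeta> \<in> H \<Longrightarrow> inj_on (\<lambda>i::nat. g i \<zeta>) {..<k} \<and> Z \<zeta> = (\<lambda>i. g i \<zeta>) ` {..<k}"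
    using global_sections[OF loc convex_imp_simply_connected[OF Hconv] open_imp_locally_path_connected[OF Hopen]] by blast
  have Zcard: "finite (Z \<zeta>) \<and> card (Z \<zeta>) = d" if "\<zeta> \<in> H" for \<zeta>
    using card_roots_rsquarefree[OF sqe[OF that]] dege[OF that] by (simp add: Z_def)
  have "of_real (ln \<rho> - 1) \<in> H" by (simp add: H_def)
  then have kd: "k = d" using gfib Zcard card_image by (metis card_lessThan)
  have ghol: "g i holomorphic_on H" if "i < d" for i
    using holomorphic_root_section[OF Hopen hole dege sqe, of g i] gc gfib that unfolding kd Z_def by blast
  have per: "g i (\<zeta> + of_real (2 * pi * real N * of_int n) * \<i>) = g i \<zeta>" if "i < d" "\<zeta> \<in> H" for i \<zeta> n
    unfolding N
  proof (rule periodic_section[OF loc convex_connected[OF Hconv] _ _ Zcard])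
    show "Z (\<zeta> + of_real (2 * pi) * \<i>) = Z \<zeta>" for \<zeta> by (simp add: Z_def exp_add)
    show "g i \<zeta> \<in> Z \<zeta>" if "\<zeta> \<in> H" for \<zeta> using gfib[OF that] \<open>i < d\<close> kd by blast
  qed (use that gc kd in \<open>auto simp: H_def\<close>)
  have NH: "of_nat N * L \<in> H" if "exp L \<in> ball 0 R" for L
  proof -
    have "norm (exp L) ^ N < R ^ N"
      using that N by (intro power_strict_mono) auto
    then have "norm (exp L) ^ N < \<rho>" using R by simp
    moreover have "norm (exp L) ^ N = exp (real N * Re L)"
      by (simp add: norm_exp_eq_Re exp_of_nat_mult)
    ultimately have "real N * Re L < ln \<rho>" using \<rho> by (metis exp_less_cancel_iff exp_ln)
    then show ?thesis by (simp add: H_def)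
  qed
  define w where "w i \<sigma> = g i (of_nat N * Ln \<sigma>)" for i \<sigma>
  \<comment> \<open>Two logarithms differ by a multiple of 2 pi i, which after multiplication by
    \<open>N\<close> is a period of \<open>g i\<close>; so the cut of \<open>Ln\<close> leaves no
    trace in \<open>w i\<close>.\<close>
  have w: "w i (exp L) = g i (of_nat N * L)" if i: "i < d" and L: "exp L \<in> ball 0 R" for i L
  proof -
    have "exp (Ln (exp L)) = exp L" by simp
    then obtain n :: int where n: "Ln (exp L) = L + (of_int (2 * n) * pi) * \<i>" unfolding exp_eq by blast
    have "of_nat N * Ln (exp L) = of_nat N * L + of_real (2 * pi * real N * of_int n) * \<i>"
      unfolding n by (simp add: algebra_simps)
    then show ?thesis unfolding w_def using per[OF i NH[OF L]] by metis
  qed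
  have whol: "w i holomorphic_on ball 0 R - {0}" if i: "i < d" for i
  proof -
    have "w i field_differentiable (at \<sigma>0)" if \<sigma>0: "\<sigma>0 \<in> ball 0 R - {0}" for \<sigma>0
    proof -
      \<comment> \<open>A logarithm that is holomorphic near \<open>\<sigma>0\<close> even when
        \<open>\<sigma>0\<close> lies on the cut of \<open>Ln\<close>.\<close>
      define L where "L \<sigma> = Ln (\<sigma> / \<sigma>0) + Ln \<sigma>0" for \<sigma>
      have expL: "exp (L \<sigma>) = \<sigma>" if "\<sigma> \<noteq> 0" for \<sigma> using that \<sigma>0 by (simp add: L_def exp_add)
      have "L field_differentiable (at \<sigma>0)"
        unfolding L_def using \<sigma>0
        by (intro derivative_intros field_differentiable_compose[unfolded o_def, of "\<lambda>\<sigma>. \<sigma> / \<sigma>0" _ Ln] field_differentiable_at_Ln) auto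
      then have "(\<lambda>\<sigma>. of_nat N * L \<sigma>) field_differentiable (at \<sigma>0)" by (intro derivative_intros)
      moreover have "exp (L \<sigma>0) \<in> ball 0 R" using expL[of \<sigma>0] \<sigma>0 by (simp del: norm_exp_eq_Re)
      then have "of_nat N * L \<sigma>0 \<in> H" by (rule NH)
      then have "g i field_differentiable (at (of_nat N * L \<sigma>0))"
        using ghol[OF i] Hopen holomorphic_on_imp_differentiable_at by blast
      ultimately have "(g i \<circ> (\<lambda>\<sigma>. of_nat N * L \<sigma>)) field_differentiable (at \<sigma>0)"
        by (rule field_differentiable_compose)
      then obtain D where "((\<lambda>\<sigma>. g i (of_nat N * L \<sigma>)) has_field_derivative D) (at \<sigma>0)"
        unfolding field_differentiable_def o_def by blast
      then have "(w i has_field_derivative D) (at \<sigma>0)"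
      proof (rule has_field_derivative_transform_within_open[of _ _ _ "ball 0 R - {0}"])
        show "g i (of_nat N * L \<sigma>) = w i \<sigma>" if "\<sigma> \<in> ball 0 R - {0}" for \<sigma>
          using w[OF i, of "L \<sigma>"] expL[of \<sigma>] that by (simp del: norm_exp_eq_Re)
      qed (use \<sigma>0 in auto)
      then show ?thesis unfolding field_differentiable_def by blast
    qed
    then show ?thesis by (simp add: holomorphic_on_open field_differentiable_def open_delete)
  qed
  have wfib: "inj_on (\<lambda>i. w i \<sigma>) {..<d} \<and> {x. poly (Q (\<sigma> ^ N)) x = 0} = (\<lambda>i. w i \<sigma>) ` {..<d}"
    and sqw: "rsquarefree (Q (\<sigma> ^ N)) \<and> degree (Q (\<sigma> ^ N)) = d" if "\<sigma> \<in> ball 0 R - {0}" for \<sigma>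
  proof -
    have h: "of_nat N * Ln \<sigma> \<in> H" using NH[of "Ln \<sigma>"] that by simp
    have e: "exp (of_nat N * Ln \<sigma>) = \<sigma> ^ N" using that by (simp add: exp_of_nat_mult)
    show "inj_on (\<lambda>i. w i \<sigma>) {..<d} \<and> {x. poly (Q (\<sigma> ^ N)) x = 0} = (\<lambda>i. w i \<sigma>) ` {..<d}"
      using gfib[OF h] unfolding w_def kd Z_def e .
    show "rsquarefree (Q (\<sigma> ^ N)) \<and> degree (Q (\<sigma> ^ N)) = d"
      using sqe[OF h] dege[OF h] unfolding e by simp
  qed
  define B where "B s = 1 + (\<Sum>k<d. norm (coeff (Q s) k)) / norm (coeff (Q s) d)" for s
  have Npos: "N > 0" using N by simp
  have powN: "\<sigma> ^ N \<in> ball 0 \<rho>" if "\<sigma> \<in> ball 0 R" for \<sigma> :: complex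
  proof -
    have "norm \<sigma> ^ N < R ^ N" using that Npos by (intro power_strict_mono) auto
    then show ?thesis using R by (simp add: norm_power)
  qed
  have contN: "continuous_on (ball 0 R) (\<lambda>\<sigma>. coeff (Q (\<sigma> ^ N)) k)" for k
    by (rule continuous_on_compose2[OF holomorphic_on_imp_continuous_on[OF hol]])
      (use powN in \<open>auto intro!: continuous_intros\<close>)
  have "continuous_on (ball 0 R) (\<lambda>\<sigma>. B (\<sigma> ^ N))"
    unfolding B_def by (intro continuous_intros contN) (use lc powN in auto)
  then have "isCont (\<lambda>\<sigma>. B (\<sigma> ^ N)) 0" using R by (simp add: continuous_on_eq_continuous_at)
  then have "\<forall>\<^sub>F \<sigma> in at 0. B (\<sigma> ^ N) < B (0 ^ N) + 1"
    unfolding isCont_def by (rule order_tendstoD) simp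
  moreover have "\<forall>\<^sub>F \<sigma> in at 0. \<sigma> \<in> ball 0 R - {0}"
    using R by (intro eventually_at_in_open) auto
  ultimately have Bev: "\<forall>\<^sub>F \<sigma> in at 0. norm (w i \<sigma>) \<le> B (0 ^ N) + 1" if "i < d" for i
  proof eventually_elim
    case (elim \<sigma>)
    have "poly (Q (\<sigma> ^ N)) (w i \<sigma>) = 0" using wfib[OF elim(2)] that by blast
    then have "norm (w i \<sigma>) \<le> B (\<sigma> ^ N)"
      unfolding B_def using sqw[OF elim(2)] lc powN elim(2) by (intro root_bound) auto
    then show ?case using elim(1) by simp
  qed
  have "\<exists>z. z holomorphic_on ball 0 R \<and> (\<forall>\<sigma>\<in>ball 0 R - {0}. z \<sigma> = w i \<sigma>)" if "i < d" for i
    using holomorphic_on_extend_bounded[OF whol[OF that]] Bev[OF that] R by auto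
  then obtain z where z: "\<And>i. i < d \<Longrightarrow> z i holomorphic_on ball 0 R"
    "\<And>i \<sigma>. i < d \<Longrightarrow> \<sigma> \<in> ball 0 R - {0} \<Longrightarrow> z i \<sigma> = w i \<sigma>" by metis
  have zfib: "inj_on (\<lambda>i. z i \<sigma>) {..<d}" "{x. poly (Q (\<sigma> ^ N)) x = 0} = (\<lambda>i. z i \<sigma>) ` {..<d}"
    if "\<sigma> \<in> ball 0 R - {0}" for \<sigma>
  proof -
    have "inj_on (\<lambda>i. z i \<sigma>) {..<d} \<longleftrightarrow> inj_on (\<lambda>i. w i \<sigma>) {..<d}"
      by (rule inj_on_cong) (use z(2) that in simp)
    then show "inj_on (\<lambda>i. z i \<sigma>) {..<d}" using wfib[OF that] by blast
    have "(\<lambda>i. z i \<sigma>) ` {..<d} = (\<lambda>i. w i \<sigma>) ` {..<d}"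
      by (rule image_cong) (use z(2) that in auto)
    then show "{x. poly (Q (\<sigma> ^ N)) x = 0} = (\<lambda>i. z i \<sigma>) ` {..<d}" using wfib[OF that] by simp
  qed
  have prodne: "poly (Q (\<sigma> ^ N)) x = coeff (Q (\<sigma> ^ N)) d * (\<Prod>i<d. (x - z i \<sigma>))" if "\<sigma> \<in> ball 0 R - {0}" for \<sigma> x
    using poly_rsquarefree_eq_prod[OF _ zfib[OF that]] sqw[OF that] by blast
  have "poly (Q (\<sigma> ^ N)) x = coeff (Q (\<sigma> ^ N)) d * (\<Prod>i<d. (x - z i \<sigma>))" if \<sigma>: "\<sigma> \<in> ball 0 R" for \<sigma> x
  proof (cases "\<sigma> = 0")
    case False
    then show ?thesis using prodne that by blast
  next
    case True
    \<comment> \<open>The factorisation is known off 0 and passes to 0 by continuity of both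
      sides.\<close>
    define D where "D \<sigma> = (\<Sum>k\<le>d. coeff (Q (\<sigma> ^ N)) k * x ^ k) - coeff (Q (\<sigma> ^ N)) d * (\<Prod>i<d. (x - z i \<sigma>))" for \<sigma>
    have D: "D \<sigma> = poly (Q (\<sigma> ^ N)) x - coeff (Q (\<sigma> ^ N)) d * (\<Prod>i<d. (x - z i \<sigma>))" if "\<sigma> \<in> ball 0 R" for \<sigma>
      unfolding D_def poly_altdef deg[OF powN[OF that]] ..
    have "continuous_on (ball 0 R) D"
      unfolding D_def by (intro continuous_intros contN holomorphic_on_imp_continuous_on z(1)) auto
    then have "D 0 = 0"
      by (rule continuous_zero_at_0[OF _ R(1)]) (use D prodne in auto)
    then show ?thesis using D[OF \<sigma>] True by simp
  qed
  then have "puiseux_branches Q d N R z"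
    unfolding puiseux_branches_def using z(1) zfib(1) by blast
  then show ?thesis by blast
qed

section \<open>Persistence of branches\<close>

lemma puiseux_branches_roots:
  assumes br: "puiseux_branches Q d N R z" and \<sigma>: "\<sigma> \<in> ball 0 R" and lc: "coeff (Q (\<sigma> ^ N)) d \<noteq> 0"
  shows "poly (Q (\<sigma> ^ N)) x = 0 \<longleftrightarrow> (\<exists>i<d. x = z i \<sigma>)"
proof -
  have "poly (Q (\<sigma> ^ N)) x = coeff (Q (\<sigma> ^ N)) d * (\<Prod>i<d. (x - z i \<sigma>))"
    using br \<sigma> unfolding puiseux_branches_def by blast
  then show ?thesis using lc by auto
qed

lemma branch_rotation:
  assumes br: "puiseux_branches Q d N R z" and lc: "\<And>\<sigma>. \<sigma> \<in> ball 0 R \<Longrightarrow> coeff (Q (\<sigma> ^ N)) d \<noteq> 0"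
    and \<omega>: "norm \<omega> = 1" "\<omega> ^ N = 1" and i: "i < d" and \<sigma>: "\<sigma> \<in> ball 0 R"
  shows "\<exists>j<d. z i (\<omega> * \<sigma>) = z j \<sigma>"
proof -
  have b: "\<omega> * \<sigma> \<in> ball 0 R" using \<sigma> \<omega> by (simp add: norm_mult)
  have e: "(\<omega> * \<sigma>) ^ N = \<sigma> ^ N" using \<omega> by (simp add: power_mult_distrib)
  have "poly (Q ((\<omega> * \<sigma>) ^ N)) (z i (\<omega> * \<sigma>)) = 0"
    using puiseux_branches_roots[OF br b lc[OF b]] i by blast
  then show ?thesis unfolding e puiseux_branches_roots[OF br \<sigma> lc[OF \<sigma>]] .
qed

text \<open>Since the \<open>N\<close>-th powers of \<sigma> and \<omega> \<sigma> agree, the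
  rotated branch is a second section of the same covering of the punctured disc. That disc is
  connected, so agreement at one point is agreement everywhere.\<close>

lemma branch_rotation_dichotomy:
  assumes br: "puiseux_branches Q d N R z" and lc: "\<And>\<sigma>. \<sigma> \<in> ball 0 R \<Longrightarrow> coeff (Q (\<sigma> ^ N)) d \<noteq> 0"
    and \<omega>: "norm \<omega> = 1" "\<omega> ^ N = 1" and i: "i < d"
    and \<sigma>0: "\<sigma>0 \<in> ball 0 R - {0}" "z i (\<omega> * \<sigma>0) = z i \<sigma>0" and \<sigma>: "\<sigma> \<in> ball 0 R"
  shows "z i (\<omega> * \<sigma>) = z i \<sigma>"
proof (cases "\<sigma> = 0")
  case False
  have hol: "z i holomorphic_on ball 0 R" if "i < d" for i using br that unfolding puiseux_branches_def by blast
  have loc: "local_sections (ball 0 R - {0}) (\<lambda>\<sigma>. (\<lambda>i. z i \<sigma>) ` {..<d})"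
    unfolding local_sections_def
  proof (intro ballI exI[of _ UNIV] exI[of _ d] exI[of _ z] conjI allI impI)
    show "continuous_on ((ball 0 R - {0}) \<inter> UNIV) (z i)" if "i < d" for i
      by (rule continuous_on_subset[OF holomorphic_on_imp_continuous_on[OF hol[OF that]]]) auto
    show "inj_on (\<lambda>i. z i x) {..<d}" if "x \<in> (ball 0 R - {0}) \<inter> UNIV" for x
      using br that unfolding puiseux_branches_def by blast
  qed auto
  have cont: "continuous_on (ball 0 R) (z i)" by (rule holomorphic_on_imp_continuous_on[OF hol[OF i]])
  have rot: "\<omega> * \<sigma> \<in> ball 0 R" if "\<sigma> \<in> ball 0 R" for \<sigma> using that \<omega> by (simp add: norm_mult)
  show ?thesis
  proof (rule section_unique[OF loc connected_punctured_ball, of "\<lambda>\<sigma>. z i (\<omega> * \<sigma>)" "z i" \<sigma>0 \<sigma>])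
    show "continuous_on (ball 0 R - {0}) (\<lambda>\<sigma>. z i (\<omega> * \<sigma>))"
      by (rule continuous_on_compose2[OF cont]) (use rot in \<open>auto intro!: continuous_intros\<close>)
    show "continuous_on (ball 0 R - {0}) (z i)" by (rule continuous_on_subset[OF cont]) auto
    show "z i (\<omega> * x) \<in> (\<lambda>i. z i x) ` {..<d}" if "x \<in> ball 0 R - {0}" for x
      using branch_rotation[OF br lc \<omega> i, of x] that by blast
  qed (use \<sigma>0 \<sigma> False i in auto)
qed simp

text \<open>Makes a strict inequality over \<open>x0\<close> persist uniformly on a compact set,
  here the points on a circle paired with the values of a branch.\<close>

lemma compact_tube:
  fixes \<Phi> :: "'q::euclidean_space \<times> 'p::euclidean_space \<Rightarrow> real"
  assumes cont: "continuous_on UNIV \<Phi>" and K: "compact K" and neg: "\<And>\<kappa>. \<kappa> \<in> K \<Longrightarrow> \<Phi> (\<kappa>, x0) < 0"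
  shows "\<exists>e>0. \<forall>p \<kappa>. dist p x0 < e \<longrightarrow> \<kappa> \<in> K \<longrightarrow> \<Phi> (\<kappa>, p) < 0"
proof (cases "K = {}")
  case True
  then show ?thesis by (intro exI[of _ 1]) simp
next
  case False
  have "open (\<Phi> -` {..<0})" using cont by (simp add: open_vimage)
  then have ope: "openin (top_of_set (K \<times> UNIV)) ((K \<times> UNIV) \<inter> \<Phi> -` {..<0})" by (simp add: openin_open_Int)
  obtain V where V: "openin (top_of_set UNIV) V" "x0 \<in> V" "K \<times> V \<subseteq> (K \<times> UNIV) \<inter> \<Phi> -` {..<0}"
    by (rule tube_lemma[OF K False _ ope, of x0]) (use neg in auto)
  then have "open V" by simp
  then obtain e where e: "e > 0" "ball x0 e \<subseteq> V" using V(2) openE by blast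
  have "\<Phi> (\<kappa>, p) < 0" if "dist p x0 < e" "\<kappa> \<in> K" for p \<kappa>
  proof -
    have "p \<in> V" using e(2) that(1) by (auto simp: dist_commute)
    then show ?thesis using V(3) that(2) by auto
  qed
  with e(1) show ?thesis by blast
qed

lemma branches_separated:
  assumes br: "puiseux_branches Q d N R z" and r: "0 < r" "r < R"
  obtains \<delta> where "\<delta> > 0" "\<And>\<sigma> i j. norm \<sigma> = r \<Longrightarrow> i < d \<Longrightarrow> j < d \<Longrightarrow> i \<noteq> j \<Longrightarrow> \<delta> \<le> norm (z i \<sigma> - z j \<sigma>)"
proof -
  have hol: "z i holomorphic_on ball 0 R" if "i < d" for i using br that unfolding puiseux_branches_def by blast
  have sub: "sphere 0 r \<subseteq> ball (0::complex) R" using r by auto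
  have "\<exists>m>0. \<forall>\<sigma>\<in>sphere 0 r. m \<le> norm (z i \<sigma> - z j \<sigma>)" if ij: "i < d" "j < d" "i \<noteq> j" for i j
  proof -
    have c: "continuous_on (sphere 0 r) (\<lambda>\<sigma>. norm (z i \<sigma> - z j \<sigma>))"
      by (intro continuous_intros continuous_on_subset[OF holomorphic_on_imp_continuous_on[OF hol] sub] ij)
    have ne: "sphere (0::complex) r \<noteq> {}" using r by simp
    obtain \<sigma>0 where \<sigma>0: "\<sigma>0 \<in> sphere 0 r" "\<And>\<sigma>. \<sigma> \<in> sphere 0 r \<Longrightarrow> norm (z i \<sigma>0 - z j \<sigma>0) \<le> norm (z i \<sigma> - z j \<sigma>)"
      using continuous_attains_inf[OF compact_sphere ne c] by blast
    have "\<sigma>0 \<in> ball 0 R - {0}" using \<sigma>0(1) r by auto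
    then have "inj_on (\<lambda>i. z i \<sigma>0) {..<d}" using br unfolding puiseux_branches_def by blast
    then have "z i \<sigma>0 \<noteq> z j \<sigma>0" using ij by (auto simp: inj_on_def)
    then have "norm (z i \<sigma>0 - z j \<sigma>0) > 0" by simp
    then show ?thesis using \<sigma>0(2) by blast
  qed
  note sep = this
  have "\<forall>p. \<exists>m>0. fst p < d \<and> snd p < d \<and> fst p \<noteq> snd p \<longrightarrow> (\<forall>\<sigma>\<in>sphere 0 r. m \<le> norm (z (fst p) \<sigma> - z (snd p) \<sigma>))"
  proof
    fix p
    show "\<exists>m>0. fst p < d \<and> snd p < d \<and> fst p \<noteq> snd p \<longrightarrow> (\<forall>\<sigma>\<in>sphere 0 r. m \<le> norm (z (fst p) \<sigma> - z (snd p) \<sigma>))"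
    proof (cases "fst p < d \<and> snd p < d \<and> fst p \<noteq> snd p")
      case True
      then have "\<exists>m>0. \<forall>\<sigma>\<in>sphere 0 r. m \<le> norm (z (fst p) \<sigma> - z (snd p) \<sigma>)"
        by (intro sep) simp_all
      then obtain m where "m > 0 \<and> (\<forall>\<sigma>\<in>sphere 0 r. m \<le> norm (z (fst p) \<sigma> - z (snd p) \<sigma>))" ..
      then show ?thesis by (intro exI[of _ m] conjI impI) (rule conjunct1, assumption, rule conjunct2)
    next
      case False
      then show ?thesis by (intro exI[of _ "1::real"] conjI impI) simp_all
    qed
  qed
  then obtain m where m: "\<And>p. m p > 0"
    "\<And>p \<sigma>. fst p < d \<Longrightarrow> snd p < d \<Longrightarrow> fst p \<noteq> snd p \<Longrightarrow> \<sigma> \<in> sphere 0 r \<Longrightarrow> m p \<le> norm (z (fst p) \<sigma> - z (snd p) \<sigma>)"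
    by metis
  define \<delta> where "\<delta> = Min (insert 1 (m ` ({..<d} \<times> {..<d})))"
  show ?thesis
  proof (rule that[of \<delta>])
    show "\<delta> > 0" using m(1) by (auto simp: \<delta>_def)
    fix \<sigma> :: complex and i j assume h: "norm \<sigma> = r" "i < d" "j < d" "i \<noteq> j"
    have "\<delta> \<le> m (i, j)" unfolding \<delta>_def using h by (intro Min_le) auto
    also have "\<dots> \<le> norm (z i \<sigma> - z j \<sigma>)" using m(2)[of "(i, j)" \<sigma>] h by simp
    finally show "\<delta> \<le> norm (z i \<sigma> - z j \<sigma>)" .
  qed
qed

text \<open>At each point of the circle proximity defines an injection of indices, hence a
  permutation. It is locally constant in \<sigma>, and the circle is connected, so one permutation
  serves the whole circle.\<close>

lemma matching_on_circle:
  fixes z z' :: "nat \<Rightarrow> complex \<Rightarrow> complex"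
  assumes cont: "\<And>i. i < d \<Longrightarrow> continuous_on (sphere 0 r) (z i)" "\<And>i. i < d \<Longrightarrow> continuous_on (sphere 0 r) (z' i)"
    and r: "r > 0" and near: "\<And>\<sigma> i. norm \<sigma> = r \<Longrightarrow> i < d \<Longrightarrow> \<exists>j<d. dist (z' j \<sigma>) (z i \<sigma>) < \<eta>"
    and sep: "\<And>\<sigma> i j. norm \<sigma> = r \<Longrightarrow> i < d \<Longrightarrow> j < d \<Longrightarrow> i \<noteq> j \<Longrightarrow> 2 * \<eta> \<le> dist (z i \<sigma>) (z j \<sigma>)"
  shows "\<exists>\<pi>. bij_betw \<pi> {..<d} {..<d} \<and> (\<forall>i<d. \<forall>\<sigma>. norm \<sigma> = r \<longrightarrow> dist (z' (\<pi> i) \<sigma>) (z i \<sigma>) < \<eta>)"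
proof -
  have "\<forall>\<sigma> i. \<exists>j. norm \<sigma> = r \<longrightarrow> i < d \<longrightarrow> j < d \<and> dist (z' j \<sigma>) (z i \<sigma>) < \<eta>"
    using near by blast
  then obtain c where c: "\<And>\<sigma> i. norm \<sigma> = r \<Longrightarrow> i < d \<Longrightarrow> c \<sigma> i < d \<and> dist (z' (c \<sigma> i) \<sigma>) (z i \<sigma>) < \<eta>"
    by metis
  have close: "i = i'" if h: "norm \<sigma> = r" "i < d" "i' < d" "dist w (z i \<sigma>) < \<eta>" "dist w (z i' \<sigma>) < \<eta>" for \<sigma> i i' w
  proof (rule ccontr)
    assume "i \<noteq> i'"
    have "dist (z i \<sigma>) (z i' \<sigma>) \<le> dist w (z i \<sigma>) + dist w (z i' \<sigma>)" by (metis dist_commute dist_triangle)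
    also have "\<dots> < 2 * \<eta>" using h by simp
    finally show False using sep[of \<sigma> i i'] h \<open>i \<noteq> i'\<close> by simp
  qed
  have inj: "inj_on (c \<sigma>) {..<d}" if "norm \<sigma> = r" for \<sigma>
  proof (rule inj_onI)
    fix i i' assume h: "i \<in> {..<d}" "i' \<in> {..<d}" "c \<sigma> i = c \<sigma> i'"
    show "i = i'" by (rule close[OF that, of i i' "z' (c \<sigma> i) \<sigma>"]) (use h c[OF that, of i] c[OF that, of i'] in auto)
  qed
  have bij: "bij_betw (c \<sigma>) {..<d} {..<d}" if "norm \<sigma> = r" for \<sigma>
  proof -
    have "c \<sigma> ` {..<d} \<subseteq> {..<d}" using c[OF that] by auto
    from endo_inj_surj[OF finite_lessThan this inj[OF that]] show ?thesis
      unfolding bij_betw_def using inj[OF that] by blast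
  qed
  have uniq: "j = c \<sigma> i" if h: "norm \<sigma> = r" "i < d" "j < d" "dist (z' j \<sigma>) (z i \<sigma>) < \<eta>" for \<sigma> i j
  proof -
    obtain i' where i': "i' < d" "j = c \<sigma> i'" using bij[OF h(1)] h(3) unfolding bij_betw_def by auto
    have "i = i'" by (rule close[OF h(1,2) i'(1) h(4)]) (use c[OF h(1) i'(1)] i'(2) in simp)
    then show ?thesis using i' by simp
  qed
  have const: "(\<lambda>\<sigma>. c \<sigma> i) constant_on sphere 0 r" if i: "i < d" for i
  proof (rule locally_constant_imp_constant)
    show "connected (sphere (0::complex) r)" by (rule connected_sphere) simp
    fix a :: complex assume a: "a \<in> sphere 0 r"
    let ?j = "c a i"
    have j: "?j < d" "dist (z' ?j a) (z i a) < \<eta>" using c[of a i] a i by auto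
    have "continuous_on (sphere 0 r) (\<lambda>\<sigma>. dist (z' ?j \<sigma>) (z i \<sigma>))"
      by (intro continuous_intros cont i j)
    then have "openin (top_of_set (sphere 0 r)) (sphere 0 r \<inter> (\<lambda>\<sigma>. dist (z' ?j \<sigma>) (z i \<sigma>)) -` {..<\<eta>})"
      by (rule continuous_openin_preimage_gen) simp
    moreover have "c \<sigma> i = c a i" if "\<sigma> \<in> sphere 0 r \<inter> (\<lambda>\<sigma>. dist (z' ?j \<sigma>) (z i \<sigma>)) -` {..<\<eta>}" for \<sigma>
      using uniq[of \<sigma> i ?j] that i j by simp
    ultimately show "\<exists>T. openin (top_of_set (sphere 0 r)) T \<and> a \<in> T \<and> (\<forall>x\<in>T. c x i = c a i)"
      using a j by (intro exI[of _ "sphere 0 r \<inter> (\<lambda>\<sigma>. dist (z' ?j \<sigma>) (z i \<sigma>)) -` {..<\<eta>}"]) blast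
  qed
  let ?\<pi> = "c (of_real r)"
  have r0: "norm (of_real r :: complex) = r" using r by simp
  have "dist (z' (?\<pi> i) \<sigma>) (z i \<sigma>) < \<eta>" if "i < d" "norm \<sigma> = r" for i \<sigma>
  proof -
    have "c \<sigma> i = ?\<pi> i" using const[OF that(1)] that(2) r0 unfolding constant_on_def by (metis mem_sphere_0)
    then show ?thesis using c[OF that(2,1)] by simp
  qed
  then show ?thesis using bij[OF r0] by blast
qed

lemma puiseux_branches_permute:
  assumes br: "puiseux_branches Q d N R z" and \<pi>: "bij_betw \<pi> {..<d} {..<d}"
  shows "puiseux_branches Q d N R (\<lambda>i. z (\<pi> i))"
  unfolding puiseux_branches_def
proof (intro conjI allI impI ballI)
  have \<pi>d: "\<pi> i < d" if "i < d" for i using \<pi> that unfolding bij_betw_def by auto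
  show "z (\<pi> i) holomorphic_on ball 0 R" if "i < d" for i
    using br \<pi>d[OF that] unfolding puiseux_branches_def by blast
  show "poly (Q (\<sigma> ^ N)) x = coeff (Q (\<sigma> ^ N)) d * (\<Prod>i<d. (x - z (\<pi> i) \<sigma>))" if "\<sigma> \<in> ball 0 R" for \<sigma> x
  proof -
    have "(\<Prod>i<d. (x - z (\<pi> i) \<sigma>)) = (\<Prod>i<d. (x - z i \<sigma>))"
      using prod.reindex_bij_betw[OF \<pi>, of "\<lambda>i. x - z i \<sigma>"] .
    then show ?thesis using br that unfolding puiseux_branches_def by simp
  qed
  show "inj_on (\<lambda>i. z (\<pi> i) \<sigma>) {..<d}" if "\<sigma> \<in> ball 0 R - {0}" for \<sigma>
  proof -
    have "inj_on (\<lambda>i. z i \<sigma>) {..<d}" using br that unfolding puiseux_branches_def by blast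
    then have "inj_on ((\<lambda>i. z i \<sigma>) \<circ> \<pi>) {..<d}" using \<pi> unfolding bij_betw_def by (intro comp_inj_on) auto
    then show ?thesis by (simp add: o_def)
  qed
qed

text \<open>\<open>R\<close> and \<open>N\<close> are common to all parameters near
  \<open>x0\<close>, so that branches over different parameters are functions on the same disc. The
  parameter will be a pair of a point of the submanifold and a direction.\<close>

locale puiseux_family =
  fixes Q :: "'p::euclidean_space \<Rightarrow> complex \<Rightarrow> complex poly" and S :: "'p set" and x0 :: 'p
    and d N :: nat and R e0 :: real
  assumes cont: "\<And>k. continuous_on UNIV (\<lambda>(p, s). coeff (Q p s) k)"
    and x0: "x0 \<in> S" and R: "R > 0" and e0: "e0 > 0" and N: "N > 0"
    and deg: "\<And>p s. p \<in> S \<Longrightarrow> dist p x0 < e0 \<Longrightarrow> s \<in> ball 0 (R ^ N) \<Longrightarrow> degree (Q p s) = d"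
    and lc: "\<And>p s. p \<in> S \<Longrightarrow> dist p x0 < e0 \<Longrightarrow> s \<in> ball 0 (R ^ N) \<Longrightarrow> coeff (Q p s) d \<noteq> 0"
    and branches: "\<And>p. p \<in> S \<Longrightarrow> dist p x0 < e0 \<Longrightarrow> \<exists>z. puiseux_branches (Q p) d N R z"
begin

lemma powN: "\<sigma> ^ N \<in> ball 0 (R ^ N)" if "\<sigma> \<in> ball 0 R" for \<sigma> :: complex
  using that N by (simp add: norm_power power_strict_mono)

lemma near_branches:
  assumes z: "puiseux_branches (Q x0) d N R z" and r: "0 < r" "r < R" and \<eta>: "\<eta> > 0" and i: "i < d"
  shows "\<exists>e>0. \<forall>p\<in>S. dist p x0 < e \<longrightarrow> (\<forall>\<sigma>. norm \<sigma> = r \<longrightarrow> (\<exists>y. poly (Q p (\<sigma> ^ N)) y = 0 \<and> dist y (z i \<sigma>) < \<eta>))"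
proof -
  have hol: "z i holomorphic_on ball 0 R" using z i unfolding puiseux_branches_def by blast
  have sub: "sphere 0 r \<subseteq> ball (0::complex) R" using r by auto
  let ?K = "(\<lambda>\<sigma>. (\<sigma> ^ N, z i \<sigma>)) ` sphere 0 r"
  have K: "compact ?K"
    by (intro compact_continuous_image continuous_intros continuous_on_subset[OF holomorphic_on_imp_continuous_on[OF hol] sub]) auto
  define \<Phi> where "\<Phi> = (\<lambda>(q :: complex \<times> complex, p). norm (\<Sum>k\<le>d. coeff (Q p (fst q)) k * snd q ^ k) - norm (coeff (Q p (fst q)) d) * \<eta> ^ d)"
  have c: "continuous_on UNIV (\<lambda>w::(complex \<times> complex) \<times> 'p. coeff (Q (snd w) (fst (fst w))) k)" for k
    using continuous_on_compose2[OF cont[of k], of UNIV "\<lambda>w::(complex \<times> complex) \<times> 'p. (snd w, fst (fst w))"]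
    by (auto simp: continuous_on_fst continuous_on_snd continuous_on_Pair)
  have "continuous_on UNIV \<Phi>"
    unfolding \<Phi>_def case_prod_unfold by (intro continuous_intros c)
  moreover have "\<Phi> (\<kappa>, x0) < 0" if "\<kappa> \<in> ?K" for \<kappa>
  proof -
    from that obtain \<sigma> where "\<kappa> = (\<sigma> ^ N, z i \<sigma>)" "\<sigma> \<in> sphere 0 r" by (rule imageE)
    then have \<sigma>: "norm \<sigma> = r" "\<kappa> = (\<sigma> ^ N, z i \<sigma>)" by simp_all
    have b: "\<sigma> \<in> ball 0 R" using \<sigma> r by simp
    have l: "coeff (Q x0 (\<sigma> ^ N)) d \<noteq> 0" using lc[OF x0 _ powN[OF b]] e0 by simp
    have "poly (Q x0 (\<sigma> ^ N)) (z i \<sigma>) = 0" using puiseux_branches_roots[OF z b l] i by blast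
    then have "(\<Sum>k\<le>d. coeff (Q x0 (\<sigma> ^ N)) k * z i \<sigma> ^ k) = 0"
      using deg[OF x0 _ powN[OF b]] e0 unfolding poly_altdef by simp
    then show ?thesis using l \<eta> by (simp add: \<Phi>_def \<sigma>)
  qed
  ultimately obtain e where e: "e > 0" "\<And>p \<kappa>. dist p x0 < e \<Longrightarrow> \<kappa> \<in> ?K \<Longrightarrow> \<Phi> (\<kappa>, p) < 0"
    using compact_tube[OF _ K, of \<Phi> x0] by blast
  have "\<exists>y. poly (Q p (\<sigma> ^ N)) y = 0 \<and> dist y (z i \<sigma>) < \<eta>"
    if p: "p \<in> S" "dist p x0 < min e e0" and \<sigma>: "norm \<sigma> = r" for p \<sigma>
  proof (rule root_near_if_poly_small[OF _ \<eta>])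
    have b: "\<sigma> \<in> ball 0 R" using \<sigma> r by simp
    have dg: "degree (Q p (\<sigma> ^ N)) = d" using deg[OF p(1) _ powN[OF b]] p(2) by simp
    have "\<Phi> ((\<sigma> ^ N, z i \<sigma>), p) < 0" using e(2)[of p] p(2) \<sigma> by auto
    then show "norm (poly (Q p (\<sigma> ^ N)) (z i \<sigma>)) < norm (lead_coeff (Q p (\<sigma> ^ N))) * \<eta> ^ degree (Q p (\<sigma> ^ N))"
      unfolding poly_altdef dg by (simp add: \<Phi>_def)
  qed
  then show ?thesis using e(1) e0 by (intro exI[of _ "min e e0"]) auto
qed

text \<open>Orders of \<open>z i - z i 0\<close> are compared only up to \<open>N\<close>, because
  rotation by an \<open>N\<close>-th root of unity cannot see the coefficient of index
  \<open>N\<close>. The growth estimates use no more than that, since a line is linear in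
  \<open>s = \<sigma> ^ N\<close>.\<close>

theorem branches_persist:
  assumes z: "puiseux_branches (Q x0) d N R z" and \<eta>: "\<eta> > 0"
  shows "\<exists>e>0. e \<le> e0 \<and> (\<forall>p\<in>S. dist p x0 < e \<longrightarrow> (\<exists>z'. puiseux_branches (Q p) d N R z' \<and>
     (\<forall>i<d. dist (z' i 0) (z i 0) < \<eta>) \<and> (\<forall>i<d. \<forall>j<d. z i 0 = z j 0 \<longrightarrow> z' i 0 = z' j 0) \<and>
     (\<forall>i<d. \<forall>k\<le>N. vanishes_to k (\<lambda>\<sigma>. z i \<sigma> - z i 0) R \<longrightarrow> vanishes_to k (\<lambda>\<sigma>. z' i \<sigma> - z' i 0) R)))"
proof -
  define r where "r = R / 2"
  have r: "0 < r" "r < R" using R by (auto simp: r_def)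
  obtain \<delta> where \<delta>: "\<delta> > 0" "\<And>\<sigma> i j. norm \<sigma> = r \<Longrightarrow> i < d \<Longrightarrow> j < d \<Longrightarrow> i \<noteq> j \<Longrightarrow> \<delta> \<le> norm (z i \<sigma> - z j \<sigma>)"
    using branches_separated[OF z r] by blast
  \<comment> \<open>When two branches move by less than \<delta>/6 each, their difference moves by
    at most \<delta>/3, as \<open>vanishes_to_persists\<close> requires.\<close>
  define \<eta>' where "\<eta>' = min (\<eta> / 2) (\<delta> / 6)"
  have \<eta>': "\<eta>' > 0" "\<eta>' < \<eta>" "2 * \<eta>' \<le> \<delta> / 3" using \<eta> \<delta>(1) by (auto simp: \<eta>'_def)
  have "\<forall>i. \<exists>e>0. i < d \<longrightarrow> (\<forall>p\<in>S. dist p x0 < e \<longrightarrow> (\<forall>\<sigma>. norm \<sigma> = r \<longrightarrow> (\<exists>y. poly (Q p (\<sigma> ^ N)) y = 0 \<and> dist y (z i \<sigma>) < \<eta>')))"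
    using near_branches[OF z r \<eta>'(1)] zero_less_one_class.zero_less_one by metis
  then obtain e1 where e1: "\<And>i. e1 i > 0" "\<And>i p \<sigma>. i < d \<Longrightarrow> p \<in> S \<Longrightarrow> dist p x0 < e1 i \<Longrightarrow> norm \<sigma> = r \<Longrightarrow>
      \<exists>y. poly (Q p (\<sigma> ^ N)) y = 0 \<and> dist y (z i \<sigma>) < \<eta>'" by metis
  define e where "e = Min (insert e0 (e1 ` {..<d}))"
  have e: "e > 0" "e \<le> e0" "\<And>i. i < d \<Longrightarrow> e \<le> e1 i" using e1(1) e0 by (auto simp: e_def)
  have hol: "z i holomorphic_on ball 0 R" if "i < d" for i using z that unfolding puiseux_branches_def by blast
  have sub: "sphere 0 r \<subseteq> ball (0::complex) R" using r by auto
  define \<omega> where "\<omega> = cis (2 * pi / real N)"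
  have "real N * (2 * pi / real N) = 2 * pi" using N by simp
  then have \<omega>: "norm \<omega> = 1" "\<omega> ^ N = 1" unfolding \<omega>_def Complex.DeMoivre by simp_all
  have \<omega>j: "\<omega> ^ j \<noteq> 1" if j: "0 < j" "j < N" for j
  proof
    assume "\<omega> ^ j = 1"
    then have "cis (real j * (2 * pi / real N)) = 1" unfolding \<omega>_def Complex.DeMoivre .
    then have "exp (\<i> * of_real (real j * (2 * pi / real N))) = 1" unfolding cis_conv_exp .
    then obtain n :: int where n: "real j * (2 * pi / real N) = of_int (2 * n) * pi"
      unfolding exp_eq_1 by auto
    have "(2 * pi) * (real j / real N) = real j * (2 * pi / real N)" by (simp add: field_simps)
    also have "\<dots> = (2 * pi) * of_int n" unfolding n by simp
    finally have "real j / real N = of_int n" by (simp only: mult_cancel_left) simp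
    then have "real j = of_int n * real N" using N by (simp add: field_simps)
    then have *: "int j = n * int N" by (metis of_int_eq_iff of_int_mult of_int_of_nat_eq)
    then have "n > 0" using j by (metis of_nat_0_less_iff zero_less_mult_pos2 N)
    then have "1 * int N \<le> n * int N" by (intro mult_right_mono) auto
    then show False using * j by linarith
  qed
  have main: "\<exists>z'. puiseux_branches (Q p) d N R z' \<and>
     (\<forall>i<d. dist (z' i 0) (z i 0) < \<eta>) \<and> (\<forall>i<d. \<forall>j<d. z i 0 = z j 0 \<longrightarrow> z' i 0 = z' j 0) \<and>
     (\<forall>i<d. \<forall>k\<le>N. vanishes_to k (\<lambda>\<sigma>. z i \<sigma> - z i 0) R \<longrightarrow> vanishes_to k (\<lambda>\<sigma>. z' i \<sigma> - z' i 0) R)"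
    if p: "p \<in> S" "dist p x0 < e" for p
  proof -
    have pe0: "dist p x0 < e0" using p(2) e(2) by simp
    obtain y where y: "puiseux_branches (Q p) d N R y" using branches[OF p(1) pe0] by blast
    have lcp: "coeff (Q p (\<sigma> ^ N)) d \<noteq> 0" if "\<sigma> \<in> ball 0 R" for \<sigma> using lc[OF p(1) pe0 powN[OF that]] .
    have lc0: "coeff (Q x0 (\<sigma> ^ N)) d \<noteq> 0" if "\<sigma> \<in> ball 0 R" for \<sigma> using lc[OF x0 _ powN[OF that]] e0 by simp
    have holy: "y i holomorphic_on ball 0 R" if "i < d" for i using y that unfolding puiseux_branches_def by blast
    have "\<exists>\<pi>. bij_betw \<pi> {..<d} {..<d} \<and> (\<forall>i<d. \<forall>\<sigma>. norm \<sigma> = r \<longrightarrow> dist (y (\<pi> i) \<sigma>) (z i \<sigma>) < \<eta>')"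
    proof (rule matching_on_circle[OF _ _ r(1)])
      show "continuous_on (sphere 0 r) (z i)" if "i < d" for i
        by (rule continuous_on_subset[OF holomorphic_on_imp_continuous_on[OF hol[OF that]] sub])
      show "continuous_on (sphere 0 r) (y i)" if "i < d" for i
        by (rule continuous_on_subset[OF holomorphic_on_imp_continuous_on[OF holy[OF that]] sub])
      show "\<exists>j<d. dist (y j \<sigma>) (z i \<sigma>) < \<eta>'" if h: "norm \<sigma> = r" "i < d" for \<sigma> i
      proof -
        have b: "\<sigma> \<in> ball 0 R" using h r by simp
        obtain x where x: "poly (Q p (\<sigma> ^ N)) x = 0" "dist x (z i \<sigma>) < \<eta>'"
          using e1(2)[OF h(2) p(1) less_le_trans[OF p(2) e(3)[OF h(2)]] h(1)] by blast
        obtain j where j: "j < d" "x = y j \<sigma>"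
          using iffD1[OF puiseux_branches_roots[OF y b lcp[OF b]] x(1)] by auto
        show ?thesis using x(2) j(1) unfolding j(2) by auto
      qed
      show "2 * \<eta>' \<le> dist (z i \<sigma>) (z j \<sigma>)" if "norm \<sigma> = r" "i < d" "j < d" "i \<noteq> j" for \<sigma> i j
        using \<delta>(2)[OF that] \<eta>'(3) \<delta>(1) by (simp add: dist_norm)
    qed
    then obtain \<pi> where \<pi>: "bij_betw \<pi> {..<d} {..<d}" "\<And>i \<sigma>. i < d \<Longrightarrow> norm \<sigma> = r \<Longrightarrow> dist (y (\<pi> i) \<sigma>) (z i \<sigma>) < \<eta>'"
      by blast
    define z' where "z' = (\<lambda>i. y (\<pi> i))"
    have z': "puiseux_branches (Q p) d N R z'" unfolding z'_def by (rule puiseux_branches_permute[OF y \<pi>(1)])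
    have near: "norm (z' i \<sigma> - z i \<sigma>) < \<eta>'" if "i < d" "norm \<sigma> = r" for i \<sigma>
      using \<pi>(2)[OF that] by (simp add: z'_def dist_norm)
    have hol': "z' i holomorphic_on ball 0 R" if "i < d" for i using z' that unfolding puiseux_branches_def by blast
    have inj': "z' i \<sigma> \<noteq> z' j \<sigma>" if "i < d" "j < d" "i \<noteq> j" "\<sigma> \<in> ball 0 R - {0}" for i j \<sigma>
      using z' that unfolding puiseux_branches_def inj_on_def by blast
    have 1: "dist (z' i 0) (z i 0) < \<eta>" if i: "i < d" for i
    proof -
      have "norm (z' i 0 - z i 0) \<le> \<eta>'"
        by (rule max_modulus_circle[of "\<lambda>\<sigma>. z' i \<sigma> - z i \<sigma>" R r])
          (use near[OF i] r in \<open>auto intro!: holomorphic_intros hol hol' i simp: less_imp_le\<close>)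
      then show ?thesis using \<eta>'(2) by (simp add: dist_norm)
    qed
    have 2: "z' i 0 = z' j 0" if ij: "i < d" "j < d" "z i 0 = z j 0" for i j
    proof (cases "i = j")
      case False
      have hg: "(\<lambda>\<sigma>. z i \<sigma> - z j \<sigma>) holomorphic_on ball 0 R" by (intro holomorphic_intros hol ij)
      have "vanishes_to 1 (\<lambda>\<sigma>. z i \<sigma> - z j \<sigma>) R"
        using holomorphic_factor_zero[OF hg] ij(3) unfolding vanishes_to_def by simp
      then have "vanishes_to 1 (\<lambda>\<sigma>. z' i \<sigma> - z' j \<sigma>) R"
      proof (rule vanishes_to_persists[OF _ r \<delta>(1), rotated -1])
        show "(\<lambda>\<sigma>. z' i \<sigma> - z' j \<sigma>) holomorphic_on ball 0 R" by (intro holomorphic_intros hol' ij)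
        show "z' i \<sigma> - z' j \<sigma> \<noteq> 0" if "\<sigma> \<in> ball 0 R - {0}" for \<sigma> using inj'[OF ij(1,2) False that] by simp
        fix \<sigma> :: complex assume \<sigma>: "norm \<sigma> = r"
        have "norm (z' i \<sigma> - z' j \<sigma> - (z i \<sigma> - z j \<sigma>)) = norm ((z' i \<sigma> - z i \<sigma>) - (z' j \<sigma> - z j \<sigma>))" by (simp add: algebra_simps)
        also have "\<dots> \<le> norm (z' i \<sigma> - z i \<sigma>) + norm (z' j \<sigma> - z j \<sigma>)" by (rule norm_triangle_ineq4)
        also have "\<dots> \<le> \<delta> / 3" using near[OF ij(1) \<sigma>] near[OF ij(2) \<sigma>] \<eta>'(3) by linarith
        finally show "norm (z' i \<sigma> - z' j \<sigma> - (z i \<sigma> - z j \<sigma>)) \<le> \<delta> / 3" .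
        show "\<delta> \<le> norm (z i \<sigma> - z j \<sigma>)" using \<delta>(2)[OF \<sigma> ij(1,2) False] .
      qed
      then obtain G where "\<And>\<sigma>. \<sigma> \<in> ball 0 R \<Longrightarrow> z' i \<sigma> - z' j \<sigma> = \<sigma> ^ 1 * G \<sigma>" unfolding vanishes_to_def by blast
      from this[of 0] show ?thesis using R by simp
    qed simp
    have 3: "vanishes_to k (\<lambda>\<sigma>. z' i \<sigma> - z' i 0) R"
      if i: "i < d" and k: "k \<le> N" and van: "vanishes_to k (\<lambda>\<sigma>. z i \<sigma> - z i 0) R" for i k
    proof (rule vanishes_to_rotation[OF hol'[OF i] R \<omega>(1) \<omega>j k])
      have rot: "\<omega> * \<sigma> \<in> ball 0 R" if "\<sigma> \<in> ball 0 R" for \<sigma> using that \<omega> by (simp add: norm_mult)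
      have holrot: "(\<lambda>\<sigma>. f (\<omega> * \<sigma>)) holomorphic_on ball 0 R" if "f holomorphic_on ball 0 R" for f
      proof -
        have "(\<lambda>\<sigma>. \<omega> * \<sigma>) holomorphic_on ball 0 R" "(\<lambda>\<sigma>. \<omega> * \<sigma>) ` ball 0 R \<subseteq> ball 0 R"
          using rot by (auto intro!: holomorphic_intros)
        from holomorphic_on_compose_gen[OF this(1) that this(2)] show ?thesis by (simp add: o_def)
      qed
      have r0: "of_real r \<in> ball (0::complex) R - {0}" "norm (of_real r :: complex) = r" using r by auto
      \<comment> \<open>Either the rotation fixes branch \<open>i\<close>; then it also fixes
        \<open>z' i\<close>, because no other branch is close enough, and the difference is
        identically 0. Or it moves both branches at every point off 0, and the minimum modulus
        argument applies to the two differences.\<close>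
      show "vanishes_to k (\<lambda>\<sigma>. z' i (\<omega> * \<sigma>) - z' i \<sigma>) R"
      proof (cases "z i (\<omega> * of_real r) = z i (of_real r)")
        case True
        obtain j where j: "j < d" "z' i (\<omega> * of_real r) = z' j (of_real r)"
          using branch_rotation[OF z' lcp \<omega> i, of "of_real r"] r0 by blast
        have "j = i"
        proof (rule ccontr)
          assume "j \<noteq> i"
          have "norm (\<omega> * of_real r) = r" using \<omega> r by (simp add: norm_mult)
          then have a: "norm (z' j (of_real r) - z i (of_real r)) < \<eta>'"
            using near[OF i, of "\<omega> * of_real r"] j True by simp
          have "norm (z j (of_real r) - z i (of_real r)) =
            norm ((z' j (of_real r) - z i (of_real r)) - (z' j (of_real r) - z j (of_real r)))" by simp
          also have "\<dots> \<le> norm (z' j (of_real r) - z i (of_real r)) + norm (z' j (of_real r) - z j (of_real r))"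
            by (rule norm_triangle_ineq4)
          also have "\<dots> < \<delta>" using a near[OF j(1) r0(2)] \<eta>'(3) \<delta>(1) by linarith
          finally show False using \<delta>(2)[OF r0(2) j(1) i \<open>j \<noteq> i\<close>] by simp
        qed
        then have "z' i (\<omega> * \<sigma>) = z' i \<sigma>" if "\<sigma> \<in> ball 0 R" for \<sigma>
          using branch_rotation_dichotomy[OF z' lcp \<omega> i r0(1) _ that] j(2) by simp
        then show ?thesis unfolding vanishes_to_def by (intro exI[of _ "\<lambda>_. 0"]) simp
      next
        case False
        have ne: "z i (\<omega> * \<sigma>) \<noteq> z i \<sigma>" if "\<sigma> \<in> ball 0 R - {0}" for \<sigma>
          using branch_rotation_dichotomy[OF z lc0 \<omega> i that, of "of_real r"] False r0 by auto
        have ge: "\<delta> \<le> norm (z i (\<omega> * \<sigma>) - z i \<sigma>)" if \<sigma>: "norm \<sigma> = r" for \<sigma>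
        proof -
          have b: "\<sigma> \<in> ball 0 R - {0}" using \<sigma> r by auto
          obtain j where j: "j < d" "z i (\<omega> * \<sigma>) = z j \<sigma>" using branch_rotation[OF z lc0 \<omega> i, of \<sigma>] b by blast
          then have "j \<noteq> i" using ne[OF b] by auto
          then show ?thesis unfolding j(2) by (rule \<delta>(2)[OF \<sigma> j(1) i])
        qed
        have close: "norm (z' i (\<omega> * \<sigma>) - z' i \<sigma> - (z i (\<omega> * \<sigma>) - z i \<sigma>)) \<le> \<delta> / 3" if \<sigma>: "norm \<sigma> = r" for \<sigma>
        proof -
          have \<sigma>': "norm (\<omega> * \<sigma>) = r" using \<sigma> \<omega> by (simp add: norm_mult)
          have "norm (z' i (\<omega> * \<sigma>) - z' i \<sigma> - (z i (\<omega> * \<sigma>) - z i \<sigma>)) =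
            norm ((z' i (\<omega> * \<sigma>) - z i (\<omega> * \<sigma>)) - (z' i \<sigma> - z i \<sigma>))" by (simp add: algebra_simps)
          also have "\<dots> \<le> norm (z' i (\<omega> * \<sigma>) - z i (\<omega> * \<sigma>)) + norm (z' i \<sigma> - z i \<sigma>)" by (rule norm_triangle_ineq4)
          also have "\<dots> \<le> \<delta> / 3" using near[OF i \<sigma>] near[OF i \<sigma>'] \<eta>'(3) by linarith
          finally show ?thesis .
        qed
        have ne': "z' i (\<omega> * \<sigma>) - z' i \<sigma> \<noteq> 0" if \<sigma>: "\<sigma> \<in> ball 0 R - {0}" for \<sigma>
        proof
          assume "z' i (\<omega> * \<sigma>) - z' i \<sigma> = 0"
          then have "z' i (\<omega> * of_real r) = z' i (of_real r)"
            using branch_rotation_dichotomy[OF z' lcp \<omega> i \<sigma>, of "of_real r"] r0 by simp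
          then have "norm (z i (\<omega> * of_real r) - z i (of_real r)) \<le> \<delta> / 3"
            using close[OF r0(2)] by (simp add: norm_minus_commute)
          then show False using ge[OF r0(2)] \<delta>(1) by linarith
        qed
        obtain G where G: "G holomorphic_on ball 0 R" "\<And>\<sigma>. \<sigma> \<in> ball 0 R \<Longrightarrow> z i \<sigma> - z i 0 = \<sigma> ^ k * G \<sigma>"
          using van unfolding vanishes_to_def by blast
        have "z i (\<omega> * \<sigma>) - z i \<sigma> = \<sigma> ^ k * (\<omega> ^ k * G (\<omega> * \<sigma>) - G \<sigma>)" if "\<sigma> \<in> ball 0 R" for \<sigma>
        proof -
          have "z i (\<omega> * \<sigma>) - z i \<sigma> = (z i (\<omega> * \<sigma>) - z i 0) - (z i \<sigma> - z i 0)" by simp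
          then show ?thesis unfolding G(2)[OF that] G(2)[OF rot[OF that]] by (simp add: algebra_simps power_mult_distrib)
        qed
        moreover have "(\<lambda>\<sigma>. \<omega> ^ k * G (\<omega> * \<sigma>) - G \<sigma>) holomorphic_on ball 0 R"
          by (intro holomorphic_on_diff holomorphic_on_mult holomorphic_on_const holrot[OF G(1)] G(1))
        ultimately have v: "vanishes_to k (\<lambda>\<sigma>. z i (\<omega> * \<sigma>) - z i \<sigma>) R" unfolding vanishes_to_def by blast
        have h: "(\<lambda>\<sigma>. z' i (\<omega> * \<sigma>) - z' i \<sigma>) holomorphic_on ball 0 R"
          by (intro holomorphic_on_diff holrot[OF hol'[OF i]] hol'[OF i])
        show ?thesis
        proof (rule vanishes_to_persists[of _ R r \<delta> "\<lambda>\<sigma>. z i (\<omega> * \<sigma>) - z i \<sigma>"])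
          show "z' i (\<omega> * \<sigma>) - z' i \<sigma> \<noteq> 0" if "\<sigma> \<in> ball 0 R - {0}" for \<sigma> by (rule ne'[OF that])
          show "norm (z' i (\<omega> * \<sigma>) - z' i \<sigma> - (z i (\<omega> * \<sigma>) - z i \<sigma>)) \<le> \<delta> / 3" if "norm \<sigma> = r" for \<sigma>
            by (rule close[OF that])
          show "\<delta> \<le> norm (z i (\<omega> * \<sigma>) - z i \<sigma>)" if "norm \<sigma> = r" for \<sigma> by (rule ge[OF that])
        qed (fact h r \<delta>(1) v)+
      qed
    qed
    show ?thesis
    proof (intro exI[of _ z'] conjI allI impI)
      show "dist (z' i 0) (z i 0) < \<eta>" if "i < d" for i by (rule 1[OF that])
      show "z' i 0 = z' j 0" if "i < d" "j < d" "z i 0 = z j 0" for i j by (rule 2[OF that])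
      show "vanishes_to k (\<lambda>\<sigma>. z' i \<sigma> - z' i 0) R"
        if "i < d" "k \<le> N" "vanishes_to k (\<lambda>\<sigma>. z i \<sigma> - z i 0) R" for i k by (rule 3[OF that])
    qed (rule z')
  qed
  show ?thesis
    by (intro exI[of _ e] conjI ballI impI e(1,2) main)
qed

end

section \<open>Growth along the branches\<close>

lemma filterlim_power_at_right_0:
  assumes "N > 0"
  shows "filterlim (\<lambda>\<sigma>::real. \<sigma> ^ N) (at_right 0) (at_right 0)"
  unfolding filterlim_at
proof
  show "((\<lambda>\<sigma>::real. \<sigma> ^ N) \<longlongrightarrow> 0) (at_right 0)"
    using assms by (auto intro!: tendsto_eq_intros simp: power_0_left)
  show "\<forall>\<^sub>F \<sigma>::real in at_right 0. \<sigma> ^ N \<in> {0<..} \<and> \<sigma> ^ N \<noteq> 0"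
    using eventually_at_right_less[of "0::real"] by eventually_elim simp
qed

lemma filterlim_root_at_right_0:
  assumes "N > 0"
  shows "filterlim (root N) (at_right 0) (at_right 0)"
  unfolding filterlim_at
proof
  have "isCont (root N) 0" by (rule isCont_real_root)
  then show "(root N \<longlongrightarrow> 0) (at_right 0)"
    unfolding isCont_def using tendsto_mono[OF at_le[of "{0<..}" UNIV 0]] by fastforce
  show "\<forall>\<^sub>F \<sigma>::real in at_right 0. root N \<sigma> \<in> {0<..} \<and> root N \<sigma> \<noteq> 0"
    using eventually_at_right_less[of "0::real"] by eventually_elim (use assms in simp)
qed

lemma tendsto_at_right_holomorphic:
  assumes "G holomorphic_on ball 0 R" "R > 0"
  shows "((\<lambda>\<sigma>. G (of_real \<sigma>)) \<longlongrightarrow> G 0) (at_right (0::real))"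
proof -
  have "isCont G 0" using holomorphic_on_imp_continuous_on[OF assms(1)] assms(2) by (simp add: continuous_on_eq_continuous_at)
  moreover have "((\<lambda>\<sigma>::real. complex_of_real \<sigma>) \<longlongrightarrow> 0) (at_right 0)"
    by (auto intro!: tendsto_eq_intros)
  ultimately show ?thesis using isCont_tendsto_compose by metis
qed

lemma eventually_of_real_in_ball:
  assumes "R > 0"
  shows "\<forall>\<^sub>F \<sigma> in at_right (0::real). complex_of_real \<sigma> \<in> ball 0 R \<and> \<sigma> > 0 \<and> \<sigma> < 1"
proof -
  have "\<forall>\<^sub>F \<sigma> in at_right (0::real). \<sigma> \<in> {0<..<min R 1}"
    using assms by (intro eventually_at_right_real) simp
  then show ?thesis by eventually_elim simp
qed

text \<open>\<open>K i\<close> is the order of \<open>z i - z0\<close>, cut off at \<open>N\<close>.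
  On the line \<open>z0 + \<gamma> s\<close> with generic \<gamma> the \<open>i\<close>-th factor of
  the polynomial vanishes to order exactly \<open>K i\<close> in \<sigma>, so a bound by the
  \<open>n\<close>-th power of \<open>s\<close> forces the exponents to add up to at least
  \<open>N * n\<close>.\<close>

lemma growth_exponents:
  assumes br: "puiseux_branches Q d N R z" and R: "R > 0" and N: "N > 0"
    and lc: "\<And>\<sigma>. \<sigma> \<in> ball 0 R \<Longrightarrow> coeff (Q (\<sigma> ^ N)) d \<noteq> 0"
    and contd: "isCont (\<lambda>s. coeff (Q s) d) 0"
    and bound: "\<And>\<gamma>::real. \<exists>C. \<forall>\<^sub>F s in at_right 0. norm (poly (Q (of_real s)) (z0 + of_real (\<gamma> * s))) \<le> C * s ^ n"
  shows "\<exists>K. (\<forall>i<d. K i \<le> N \<and> vanishes_to (K i) (\<lambda>\<sigma>. z i \<sigma> - z i 0) R \<and> (z i 0 \<noteq> z0 \<longrightarrow> K i = 0)) \<and> N * n \<le> (\<Sum>i<d. K i)"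
proof -
  have hol: "z i holomorphic_on ball 0 R" if "i < d" for i using br that unfolding puiseux_branches_def by blast
  define P where "P i k G \<longleftrightarrow> k \<le> N \<and> vanishes_to k (\<lambda>\<sigma>. z i \<sigma> - z i 0) R \<and> (z i 0 \<noteq> z0 \<longrightarrow> k = 0) \<and>
     G holomorphic_on ball 0 R \<and> (\<forall>\<sigma>\<in>ball 0 R. z i \<sigma> - z0 = \<sigma> ^ k * G \<sigma>) \<and> (k < N \<longrightarrow> G 0 \<noteq> 0)" for i k G
  have "\<exists>k G. P i k G" if i: "i < d" for i
  proof (cases "z i 0 = z0")
    case False
    have "vanishes_to 0 (\<lambda>\<sigma>. z i \<sigma> - z i 0) R" by (rule vanishes_to_0) (intro holomorphic_intros hol i)
    moreover have "(\<lambda>\<sigma>. z i \<sigma> - z0) holomorphic_on ball 0 R" by (intro holomorphic_intros hol i)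
    ultimately have "P i 0 (\<lambda>\<sigma>. z i \<sigma> - z0)" using False by (simp add: P_def)
    then show ?thesis by blast
  next
    case True
    let ?P = "\<lambda>k. k \<le> N \<and> vanishes_to k (\<lambda>\<sigma>. z i \<sigma> - z i 0) R"
    have "vanishes_to 0 (\<lambda>\<sigma>. z i \<sigma> - z i 0) R" by (rule vanishes_to_0) (intro holomorphic_intros hol i)
    then have P0: "?P 0" by simp
    define k where "k = (GREATEST k. ?P k)"
    have k: "?P k" unfolding k_def using GreatestI_nat[of ?P 0 N] P0 by blast
    have max: "j \<le> k" if "?P j" for j unfolding k_def using Greatest_le_nat[of ?P j N] that by blast
    obtain G where G: "G holomorphic_on ball 0 R" "\<And>\<sigma>. \<sigma> \<in> ball 0 R \<Longrightarrow> z i \<sigma> - z i 0 = \<sigma> ^ k * G \<sigma>"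
      using k unfolding vanishes_to_def by blast
    have "G 0 \<noteq> 0" if "k < N"
    proof
      assume G0: "G 0 = 0"
      obtain G1 where G1: "G1 holomorphic_on ball 0 R" "\<And>\<sigma>. \<sigma> \<in> ball 0 R \<Longrightarrow> G \<sigma> = \<sigma> * G1 \<sigma>"
        using holomorphic_factor_zero[OF G(1) G0] by blast
      have "z i \<sigma> - z i 0 = \<sigma> ^ Suc k * G1 \<sigma>" if "\<sigma> \<in> ball 0 R" for \<sigma>
        unfolding G(2)[OF that] G1(2)[OF that] by simp
      then have "?P (Suc k)" using G1(1) that unfolding vanishes_to_def by auto
      then show False using max by fastforce
    qed
    then have "P i k G"
      using k G unfolding P_def True by blast
    then show ?thesis by blast
  qed
  then obtain K G where KG: "\<And>i. i < d \<Longrightarrow> P i (K i) (G i)" by metis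
  have K: "\<And>i. i < d \<Longrightarrow> K i \<le> N \<and> vanishes_to (K i) (\<lambda>\<sigma>. z i \<sigma> - z i 0) R \<and> (z i 0 \<noteq> z0 \<longrightarrow> K i = 0)"
    and G: "\<And>i. i < d \<Longrightarrow> G i holomorphic_on ball 0 R" "\<And>i \<sigma>. i < d \<Longrightarrow> \<sigma> \<in> ball 0 R \<Longrightarrow> z i \<sigma> - z0 = \<sigma> ^ K i * G i \<sigma>"
      "\<And>i. i < d \<Longrightarrow> K i < N \<Longrightarrow> G i 0 \<noteq> 0"
    using KG unfolding P_def by blast+
  \<comment> \<open>If \<open>K i = N\<close>, the term of the line can cancel the coefficient
    \<open>G i 0\<close> of the branch. Avoiding finitely many values of \<gamma> prevents this for
    all branches at once.\<close>
  have "finite ((\<lambda>i. Re (G i 0)) ` {..<d})" by simp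
  then obtain \<gamma> :: real where \<gamma>: "\<gamma> \<notin> (\<lambda>i. Re (G i 0)) ` {..<d}"
    using ex_new_if_finite infinite_UNIV_char_0 by blast
  obtain C where C: "\<forall>\<^sub>F s in at_right 0. norm (poly (Q (of_real s)) (z0 + of_real (\<gamma> * s))) \<le> C * s ^ n"
    using bound by blast
  let ?L = "\<lambda>i. (if K i = N then of_real \<gamma> else 0) - G i 0"
  have Lne: "?L i \<noteq> 0" if "i < d" for i
  proof (cases "K i = N")
    case True
    have "Re (G i 0) \<noteq> Re (of_real \<gamma>)" using \<gamma> that by auto
    then have "of_real \<gamma> \<noteq> G i 0" by metis
    then show ?thesis using True by simp
  next
    case False
    then show ?thesis using G(3)[OF that] K[OF that] by auto
  qed
  define F where "F i \<sigma> = of_real (\<gamma> * \<sigma> ^ (N - K i)) - G i (of_real \<sigma>)" for i and \<sigma> :: real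
  have Flim: "(F i \<longlongrightarrow> ?L i) (at_right 0)" if i: "i < d" for i
  proof -
    have "((\<lambda>\<sigma>::real. of_real (\<gamma> * \<sigma> ^ (N - K i)) :: complex) \<longlongrightarrow> of_real (\<gamma> * 0 ^ (N - K i))) (at_right 0)"
      by (intro tendsto_intros)
    moreover have "(of_real (\<gamma> * 0 ^ (N - K i)) :: complex) = (if K i = N then of_real \<gamma> else 0)"
      using K[OF i] by (auto simp: power_0_left)
    ultimately show ?thesis
      unfolding F_def by (intro tendsto_diff tendsto_at_right_holomorphic[OF G(1)[OF i] R]) simp
  qed
  let ?A = "\<lambda>\<sigma>::real. coeff (Q (of_real \<sigma> ^ N)) d * (\<Prod>i<d. F i \<sigma>)"
  have "((\<lambda>\<sigma>::real. coeff (Q (of_real \<sigma> ^ N)) d) \<longlongrightarrow> coeff (Q 0) d) (at_right 0)"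
  proof (rule isCont_tendsto_compose[OF contd])
    show "((\<lambda>\<sigma>::real. complex_of_real \<sigma> ^ N) \<longlongrightarrow> 0) (at_right 0)"
      using N by (auto intro!: tendsto_eq_intros simp: power_0_left)
  qed
  then have "(?A \<longlongrightarrow> coeff (Q 0) d * (\<Prod>i<d. ?L i)) (at_right 0)"
    by (intro tendsto_intros Flim) auto
  then have Alim: "((\<lambda>\<sigma>. norm (?A \<sigma>)) \<longlongrightarrow> norm (coeff (Q 0) d * (\<Prod>i<d. ?L i))) (at_right 0)"
    by (rule tendsto_norm)
  have "coeff (Q (0 ^ N)) d \<noteq> 0" using lc[of 0] R by simp
  then have Ane: "coeff (Q 0) d * (\<Prod>i<d. ?L i) \<noteq> 0" using Lne N by (simp add: power_0_left)
  let ?s = "\<Sum>i<d. K i"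
  have polyA: "poly (Q (of_real (\<sigma> ^ N))) (z0 + of_real (\<gamma> * \<sigma> ^ N)) = of_real \<sigma> ^ ?s * ?A \<sigma>"
    if \<sigma>: "complex_of_real \<sigma> \<in> ball 0 R" for \<sigma> :: real
  proof -
    have "poly (Q (of_real \<sigma> ^ N)) (z0 + of_real (\<gamma> * \<sigma> ^ N)) =
      coeff (Q (of_real \<sigma> ^ N)) d * (\<Prod>i<d. (z0 + of_real (\<gamma> * \<sigma> ^ N) - z i (of_real \<sigma>)))"
      using br \<sigma> unfolding puiseux_branches_def by blast
    also have "(\<Prod>i<d. (z0 + of_real (\<gamma> * \<sigma> ^ N) - z i (of_real \<sigma>))) = (\<Prod>i<d. of_real \<sigma> ^ K i * F i \<sigma>)"
    proof (rule prod.cong[OF refl])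
      fix i assume "i \<in> {..<d}"
      then have i: "i < d" by simp
      have "\<sigma> ^ N = \<sigma> ^ K i * \<sigma> ^ (N - K i)" using K[OF i] by (simp add: power_add[symmetric])
      then have "of_real \<sigma> ^ K i * F i \<sigma> = of_real (\<gamma> * \<sigma> ^ N) - of_real \<sigma> ^ K i * G i (of_real \<sigma>)"
        by (simp add: F_def algebra_simps)
      also have "\<dots> = z0 + of_real (\<gamma> * \<sigma> ^ N) - z i (of_real \<sigma>)"
        unfolding G(2)[OF i \<sigma>, symmetric] by simp
      finally show "z0 + of_real (\<gamma> * \<sigma> ^ N) - z i (of_real \<sigma>) = of_real \<sigma> ^ K i * F i \<sigma>" ..
    qed
    also have "\<dots> = of_real \<sigma> ^ ?s * (\<Prod>i<d. F i \<sigma>)" by (simp add: prod.distrib power_sum)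
    finally show ?thesis by (simp add: mult.left_commute)
  qed
  have "N * n \<le> ?s"
  proof (rule ccontr)
    assume less: "\<not> N * n \<le> ?s"
    have "\<forall>\<^sub>F \<sigma> in at_right 0. norm (poly (Q (of_real (\<sigma> ^ N))) (z0 + of_real (\<gamma> * \<sigma> ^ N))) \<le> C * (\<sigma> ^ N) ^ n"
      using filterlim_power_at_right_0[OF N] C unfolding filterlim_iff by blast
    with eventually_of_real_in_ball[OF R] have "\<forall>\<^sub>F \<sigma> in at_right 0. norm (?A \<sigma>) \<le> C * \<sigma> ^ (N * n - ?s)"
    proof eventually_elim
      case (elim \<sigma>)
      have "norm (poly (Q (of_real (\<sigma> ^ N))) (z0 + of_real (\<gamma> * \<sigma> ^ N))) = \<sigma> ^ ?s * norm (?A \<sigma>)"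
        using elim(1) unfolding polyA[OF conjunct1[OF elim(1)]] by (simp add: norm_mult norm_power)
      moreover have "(\<sigma> ^ N) ^ n = \<sigma> ^ ?s * \<sigma> ^ (N * n - ?s)" using less by (simp add: power_mult[symmetric] power_add[symmetric])
      ultimately have "\<sigma> ^ ?s * norm (?A \<sigma>) \<le> \<sigma> ^ ?s * (C * \<sigma> ^ (N * n - ?s))" using elim(2) by (simp add: mult.left_commute)
      then show ?case using elim(1) by simp
    qed
    moreover have "((\<lambda>\<sigma>::real. C * \<sigma> ^ (N * n - ?s)) \<longlongrightarrow> C * 0 ^ (N * n - ?s)) (at_right 0)"
      by (intro tendsto_intros)
    ultimately have "norm (coeff (Q 0) d * (\<Prod>i<d. ?L i)) \<le> C * 0 ^ (N * n - ?s)"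
      using tendsto_le[OF trivial_limit_at_right_real _ Alim] by blast
    moreover have "(0::real) ^ (N * n - ?s) = 0" using less by (simp add: power_0_left)
    ultimately show False using Ane by simp
  qed
  then show ?thesis using K by blast
qed

text \<open>In this direction it is enough that each factor is divisible by the
  \<open>K i\<close>-th power of \<sigma>, so \<gamma> need not be generic and may vary with
  \<open>s\<close>. This freedom is needed because a line in homogeneous coordinates becomes such a
  curve in an affine chart.\<close>

lemma growth_bound:
  assumes br: "puiseux_branches Q d N R z" and R: "R > 0" and N: "N > 0"
    and contd: "isCont (\<lambda>s. coeff (Q s) d) 0"
    and K: "\<And>i. i < d \<Longrightarrow> K i \<le> N \<and> vanishes_to (K i) (\<lambda>\<sigma>. z i \<sigma> - z i 0) R \<and> (z i 0 \<noteq> z0 \<longrightarrow> K i = 0)"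
    and n: "N * n \<le> (\<Sum>i<d. K i)"
    and \<gamma>: "(\<gamma> \<longlongrightarrow> c) (at_right (0::real))"
  shows "\<exists>C. \<forall>\<^sub>F s in at_right 0. norm (poly (Q (of_real s)) (z0 + of_real s * \<gamma> s)) \<le> C * s ^ n"
proof -
  have hol: "z i holomorphic_on ball 0 R" if "i < d" for i using br that unfolding puiseux_branches_def by blast
  define P where "P i G \<longleftrightarrow> G holomorphic_on ball 0 R \<and> (\<forall>\<sigma>\<in>ball 0 R. z i \<sigma> - z0 = \<sigma> ^ K i * G \<sigma>)" for i G
  have "\<exists>G. P i G" if i: "i < d" for i
  proof (cases "K i = 0")
    case True
    have "(\<lambda>\<sigma>. z i \<sigma> - z0) holomorphic_on ball 0 R" by (intro holomorphic_intros hol i)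
    then show ?thesis using True unfolding P_def by (intro exI[of _ "\<lambda>\<sigma>. z i \<sigma> - z0"]) simp
  next
    case False
    then have "z i 0 = z0" using K[OF i] by auto
    then show ?thesis using K[OF i] unfolding vanishes_to_def P_def by simp
  qed
  then obtain G where PG: "\<And>i. i < d \<Longrightarrow> P i (G i)" by metis
  have G: "\<And>i. i < d \<Longrightarrow> G i holomorphic_on ball 0 R" "\<And>i \<sigma>. i < d \<Longrightarrow> \<sigma> \<in> ball 0 R \<Longrightarrow> z i \<sigma> - z0 = \<sigma> ^ K i * G i \<sigma>"
    using PG unfolding P_def by blast+
  define \<gamma>' where "\<gamma>' \<sigma> = \<gamma> (\<sigma> ^ N)" for \<sigma>
  have \<gamma>': "(\<gamma>' \<longlongrightarrow> c) (at_right 0)"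
    unfolding \<gamma>'_def by (rule filterlim_compose[OF \<gamma> filterlim_power_at_right_0[OF N]])
  define F where "F i \<sigma> = of_real (\<sigma> ^ (N - K i)) * \<gamma>' \<sigma> - G i (of_real \<sigma>)" for i and \<sigma> :: real
  let ?A = "\<lambda>\<sigma>::real. coeff (Q (of_real \<sigma> ^ N)) d * (\<Prod>i<d. F i \<sigma>)"
  have "((\<lambda>\<sigma>::real. coeff (Q (of_real \<sigma> ^ N)) d) \<longlongrightarrow> coeff (Q 0) d) (at_right 0)"
  proof (rule isCont_tendsto_compose[OF contd])
    show "((\<lambda>\<sigma>::real. complex_of_real \<sigma> ^ N) \<longlongrightarrow> 0) (at_right 0)"
      using N by (auto intro!: tendsto_eq_intros simp: power_0_left)
  qed
  moreover have "(F i \<longlongrightarrow> of_real (0 ^ (N - K i)) * c - G i 0) (at_right 0)" if "i < d" for i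
    unfolding F_def by (intro tendsto_intros \<gamma>' tendsto_at_right_holomorphic[OF G(1)[OF that] R])
  ultimately have "(?A \<longlongrightarrow> coeff (Q 0) d * (\<Prod>i<d. of_real (0 ^ (N - K i)) * c - G i 0)) (at_right 0)"
    by (intro tendsto_mult tendsto_prod) auto
  then have "\<forall>\<^sub>F \<sigma> in at_right 0. norm (?A \<sigma>) < norm (coeff (Q 0) d * (\<Prod>i<d. of_real (0 ^ (N - K i)) * c - G i 0)) + 1"
    by (intro order_tendstoD(2)[OF tendsto_norm]) auto
  moreover define C where "C = norm (coeff (Q 0) d * (\<Prod>i<d. of_real (0 ^ (N - K i)) * c - G i 0)) + 1"
  ultimately have C: "\<forall>\<^sub>F \<sigma> in at_right 0. norm (?A \<sigma>) < C" by simp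
  have C0: "C \<ge> 0" by (simp add: C_def)
  let ?s = "\<Sum>i<d. K i"
  have polyA: "poly (Q (of_real (\<sigma> ^ N))) (z0 + of_real (\<sigma> ^ N) * \<gamma> (\<sigma> ^ N)) = of_real \<sigma> ^ ?s * ?A \<sigma>"
    if \<sigma>: "complex_of_real \<sigma> \<in> ball 0 R" for \<sigma> :: real
  proof -
    have "poly (Q (of_real \<sigma> ^ N)) (z0 + of_real (\<sigma> ^ N) * \<gamma>' \<sigma>) =
      coeff (Q (of_real \<sigma> ^ N)) d * (\<Prod>i<d. (z0 + of_real (\<sigma> ^ N) * \<gamma>' \<sigma> - z i (of_real \<sigma>)))"
      using br \<sigma> unfolding puiseux_branches_def by blast
    also have "(\<Prod>i<d. (z0 + of_real (\<sigma> ^ N) * \<gamma>' \<sigma> - z i (of_real \<sigma>))) = (\<Prod>i<d. of_real \<sigma> ^ K i * F i \<sigma>)"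
    proof (rule prod.cong[OF refl])
      fix i assume "i \<in> {..<d}"
      then have i: "i < d" by simp
      have "\<sigma> ^ N = \<sigma> ^ K i * \<sigma> ^ (N - K i)" using K[OF i] by (simp add: power_add[symmetric])
      then have "of_real \<sigma> ^ K i * F i \<sigma> = of_real (\<sigma> ^ N) * \<gamma>' \<sigma> - of_real \<sigma> ^ K i * G i (of_real \<sigma>)"
        by (simp add: F_def algebra_simps)
      also have "\<dots> = z0 + of_real (\<sigma> ^ N) * \<gamma>' \<sigma> - z i (of_real \<sigma>)"
        unfolding G(2)[OF i \<sigma>, symmetric] by simp
      finally show "z0 + of_real (\<sigma> ^ N) * \<gamma>' \<sigma> - z i (of_real \<sigma>) = of_real \<sigma> ^ K i * F i \<sigma>" ..
    qed
    also have "\<dots> = of_real \<sigma> ^ ?s * (\<Prod>i<d. F i \<sigma>)" by (simp add: prod.distrib power_sum)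
    finally show ?thesis by (simp add: mult.left_commute \<gamma>'_def)
  qed
  from C eventually_of_real_in_ball[OF R]
  have "\<forall>\<^sub>F \<sigma> in at_right 0. norm (poly (Q (of_real (\<sigma> ^ N))) (z0 + of_real (\<sigma> ^ N) * \<gamma> (\<sigma> ^ N))) \<le> C * (\<sigma> ^ N) ^ n"
  proof eventually_elim
    case (elim \<sigma>)
    have "norm (poly (Q (of_real (\<sigma> ^ N))) (z0 + of_real (\<sigma> ^ N) * \<gamma> (\<sigma> ^ N))) = \<sigma> ^ ?s * norm (?A \<sigma>)"
      using elim(2) unfolding polyA[OF conjunct1[OF elim(2)]] by (simp add: norm_mult norm_power)
    also have "\<dots> \<le> \<sigma> ^ (N * n) * C"
      using elim n C0 by (intro mult_mono power_decreasing) auto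
    finally show ?case by (simp add: power_mult mult.commute)
  qed
  then have "\<forall>\<^sub>F s in at_right 0. norm (poly (Q (of_real (root N s ^ N))) (z0 + of_real (root N s ^ N) * \<gamma> (root N s ^ N))) \<le> C * (root N s ^ N) ^ n"
    using filterlim_root_at_right_0[OF N] unfolding filterlim_iff by blast
  with eventually_at_right_less[of "0::real"]
  have "\<forall>\<^sub>F s in at_right 0. norm (poly (Q (of_real s)) (z0 + of_real s * \<gamma> s)) \<le> C * s ^ n"
    by eventually_elim (use N in \<open>simp add: real_root_pow_pos2\<close>)
  then show ?thesis by blast
qed

lemma order_prod_linear:
  fixes b :: "nat \<Rightarrow> complex"
  assumes "finite I" "c \<noteq> 0"
  shows "order a (Polynomial.smult c (\<Prod>i\<in>I. [:- b i, 1:])) = card {i\<in>I. b i = a}"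
proof -
  have "order a (\<Prod>i\<in>I. [:- b i, 1:]) = card {i\<in>I. b i = a}"
    using assms(1)
  proof (induction I rule: finite_induct)
    case empty
    then show ?case by (simp add: order_0I)
  next
    case (insert x I)
    have "order a ([:- b x, 1:] * (\<Prod>i\<in>I. [:- b i, 1:])) = order a [:- b x, 1:] + order a (\<Prod>i\<in>I. [:- b i, 1:])"
    proof (rule order_mult)
      have "(\<Prod>i\<in>I. [:- b i, 1:]) \<noteq> 0" using insert by simp
      then show "[:- b x, 1:] * (\<Prod>i\<in>I. [:- b i, 1:]) \<noteq> 0" unfolding mult_eq_0_iff by simp
    qed
    moreover have "order a [:- b x, 1:] = (if b x = a then 1 else 0)"
    proof (cases "b x = a")
      case True
      then show ?thesis using order_power_n_n[of a 1] by simp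
    next
      case False
      then show ?thesis by (simp add: order_0I)
    qed
    moreover have "{i \<in> insert x I. b i = a} = (if b x = a then insert x {i\<in>I. b i = a} else {i\<in>I. b i = a})" by auto
    ultimately show ?case using insert by simp
  qed
  then show ?thesis using assms(2) by (simp add: order_smult)
qed

section \<open>Roots, multiplicities and growth rates under a change of the parameter\<close>

context puiseux_family
begin

lemma poly_at_0:
  assumes p: "p \<in> S" "dist p x0 < e0" and z: "puiseux_branches (Q p) d N R z"
  shows "order a (Q p 0) = card {i\<in>{..<d}. z i 0 = a}" "poly (Q p 0) a = 0 \<longleftrightarrow> (\<exists>i<d. a = z i 0)"
proof -
  have R0: "(0::complex) \<in> ball 0 R" "(0::complex) ^ N = 0" using R N by (auto simp: power_0_left)
  have l: "coeff (Q p 0) d \<noteq> 0" using lc[OF p, of 0] R by simp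
  have ev: "poly (Q p (0 ^ N)) x = coeff (Q p (0 ^ N)) d * (\<Prod>i<d. (x - z i 0))" for x
    using z R0(1) unfolding puiseux_branches_def by blast
  have "Q p 0 = Polynomial.smult (coeff (Q p 0) d) (\<Prod>i<d. [:- z i 0, 1:])"
    unfolding poly_eq_poly_eq_iff[symmetric] using ev unfolding R0(2) by (simp add: fun_eq_iff poly_prod)
  then have "order a (Q p 0) = order a (Polynomial.smult (coeff (Q p 0) d) (\<Prod>i<d. [:- z i 0, 1:]))" by (rule arg_cong)
  also have "\<dots> = card {i\<in>{..<d}. z i 0 = a}" by (rule order_prod_linear[OF finite_lessThan l])
  finally show "order a (Q p 0) = card {i\<in>{..<d}. z i 0 = a}" .
  show "poly (Q p 0) a = 0 \<longleftrightarrow> (\<exists>i<d. a = z i 0)"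
    using ev[of a] l unfolding R0(2) by auto
qed

text \<open>Branches that meet over \<open>x0\<close> meet over \<open>p\<close>, and \<eta>
  separates the roots over \<open>x0\<close>; so the branches through corresponding roots carry the
  same indices. This preserves multiplicities and transfers the exponents \<open>K i\<close>. The
  growth clause compares bounds with equal \<open>n\<close>, which keeps the branches out of the
  statement.\<close>

theorem roots_persist:
  assumes \<eta>0: "\<eta>0 > 0"
  shows "\<exists>\<eta> e. 0 < \<eta> \<and> \<eta> \<le> \<eta>0 \<and> 0 < e \<and> e \<le> e0 \<and>
    (\<forall>a b. poly (Q x0 0) a = 0 \<longrightarrow> poly (Q x0 0) b = 0 \<longrightarrow> a \<noteq> b \<longrightarrow> 2 * \<eta> \<le> dist a b) \<and>
    (\<forall>p\<in>S. dist p x0 < e \<longrightarrow>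
      (\<forall>a. poly (Q x0 0) a = 0 \<longrightarrow> (\<exists>!y. poly (Q p 0) y = 0 \<and> dist y a < \<eta>)) \<and>
      (\<forall>y. poly (Q p 0) y = 0 \<longrightarrow> (\<exists>a. poly (Q x0 0) a = 0 \<and> dist y a < \<eta>)) \<and>
      (\<forall>a y. poly (Q x0 0) a = 0 \<longrightarrow> poly (Q p 0) y = 0 \<longrightarrow> dist y a < \<eta> \<longrightarrow>
         order y (Q p 0) = order a (Q x0 0) \<and>
         (\<forall>n \<gamma> c. (\<forall>g::real. \<exists>C. \<forall>\<^sub>F s in at_right 0. norm (poly (Q x0 (of_real s)) (a + of_real (g * s))) \<le> C * s ^ n) \<longrightarrow>
            (\<gamma> \<longlongrightarrow> c) (at_right (0::real)) \<longrightarrow>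
            (\<exists>C. \<forall>\<^sub>F s in at_right 0. norm (poly (Q p (of_real s)) (y + of_real s * \<gamma> s)) \<le> C * s ^ n))))"
proof -
  have x0e: "dist x0 x0 < e0" using e0 by simp
  obtain z where z: "puiseux_branches (Q x0) d N R z" using branches[OF x0 x0e] by blast
  note root0 = poly_at_0(2)[OF x0 x0e z]
  have "finite ((\<lambda>i. z i 0) ` {..<d})" by simp
  then obtain \<delta> where \<delta>: "\<delta> > 0" "\<And>a b. a \<in> (\<lambda>i. z i 0) ` {..<d} \<Longrightarrow> b \<in> (\<lambda>i. z i 0) ` {..<d} \<Longrightarrow> a \<noteq> b \<Longrightarrow> \<delta> \<le> dist a b"
    using finite_set_separated by metis
  define \<eta> where "\<eta> = min \<eta>0 (\<delta> / 2)"
  have \<eta>: "\<eta> > 0" "\<eta> \<le> \<eta>0" "2 * \<eta> \<le> \<delta>" using \<eta>0 \<delta>(1) by (auto simp: \<eta>_def)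
  have sep: "2 * \<eta> \<le> dist a b" if "poly (Q x0 0) a = 0" "poly (Q x0 0) b = 0" "a \<noteq> b" for a b
  proof -
    have "\<delta> \<le> dist a b" by (rule \<delta>(2)) (use that root0 in auto)
    then show ?thesis using \<eta>(3) by simp
  qed
  obtain e where e: "e > 0" "e \<le> e0" "\<And>p. p \<in> S \<Longrightarrow> dist p x0 < e \<Longrightarrow> \<exists>z'. puiseux_branches (Q p) d N R z' \<and>
     (\<forall>i<d. dist (z' i 0) (z i 0) < \<eta>) \<and> (\<forall>i<d. \<forall>j<d. z i 0 = z j 0 \<longrightarrow> z' i 0 = z' j 0) \<and>
     (\<forall>i<d. \<forall>k\<le>N. vanishes_to k (\<lambda>\<sigma>. z i \<sigma> - z i 0) R \<longrightarrow> vanishes_to k (\<lambda>\<sigma>. z' i \<sigma> - z' i 0) R)"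
    using branches_persist[OF z \<eta>(1)] by blast
  have isc: "isCont (\<lambda>s. coeff (Q p s) d) 0" for p
  proof -
    have "continuous_on UNIV (\<lambda>s::complex. (p, s))" by (intro continuous_intros)
    from continuous_on_compose2[OF cont[of d] this] have "continuous_on UNIV (\<lambda>s. coeff (Q p s) d)" by simp
    then show ?thesis by (simp add: continuous_on_eq_continuous_at)
  qed
  have main: "(\<forall>a. poly (Q x0 0) a = 0 \<longrightarrow> (\<exists>!y. poly (Q p 0) y = 0 \<and> dist y a < \<eta>)) \<and>
      (\<forall>y. poly (Q p 0) y = 0 \<longrightarrow> (\<exists>a. poly (Q x0 0) a = 0 \<and> dist y a < \<eta>)) \<and>
      (\<forall>a y. poly (Q x0 0) a = 0 \<longrightarrow> poly (Q p 0) y = 0 \<longrightarrow> dist y a < \<eta> \<longrightarrow>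
         order y (Q p 0) = order a (Q x0 0) \<and>
         (\<forall>n \<gamma> c. (\<forall>g::real. \<exists>C. \<forall>\<^sub>F s in at_right 0. norm (poly (Q x0 (of_real s)) (a + of_real (g * s))) \<le> C * s ^ n) \<longrightarrow>
            (\<gamma> \<longlongrightarrow> c) (at_right (0::real)) \<longrightarrow>
            (\<exists>C. \<forall>\<^sub>F s in at_right 0. norm (poly (Q p (of_real s)) (y + of_real s * \<gamma> s)) \<le> C * s ^ n)))"
    if p: "p \<in> S" "dist p x0 < e" for p
  proof -
    obtain z' where z': "puiseux_branches (Q p) d N R z'"
      and near: "\<And>i. i < d \<Longrightarrow> dist (z' i 0) (z i 0) < \<eta>"
      and same: "\<And>i j. i < d \<Longrightarrow> j < d \<Longrightarrow> z i 0 = z j 0 \<Longrightarrow> z' i 0 = z' j 0"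
      and van: "\<And>i k. i < d \<Longrightarrow> k \<le> N \<Longrightarrow> vanishes_to k (\<lambda>\<sigma>. z i \<sigma> - z i 0) R \<Longrightarrow> vanishes_to k (\<lambda>\<sigma>. z' i \<sigma> - z' i 0) R"
      using e(3)[OF p] by blast
    have pe: "dist p x0 < e0" using p(2) e(2) by simp
    note rootp = poly_at_0(2)[OF p(1) pe z']
    have idx: "z i 0 = a" if a: "poly (Q x0 0) a = 0" and i: "i < d" and d: "dist (z' i 0) a < \<eta>" for a i
    proof (rule ccontr)
      assume ne: "z i 0 \<noteq> a"
      have "poly (Q x0 0) (z i 0) = 0" using root0 i by blast
      from sep[OF this a ne] have "2 * \<eta> \<le> dist (z i 0) a" .
      also have "\<dots> \<le> dist (z' i 0) (z i 0) + dist (z' i 0) a" by (metis dist_commute dist_triangle)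
      also have "\<dots> < 2 * \<eta>" using near[OF i] d by simp
      finally show False by simp
    qed
    have idx': "dist (z' i 0) (z j 0) < \<eta>" if "i < d" "j < d" "z i 0 = z j 0" for i j
      using near[OF that(1)] that(3) by simp
    have eq: "z' i 0 = y" if a: "poly (Q x0 0) a = 0" and y: "poly (Q p 0) y = 0" "dist y a < \<eta>" and i: "i < d" "z i 0 = a" for a y i
    proof -
      obtain j where j: "j < d" "y = z' j 0" using rootp y(1) by blast
      have "z j 0 = a" using idx[OF a j(1)] y(2) j(2) by simp
      then show ?thesis using same[OF i(1) j(1)] i(2) j(2) by simp
    qed
    have A: "\<exists>!y. poly (Q p 0) y = 0 \<and> dist y a < \<eta>" if a: "poly (Q x0 0) a = 0" for a
    proof -
      obtain i where i: "i < d" "a = z i 0" using root0 a by blast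
      have "poly (Q p 0) (z' i 0) = 0 \<and> dist (z' i 0) a < \<eta>" using rootp i near by blast
      moreover have "y = z' i 0" if "poly (Q p 0) y = 0 \<and> dist y a < \<eta>" for y
        using eq[OF a conjunct1[OF that] conjunct2[OF that] i(1) i(2)[symmetric]] by (rule sym)
      ultimately show ?thesis by blast
    qed
    have B: "\<exists>a. poly (Q x0 0) a = 0 \<and> dist y a < \<eta>" if y: "poly (Q p 0) y = 0" for y
    proof -
      obtain j where j: "j < d" "y = z' j 0" using rootp y by blast
      moreover have "poly (Q x0 0) (z j 0) = 0" using root0 j(1) by auto
      ultimately show ?thesis using near[OF j(1)] by auto
    qed
    have O: "order y (Q p 0) = order a (Q x0 0)" if ay: "poly (Q x0 0) a = 0" "poly (Q p 0) y = 0" "dist y a < \<eta>" for a y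
    proof -
      have "z' i 0 = y \<longleftrightarrow> z i 0 = a" if i: "i < d" for i
      proof
        show "z i 0 = a" if "z' i 0 = y" using idx[OF ay(1) i] that ay(3) by simp
        show "z' i 0 = y" if "z i 0 = a" by (rule eq[OF ay i that])
      qed
      then have "{i \<in> {..<d}. z' i 0 = y} = {i \<in> {..<d}. z i 0 = a}" by blast
      then show ?thesis unfolding poly_at_0(1)[OF p(1) pe z'] poly_at_0(1)[OF x0 x0e z] by simp
    qed
    have G: "\<exists>C. \<forall>\<^sub>F s in at_right 0. norm (poly (Q p (of_real s)) (y + of_real s * \<gamma> s)) \<le> C * s ^ n"
      if ay: "poly (Q x0 0) a = 0" "poly (Q p 0) y = 0" "dist y a < \<eta>"
        and b: "\<forall>g::real. \<exists>C. \<forall>\<^sub>F s in at_right 0. norm (poly (Q x0 (of_real s)) (a + of_real (g * s))) \<le> C * s ^ n"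
        and \<gamma>: "(\<gamma> \<longlongrightarrow> c) (at_right (0::real))" for a y n \<gamma> c
    proof -
      have lc0: "coeff (Q x0 (\<sigma> ^ N)) d \<noteq> 0" if "\<sigma> \<in> ball 0 R" for \<sigma> using lc[OF x0 x0e powN[OF that]] .
      have "\<exists>K. (\<forall>i<d. K i \<le> N \<and> vanishes_to (K i) (\<lambda>\<sigma>. z i \<sigma> - z i 0) R \<and> (z i 0 \<noteq> a \<longrightarrow> K i = 0)) \<and> N * n \<le> (\<Sum>i<d. K i)"
        by (rule growth_exponents[OF z R N _ isc]) (use lc0 b in auto)
      then obtain K where Kn: "(\<forall>i<d. K i \<le> N \<and> vanishes_to (K i) (\<lambda>\<sigma>. z i \<sigma> - z i 0) R \<and> (z i 0 \<noteq> a \<longrightarrow> K i = 0)) \<and> N * n \<le> (\<Sum>i<d. K i)"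
        by (rule exE)
      have K: "K i \<le> N \<and> vanishes_to (K i) (\<lambda>\<sigma>. z i \<sigma> - z i 0) R \<and> (z i 0 \<noteq> a \<longrightarrow> K i = 0)" if "i < d" for i
        using Kn that by simp
      have n: "N * n \<le> (\<Sum>i<d. K i)" using Kn by simp
      have K': "K i \<le> N \<and> vanishes_to (K i) (\<lambda>\<sigma>. z' i \<sigma> - z' i 0) R \<and> (z' i 0 \<noteq> y \<longrightarrow> K i = 0)" if i: "i < d" for i
      proof (intro conjI impI)
        show Ki: "K i \<le> N" using K[OF i] by simp
        show "vanishes_to (K i) (\<lambda>\<sigma>. z' i \<sigma> - z' i 0) R" by (rule van[OF i Ki]) (use K[OF i] in simp)
        assume "z' i 0 \<noteq> y"
        then have "z i 0 \<noteq> a" using eq[OF ay i] by auto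
        then show "K i = 0" using K[OF i] by simp
      qed
      show ?thesis by (rule growth_bound[OF z' R N isc K' n \<gamma>])
    qed
    show ?thesis
    proof (intro conjI allI impI)
      show "\<exists>!y. poly (Q p 0) y = 0 \<and> dist y a < \<eta>" if "poly (Q x0 0) a = 0" for a by (rule A[OF that])
      show "\<exists>a. poly (Q x0 0) a = 0 \<and> dist y a < \<eta>" if "poly (Q p 0) y = 0" for y by (rule B[OF that])
      show "order y (Q p 0) = order a (Q x0 0)" if "poly (Q x0 0) a = 0" "poly (Q p 0) y = 0" "dist y a < \<eta>" for a y
        by (rule O[OF that])
      show "\<exists>C. \<forall>\<^sub>F s in at_right 0. norm (poly (Q p (of_real s)) (y + of_real s * \<gamma> s)) \<le> C * s ^ n"
        if "poly (Q x0 0) a = 0" "poly (Q p 0) y = 0" "dist y a < \<eta>"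
          "\<forall>g::real. \<exists>C. \<forall>\<^sub>F s in at_right 0. norm (poly (Q x0 (of_real s)) (a + of_real (g * s))) \<le> C * s ^ n"
          "(\<gamma> \<longlongrightarrow> c) (at_right (0::real))" for a y n \<gamma> c
        by (rule G[OF that])
    qed
  qed
  show ?thesis
  proof (rule exI[of _ \<eta>], rule exI[of _ e], intro conjI)
    show "\<forall>a b. poly (Q x0 0) a = 0 \<longrightarrow> poly (Q x0 0) b = 0 \<longrightarrow> a \<noteq> b \<longrightarrow> 2 * \<eta> \<le> dist a b"
      by (intro allI impI sep)
  qed (rule \<eta>(1) \<eta>(2) e(1) e(2) | (intro ballI impI, rule main))+
qed

end

section \<open>Affine charts of the projective line\<close>

lemma degree_chart_term: "degree ([:0, 1:] ^ k * [:1, c:] ^ (d - k) :: 'a::comm_ring_1 poly) \<le> k + (d - k)"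
proof -
  have "degree ([:0, 1:] ^ k * [:1, c:] ^ (d - k)) \<le> degree ([:0, 1::'a:] ^ k) + degree ([:1, c:] ^ (d - k))"
    by (rule degree_mult_le)
  also have "\<dots> \<le> degree [:0, 1::'a:] * k + degree [:1, c:] * (d - k)"
    by (intro add_mono degree_power_le)
  also have "\<dots> \<le> 1 * k + 1 * (d - k)" by (intro add_mono mult_right_mono) auto
  finally show ?thesis by simp
qed

lemma coeff_chart_poly: "coeff (chart_poly d c C) j = (\<Sum>k\<le>d. C k * coeff ([:0, 1:] ^ k * [:1, c:] ^ (d - k)) j)"
  unfolding chart_poly_def coeff_sum mult.assoc by (intro sum.cong) simp_all

lemma degree_chart_poly: "degree (chart_poly d c C) \<le> d"
proof (rule degree_le, intro allI impI)
  fix j assume j: "d < j"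
  have "coeff ([:0, 1:] ^ k * [:1, c:] ^ (d - k)) j = 0" if "k \<le> d" for k
    by (rule coeff_eq_0) (use degree_chart_term[of k c d] that j in linarith)
  then show "coeff (chart_poly d c C) j = 0" unfolding coeff_chart_poly by (intro sum.neutral) auto
qed

lemma coeff_linear_power_top: "coeff ([:1, c:] ^ n) n = (c::'a::comm_ring_1) ^ n"
proof (induction n)
  case (Suc n)
  have "degree ([:1, c:] ^ n) \<le> n" using degree_chart_term[of 0 c n] by simp
  then have "coeff ([:1, c:] ^ n) (Suc n) = 0" by (intro coeff_eq_0) simp
  then show ?case using Suc by simp
qed simp

lemma coeff_X_power_mult: "coeff ([:0, 1:] ^ k * p) (k + n) = coeff (p :: 'a::comm_ring_1 poly) n"
  by (induction k) (simp_all add: mult.assoc)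

text \<open>The leading coefficient is the value of the form at \<open>(1 : c)\<close>, the one
  point that the chart omits. Full degree therefore means that no root lies outside the
  chart.\<close>

lemma coeff_chart_poly_top: "coeff (chart_poly d c C) d = (\<Sum>k\<le>d. C k * c ^ (d - k))"
  unfolding coeff_chart_poly
proof (rule sum.cong[OF refl])
  fix k assume "k \<in> {..d}"
  then have "coeff ([:0, 1:] ^ k * [:1, c:] ^ (d - k)) d = c ^ (d - k)"
    using coeff_X_power_mult[of k "[:1, c:] ^ (d - k)" "d - k"] by (simp add: coeff_linear_power_top)
  then show "C k * coeff ([:0, 1:] ^ k * [:1, c:] ^ (d - k)) d = C k * c ^ (d - k)" by simp
qed

lemma map_poly_chart_poly:
  "map_poly complex_of_real (chart_poly d c C) = chart_poly d (of_real c) (\<lambda>k. of_real (C k))"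
  unfolding chart_poly_def of_real_poly.hom_sum of_real_poly.hom_mult of_real_poly.hom_power
  by (simp add: of_real_hom.map_poly_pCons_hom)

lemma poly_of_real_cnj: "poly (map_poly complex_of_real q) (cnj z) = cnj (poly (map_poly complex_of_real q) z)"
  by (induction q) (simp_all add: of_real_hom.map_poly_pCons_hom)

lemma poly_of_real_of_real: "poly (map_poly complex_of_real q) (of_real x) = of_real (poly q x)"
  by (induction q) (simp_all add: of_real_hom.map_poly_pCons_hom)

interpretation of_real_div_poly: map_poly_inj_idom_divide_hom complex_of_real ..

lemma order_of_real: "order (of_real x) (map_poly complex_of_real q) = order x q"
  by (rule of_real_div_poly.order_hom)

lemma continuous_on_taylor_form:
  fixes g h :: "'x::topological_space \<Rightarrow> 'n::finite \<Rightarrow> real"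
  assumes "\<And>i. continuous_on A (\<lambda>x. g x i)" "\<And>i. continuous_on A (\<lambda>x. h x i)"
  shows "continuous_on A (\<lambda>x. taylor_form k f (g x) (h x))"
  using assms
  by (induction k arbitrary: f)
    (auto simp: taylor_form_0 taylor_form_Suc' intro!: continuous_intros continuous_on_mp_eval)

lemma nonzero_near:
  fixes f :: "'p::metric_space \<times> complex \<Rightarrow> complex"
  assumes "continuous_on UNIV f" "f (x0, 0) \<noteq> 0"
  obtains e where "e > 0" "\<And>p s. dist p x0 < e \<Longrightarrow> norm s < e \<Longrightarrow> f (p, s) \<noteq> 0"
proof -
  have "isCont f (x0, 0)" using assms(1) by (simp add: continuous_on_eq_continuous_at)
  from continuous_at_avoid[OF this assms(2)] obtain e where e: "e > 0" "\<And>y. dist (x0, 0) y < e \<Longrightarrow> f y \<noteq> 0"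
    by blast
  show ?thesis
  proof (rule that[of "e / 2"])
    show "e / 2 > 0" using e by simp
    fix p s assume "dist p x0 < e / 2" "norm (s::complex) < e / 2"
    moreover have "dist (x0, 0) (p, s) \<le> dist x0 p + dist 0 s"
      unfolding dist_Pair_Pair by (rule sqrt_sum_squares_le_sum) auto
    ultimately have "dist (x0, 0) (p, s) < e" by (simp add: dist_commute)
    then show "f (p, s) \<noteq> 0" by (rule e(2))
  qed
qed

locale disc_invariant =
  fixes S :: "(real^'n) set" and P :: "'n mpoly poly"
  assumes nonnull: "never_nullifies P S" and disc: "disc_xn (degree P) P \<noteq> 0"
    and inv: "mp_order_invariant (disc_xn (degree P) P) ((\<lambda>x. ($) x) ` S)"
begin

text \<open>The value of the homogenisation. \<open>hom_poly\<close>, \<open>binform\<close> and the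
  chart polynomials are related to each other through it.\<close>

definition hv :: "('n \<Rightarrow> real) \<Rightarrow> real \<Rightarrow> real \<Rightarrow> real" where
  "hv a u v = (\<Sum>k\<le>degree P. mp_eval a (coeff P k) * u ^ k * v ^ (degree P - k))"

definition chart :: "real \<Rightarrow> real^'n \<Rightarrow> real poly" where
  "chart c p = chart_poly (degree P) c (\<lambda>k. mp_eval (($) p) (coeff P k))"

text \<open>\<open>q\<close> is a pair of a point and a direction; the fibre is taken over the
  complex point at parameter \<open>s\<close> on the line it determines.\<close>

definition cchart :: "real \<Rightarrow> (real^'n) \<times> (real^'n) \<Rightarrow> complex \<Rightarrow> complex poly" where
  "cchart c q s = chart_poly (degree P) (of_real c)
     (\<lambda>k. mp_eval_hom complex_of_real (\<lambda>i. of_real (fst q $ i) + s * of_real (snd q $ i)) (coeff P k))"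

lemma hv_scale: "hv a (t * u) (t * v) = t ^ degree P * hv a u v"
  unfolding hv_def sum_distrib_left
proof (rule sum.cong[OF refl])
  fix k assume "k \<in> {..degree P}"
  then have "t ^ degree P = t ^ k * t ^ (degree P - k)" by (simp add: power_add[symmetric])
  then show "mp_eval a (coeff P k) * (t * u) ^ k * (t * v) ^ (degree P - k) =
    t ^ degree P * (mp_eval a (coeff P k) * u ^ k * v ^ (degree P - k))"
    by (simp add: power_mult_distrib)
qed

lemma mp_eval_hom_poly:
  "mp_eval (case_sum a (\<lambda>b. if b then v else u)) (hom_poly (degree P) P) = hv a u v"
  unfolding hom_poly_def hv_def by (simp add: mp_eval_simps)

lemma mp_eval_hpt: "mp_eval (hpt x u v) (hom_poly (degree P) P) = hv (($) x) u v"
  unfolding hpt_def by (rule mp_eval_hom_poly)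

lemma poly_chart: "poly (chart c p) z = hv (($) p) z (1 + c * z)"
  unfolding chart_def poly_chart_poly hv_def ..

lemma poly_cchart:
  "poly (cchart c q (of_real s)) (of_real z) = of_real (hv (\<lambda>i. fst q $ i + s * snd q $ i) z (1 + c * z))"
proof -
  have "mp_eval_hom complex_of_real (\<lambda>i. of_real (fst q $ i) + of_real s * of_real (snd q $ i)) f =
      of_real (mp_eval (\<lambda>i. fst q $ i + s * snd q $ i) f)" for f :: "'n mpoly"
    using mp_eval_of_real[of "\<lambda>i. fst q $ i + s * snd q $ i" f] by simp
  then show ?thesis unfolding cchart_def poly_chart_poly hv_def by simp
qed

lemma cchart_0: "cchart c q 0 = map_poly complex_of_real (chart c (fst q))"
proof -
  have "mp_eval_hom complex_of_real (\<lambda>i. of_real (fst q $ i) + 0 * of_real (snd q $ i)) f =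
      of_real (mp_eval (($) (fst q)) f)" for f :: "'n mpoly"
    using mp_eval_of_real[of "($) (fst q)" f] by simp
  then show ?thesis unfolding cchart_def chart_def map_poly_chart_poly by simp
qed

lemma continuous_coeff_cchart: "continuous_on UNIV (\<lambda>(q, s). coeff (cchart c q s) k)"
  unfolding cchart_def coeff_chart_poly case_prod_unfold
  by (intro continuous_intros continuous_on_mp_eval_complex)

lemma holomorphic_coeff_cchart: "(\<lambda>s. coeff (cchart c q s) k) holomorphic_on A"
  unfolding cchart_def coeff_chart_poly mp_eval_hom_def by (intro holomorphic_intros)

lemma coeff_chart_top: "coeff (chart c p) (degree P) = hv (($) p) 1 c"
  unfolding chart_def coeff_chart_poly_top hv_def by simp

text \<open>A nonzero form has finitely many roots, so some point \<open>(1 : c)\<close> is not a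
  root and can serve as infinity.\<close>

lemma ex_good_chart:
  assumes "x \<in> S"
  shows "\<exists>c. hv (($) x) 1 c \<noteq> 0"
proof -
  have "eval_x x P \<noteq> 0" using nonnull assms unfolding never_nullifies_def by blast
  then obtain k where "coeff (eval_x x P) k \<noteq> 0" by (metis leading_coeff_0_iff)
  then have k: "mp_eval (($) x) (coeff P k) \<noteq> 0"
    unfolding eval_x_def by (subst (asm) coeff_map_poly) (simp_all add: mp_eval_simps)
  then have kd: "k \<le> degree P" by (metis coeff_eq_0 not_le rid.eval_zero mp_eval_hom_id)
  define g where "g = (\<Sum>j\<le>degree P. monom (mp_eval (($) x) (coeff P j)) (degree P - j))"
  have "coeff g (degree P - k) = (\<Sum>j\<le>degree P. if j = k then mp_eval (($) x) (coeff P j) else 0)"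
    unfolding g_def coeff_sum by (intro sum.cong) (use kd in auto)
  also have "\<dots> = mp_eval (($) x) (coeff P k)" using kd by simp
  finally have "g \<noteq> 0" using k by auto
  then have "finite {c. poly g c = 0}" by (rule poly_roots_finite)
  then obtain c where "c \<notin> {c. poly g c = 0}" using ex_new_if_finite infinite_UNIV_char_0 by blast
  moreover have "poly g c = hv (($) x) 1 c" unfolding g_def hv_def by (simp add: poly_sum poly_monom)
  ultimately show ?thesis by auto
qed

lemma hom_poly_nonzero:
  assumes "x \<in> S"
  shows "hom_poly (degree P) P \<noteq> 0"
proof
  assume "hom_poly (degree P) P = 0"
  then have "hv (($) x) 1 c = 0" for c using mp_eval_hpt[of x 1 c] by (simp add: mp_eval_simps)
  then show False using ex_good_chart[OF assms] by blast
qed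

text \<open>\<open>w\<close> is a direction in which the lowest Taylor form of the discriminant at
  \<open>x0\<close> is nonzero. Its nonvanishing, like that of the leading coefficient, is an open
  condition on point, direction and \<open>s\<close> together, so the family covers all directions
  near \<open>w\<close>.\<close>

lemma puiseux_family_exists:
  assumes x0: "x0 \<in> S" and c: "hv (($) x0) 1 c \<noteq> 0"
  shows "\<exists>w N R e0. puiseux_family (cchart c) (S \<times> UNIV) (x0, w) (degree P) N R e0"
proof -
  let ?d = "degree P"
  let ?D = "disc_xn ?d P"
  define \<mu> where "\<mu> = mp_ord ?D (($) x0)"
  have ord: "mp_ord ?D (($) p) = \<mu>" if "p \<in> S" for p
    using inv x0 that unfolding mp_order_invariant_def \<mu>_def by blast
  obtain w' where w': "taylor_form \<mu> ?D (($) x0) w' \<noteq> 0"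
    using ex_taylor_form_mp_ord_nonzero[OF disc coord_open_UNIV, of "($) x0"] unfolding \<mu>_def by auto
  define w :: "real^'n" where "w = (\<chi> i. w' i)"
  have w: "taylor_form \<mu> ?D (($) x0) (($) w) \<noteq> 0"
  proof -
    have "($) w = w'" by (rule ext) (simp add: w_def)
    then show ?thesis using w' by simp
  qed
  obtain M where M: "\<And>a v. degree (line_poly a v ?D) \<le> M" using degree_line_poly_bound by blast
  \<comment> \<open>The discriminant on the line divided by the power of \<open>s\<close> that it
    contains, written as a polynomial so that continuity, also at \<open>s = 0\<close>, is
    evident.\<close>
  define E where "E = (\<lambda>(q :: (real^'n) \<times> (real^'n), s :: complex).
    \<Sum>k\<in>{\<mu>..M}. of_real (taylor_form k ?D (($) (fst q)) (($) (snd q))) * s ^ (k - \<mu>))"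
  have DE: "mp_eval_hom complex_of_real (\<lambda>i. of_real (p $ i) + s * of_real (v $ i)) ?D = s ^ \<mu> * E ((p, v), s)"
    if p: "p \<in> S" for p v s
  proof -
    let ?q = "line_poly (($) p) (($) v) ?D"
    have T0: "coeff ?q k = 0" if "k < \<mu>" for k
      using taylor_form_below_mp_ord[of k ?D "($) p" "($) v"] ord[OF p] that by (simp add: taylor_form_def)
    have "mp_eval_hom complex_of_real (\<lambda>i. of_real (p $ i) + s * of_real (v $ i)) ?D = poly (map_poly complex_of_real ?q) s"
      by (rule poly_of_real_line_poly[symmetric])
    also have "\<dots> = (\<Sum>k\<le>M. coeff (map_poly complex_of_real ?q) k * s ^ k)"
      by (rule poly_as_sum_of_monoms'[THEN arg_cong[of _ _ "\<lambda>p. poly p s"], symmetric, THEN trans])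
        (use M[of "($) p" "($) v"] in \<open>simp_all add: poly_sum poly_monom\<close>)
    also have "\<dots> = (\<Sum>k\<le>M. of_real (coeff ?q k) * s ^ k)" by simp
    also have "\<dots> = (\<Sum>k\<in>{\<mu>..M}. of_real (coeff ?q k) * s ^ k)"
      by (rule sum.mono_neutral_right) (use T0 in auto)
    also have "\<dots> = (\<Sum>k\<in>{\<mu>..M}. s ^ \<mu> * (of_real (coeff ?q k) * s ^ (k - \<mu>)))"
    proof (rule sum.cong[OF refl])
      fix k assume "k \<in> {\<mu>..M}"
      then have "s ^ k = s ^ \<mu> * s ^ (k - \<mu>)" by (simp add: power_add[symmetric])
      then show "of_real (coeff ?q k) * s ^ k = s ^ \<mu> * (of_real (coeff ?q k) * s ^ (k - \<mu>))" by simp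
    qed
    finally show ?thesis unfolding E_def by (simp add: sum_distrib_left taylor_form_def)
  qed
  have \<mu>M: "\<mu> \<le> M"
  proof (rule ccontr)
    assume "\<not> \<mu> \<le> M"
    then have "degree (line_poly (($) x0) (($) w) ?D) < \<mu>" using M[of "($) x0" "($) w"] by simp
    then have "coeff (line_poly (($) x0) (($) w) ?D) \<mu> = 0" by (rule coeff_eq_0)
    then show False using w by (simp add: taylor_form_def)
  qed
  have contE: "continuous_on UNIV E"
    unfolding E_def case_prod_unfold by (intro continuous_intros continuous_on_taylor_form)
  have "E ((x0, w), 0) = (\<Sum>k\<in>{\<mu>..M}. if k = \<mu> then of_real (taylor_form \<mu> ?D (($) x0) (($) w)) else 0)"
    unfolding E_def prod.case fst_conv snd_conv by (intro sum.cong) (auto simp: power_0_left)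
  then have E0: "E ((x0, w), 0) \<noteq> 0" using w \<mu>M by simp
  obtain e1 where e1: "e1 > 0" "\<And>q s. dist q (x0, w) < e1 \<Longrightarrow> norm s < e1 \<Longrightarrow> E (q, s) \<noteq> 0"
    using nonzero_near[OF contE E0] by blast
  let ?l = "\<lambda>(q, s). coeff (cchart c q s) ?d"
  have "coeff (cchart c (x0, w) 0) ?d = of_real (hv (($) x0) 1 c)"
    unfolding cchart_0 by (simp add: coeff_chart_top)
  then have l0: "?l ((x0, w), 0) \<noteq> 0" using c by simp
  obtain e2 where e2: "e2 > 0" "\<And>q s. dist q (x0, w) < e2 \<Longrightarrow> norm s < e2 \<Longrightarrow> ?l (q, s) \<noteq> 0"
    using nonzero_near[OF continuous_coeff_cchart l0] by blast
  define e0 where "e0 = min e1 e2"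
  define N :: nat where "N = fact ?d"
  \<comment> \<open>\<open>R <= 1\<close> gives \<open>R ^ N <= R <= e0\<close>, so
    \<open>s = \<sigma> ^ N\<close> stays in the disc where degree and simplicity are known.\<close>
  define R where "R = min 1 e0"
  have e0: "e0 > 0" using e1 e2 by (simp add: e0_def)
  have R: "R > 0" "R \<le> 1" "R \<le> e0" using e0 by (auto simp: R_def)
  have N0: "N > 0" by (simp add: N_def)
  have RN: "R ^ N \<le> e0"
    using power_decreasing[of 1 N R] R N0 by simp
  have lc: "coeff (cchart c q s) ?d \<noteq> 0" if "dist q (x0, w) < e0" "s \<in> ball 0 e0" for q s
    using e2(2)[of q s] that by (simp add: e0_def)
  have deg: "degree (cchart c q s) = ?d" if "dist q (x0, w) < e0" "s \<in> ball 0 e0" for q s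
    by (rule antisym[OF _ le_degree[OF lc[OF that]]]) (unfold cchart_def, rule degree_chart_poly)
  have "puiseux_family (cchart c) (S \<times> UNIV) (x0, w) ?d N R e0"
  proof (unfold_locales)
    show "continuous_on UNIV (\<lambda>(q, s). coeff (cchart c q s) k)" for k by (rule continuous_coeff_cchart)
    show "(x0, w) \<in> S \<times> UNIV" using x0 by simp
    show "0 < R" "0 < e0" "0 < N" using R e0 N0 by auto
    fix q assume q: "q \<in> S \<times> (UNIV :: (real^'n) set)" "dist q (x0, w) < e0"
    show "degree (cchart c q s) = ?d" if "s \<in> ball 0 (R ^ N)" for s
      by (rule deg[OF q(2)]) (use that RN in auto)
    show "coeff (cchart c q s) ?d \<noteq> 0" if "s \<in> ball 0 (R ^ N)" for s
      by (rule lc[OF q(2)]) (use that RN in auto)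
    show "\<exists>z. puiseux_branches (cchart c q) ?d N R z"
    proof (rule puiseux_branches_exist[OF e0 holomorphic_coeff_cchart deg[OF q(2)] lc[OF q(2)] _ N_def R(1) RN])
      fix s assume s: "s \<in> ball 0 e0 - {0 :: complex}"
      have sb: "s \<in> ball 0 e0" using s by simp
      have "E (q, s) \<noteq> 0" using e1(2)[of q s] q(2) sb by (simp add: e0_def)
      moreover have "fst q \<in> S" using q(1) by (simp add: mem_Times_iff)
      ultimately have D: "mp_eval_hom complex_of_real (\<lambda>i. of_real (fst q $ i) + s * of_real (snd q $ i)) ?D \<noteq> 0"
        using DE[of "fst q" s "snd q"] s by simp
      show "rsquarefree (cchart c q s)"
        unfolding cchart_def
        by (rule chart_poly_rsquarefree[OF refl _ degree_chart_poly D])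
          (use lc[OF q(2) sb] in \<open>simp add: cchart_def\<close>)
    qed
  qed
  then show ?thesis by blast
qed

end

section \<open>Order of the homogenisation and growth along curves in a chart\<close>

context disc_invariant
begin

abbreviation "H \<equiv> hom_poly (degree P) P"

lemma line_hpt:
  "mp_eval (\<lambda>i. hpt x u v i + s * \<epsilon> i) H =
     hv (\<lambda>i. x $ i + s * \<epsilon> (Inl i)) (u + s * \<epsilon> (Inr False)) (v + s * \<epsilon> (Inr True))"
proof -
  have "(\<lambda>i. hpt x u v i + s * \<epsilon> i) =
    case_sum (\<lambda>i. x $ i + s * \<epsilon> (Inl i)) (\<lambda>b. if b then v + s * \<epsilon> (Inr True) else u + s * \<epsilon> (Inr False))"
    by (rule ext) (auto simp: hpt_def split: sum.split)
  then show ?thesis by (simp only: mp_eval_hom_poly)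
qed

text \<open>Below the order of \<open>H\<close> all Taylor forms vanish, which bounds
  \<open>H\<close> on every line through the representative; the lines that stay straight in the
  chart give the bounds that \<open>roots_persist\<close> takes as input.\<close>

lemma growth_from_order:
  assumes t: "t \<noteq> 0" and n: "n = mp_ord H (hpt x0 (t * r) (t * (1 + c * r)))"
  shows "\<exists>C. \<forall>\<^sub>F s in at_right 0. norm (poly (cchart c (x0, w) (of_real s)) (of_real r + of_real (g * s))) \<le> C * s ^ n"
proof -
  let ?a = "hpt x0 (t * r) (t * (1 + c * r))"
  \<comment> \<open>In this direction \<open>v - c * u\<close> keeps the value \<open>t\<close>, so
    in the chart the line is \<open>z = r + g * s\<close>.\<close>
  define \<epsilon> where "\<epsilon> = case_sum (($) w) (\<lambda>b. if b then t * c * g else t * g)"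
  have line: "poly (line_poly ?a \<epsilon> H) s = t ^ degree P * hv (\<lambda>i. x0 $ i + s * w $ i) (r + g * s) (1 + c * (r + g * s))" for s
  proof -
    have "poly (line_poly ?a \<epsilon> H) s = hv (\<lambda>i. x0 $ i + s * w $ i) (t * r + s * (t * g)) (t * (1 + c * r) + s * (t * c * g))"
      unfolding poly_line_poly line_hpt by (simp add: \<epsilon>_def)
    also have "\<dots> = hv (\<lambda>i. x0 $ i + s * w $ i) (t * (r + g * s)) (t * (1 + c * (r + g * s)))"
      by (simp add: algebra_simps)
    finally show ?thesis by (simp only: hv_scale)
  qed
  have "\<forall>k<n. coeff (line_poly ?a \<epsilon> H) k = 0"
    using taylor_form_below_mp_ord[of _ H ?a \<epsilon>] unfolding n taylor_form_def by blast
  then obtain C where C: "\<forall>\<^sub>F s in at_right 0. \<bar>poly (line_poly ?a \<epsilon> H) s\<bar> \<le> C * s ^ n"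
    unfolding poly_bound_at_right_iff[symmetric] by blast
  then have "\<forall>\<^sub>F s in at_right 0. norm (poly (cchart c (x0, w) (of_real s)) (of_real r + of_real (g * s))) \<le> C / \<bar>t\<bar> ^ degree P * s ^ n"
  proof eventually_elim
    case (elim s)
    have "poly (cchart c (x0, w) (of_real s)) (of_real r + of_real (g * s)) =
      of_real (hv (\<lambda>i. x0 $ i + s * w $ i) (r + g * s) (1 + c * (r + g * s)))"
      using poly_cchart[of c "(x0, w)" s "r + g * s"] by simp
    then have "norm (poly (cchart c (x0, w) (of_real s)) (of_real r + of_real (g * s))) =
      \<bar>hv (\<lambda>i. x0 $ i + s * w $ i) (r + g * s) (1 + c * (r + g * s))\<bar>" by (simp only: norm_of_real)
    moreover have "\<bar>t\<bar> ^ degree P * \<bar>hv (\<lambda>i. x0 $ i + s * w $ i) (r + g * s) (1 + c * (r + g * s))\<bar> \<le> C * s ^ n"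
      using elim unfolding line by (simp add: abs_mult power_abs)
    moreover have "\<bar>t\<bar> ^ degree P > 0" using t by simp
    ultimately show ?case by (simp add: field_simps)
  qed
  then show ?thesis by blast
qed

text \<open>Only the part of the direction along \<open>x\<close> is confined to a neighbourhood of
  \<open>w\<close>; its last two components are free. By \<open>mp_ord_geI\<close> such a set of
  directions suffices to bound an order from below.\<close>

lemma coord_open_directions: "coord_open {\<epsilon> :: 'n + bool \<Rightarrow> real. dist (\<chi> i. \<epsilon> (Inl i)) w < e}"
  unfolding coord_open_def
proof (intro ballI allI)
  fix \<epsilon> :: "'n + bool \<Rightarrow> real" and j
  assume "\<epsilon> \<in> {\<epsilon>. dist (\<chi> i. \<epsilon> (Inl i)) w < e}"
  then have \<epsilon>: "dist (\<chi> i. \<epsilon> (Inl i)) w < e" by simp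
  define f where "f t = dist (\<chi> i. (\<epsilon>(j := t)) (Inl i)) w" for t
  have "continuous_on UNIV (\<lambda>t. (\<epsilon>(j := t)) (Inl i))" for i
    by (cases "j = Inl i") (auto intro!: continuous_intros)
  then have "continuous_on UNIV f" unfolding f_def by (intro continuous_intros continuous_on_vec_lambda)
  moreover have f0: "f (\<epsilon> j) < e" using \<epsilon> by (simp add: f_def)
  ultimately obtain \<delta> where \<delta>: "\<delta> > 0" "\<And>t. dist t (\<epsilon> j) < \<delta> \<Longrightarrow> dist (f t) (f (\<epsilon> j)) < e - f (\<epsilon> j)"
    unfolding continuous_on_iff by (metis UNIV_I diff_gt_0_iff_gt)
  have "f t < e" if "\<bar>\<epsilon> j - t\<bar> < \<delta>" for t
  proof -
    have "dist t (\<epsilon> j) < \<delta>" using that by (simp add: dist_real_def abs_minus_commute)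
    then show ?thesis using \<delta>(2)[of t] by (simp add: dist_real_def abs_if split: if_splits)
  qed
  then show "\<exists>\<delta>>0. \<forall>t. \<bar>\<epsilon> j - t\<bar> < \<delta> \<longrightarrow> \<epsilon>(j := t) \<in> {\<epsilon>. dist (\<chi> i. \<epsilon> (Inl i)) w < e}"
    using \<delta>(1) unfolding f_def by auto
qed

text \<open>Every line through the representative whose direction is admissible becomes, after
  rescaling, a curve in the chart with converging slope. Rescaling changes \<open>H\<close> only by
  a bounded factor.\<close>

lemma order_from_growth:
  assumes Hne: "H \<noteq> 0" and t: "t \<noteq> 0" and e: "e > 0"
    and growth: "\<And>v \<gamma> l. dist v w < e \<Longrightarrow> (\<gamma> \<longlongrightarrow> l) (at_right (0::real)) \<Longrightarrow>
      \<exists>C. \<forall>\<^sub>F s in at_right 0. norm (poly (cchart c (p, v) (of_real s)) (of_real y + of_real s * \<gamma> s)) \<le> C * s ^ n"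
  shows "n \<le> mp_ord H (hpt p (t * y) (t * (1 + c * y)))"
proof (rule mp_ord_geI[OF Hne coord_open_directions[of w e]])
  have "case_sum (($) w) (\<lambda>_. 0) \<in> {\<epsilon> :: 'n + bool \<Rightarrow> real. dist (\<chi> i. \<epsilon> (Inl i)) w < e}" using e by simp
  then show "{\<epsilon> :: 'n + bool \<Rightarrow> real. dist (\<chi> i. \<epsilon> (Inl i)) w < e} \<noteq> {}" by blast
  fix k and \<epsilon> :: "'n + bool \<Rightarrow> real" assume k: "k < n" and "\<epsilon> \<in> {\<epsilon>. dist (\<chi> i. \<epsilon> (Inl i)) w < e}"
  then have \<epsilon>: "dist (\<chi> i. \<epsilon> (Inl i)) w < e" by simp
  let ?a = "hpt p (t * y) (t * (1 + c * y))"
  define v :: "real^'n" where "v = (\<chi> i. \<epsilon> (Inl i))"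
  define \<alpha> where "\<alpha> = \<epsilon> (Inr False)"
  define \<beta> where "\<beta> = \<epsilon> (Inr True)"
  \<comment> \<open>Along the line, \<open>v - c * u\<close> starts at \<open>t\<close> and grows at
    the rate \<kappa>. Dividing by its value \<open>t + s * \<kappa>\<close> brings the point back
    into the chart, at \<open>y + s * \<gamma> s\<close>.\<close>
  define \<kappa> where "\<kappa> = \<beta> - c * \<alpha>"
  define \<gamma> where "\<gamma> s = complex_of_real ((\<alpha> - y * \<kappa>) / (t + s * \<kappa>))" for s
  have "((\<lambda>s. (\<alpha> - y * \<kappa>) / (t + s * \<kappa>)) \<longlongrightarrow> (\<alpha> - y * \<kappa>) / (t + 0 * \<kappa>)) (at_right 0)"
    using t by (intro tendsto_intros) auto
  then have "(\<gamma> \<longlongrightarrow> of_real ((\<alpha> - y * \<kappa>) / (t + 0 * \<kappa>))) (at_right 0)"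
    unfolding \<gamma>_def by (rule tendsto_of_real)
  then obtain C where C: "\<forall>\<^sub>F s in at_right 0. norm (poly (cchart c (p, v) (of_real s)) (of_real y + of_real s * \<gamma> s)) \<le> C * s ^ n"
    using growth[of v \<gamma>] \<epsilon> unfolding v_def by blast
  have lim: "((\<lambda>s. t + s * \<kappa>) \<longlongrightarrow> t + 0 * \<kappa>) (at_right 0)" by (intro tendsto_intros)
  have ne: "\<forall>\<^sub>F s in at_right 0. t + s * \<kappa> \<noteq> 0" by (rule tendsto_imp_eventually_ne[OF lim]) (use t in simp)
  have bd: "\<forall>\<^sub>F s in at_right 0. \<bar>t + s * \<kappa>\<bar> < \<bar>t\<bar> + 1"
    by (rule order_tendstoD(2)[OF tendsto_rabs[OF lim]]) simp
  from C ne bd have "\<forall>\<^sub>F s in at_right 0. \<bar>poly (line_poly ?a \<epsilon> H) s\<bar> \<le> (\<bar>t\<bar> + 1) ^ degree P * C * s ^ n"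
  proof eventually_elim
    case (elim s)
    define \<tau> where "\<tau> = t + s * \<kappa>"
    define \<zeta> where "\<zeta> = y + s * ((\<alpha> - y * \<kappa>) / \<tau>)"
    have \<tau>: "\<tau> \<noteq> 0" "\<bar>\<tau>\<bar> < \<bar>t\<bar> + 1" using elim by (auto simp: \<tau>_def)
    have e1: "\<tau> * \<zeta> = t * y + s * \<alpha>" using \<tau>(1) by (simp add: \<zeta>_def \<tau>_def field_simps)
    have "\<tau> * (1 + c * \<zeta>) = \<tau> + c * (\<tau> * \<zeta>)" by (simp add: algebra_simps)
    also have "\<dots> = t * (1 + c * y) + s * \<beta>" unfolding e1 by (simp add: \<tau>_def \<kappa>_def algebra_simps)
    finally have e2: "\<tau> * (1 + c * \<zeta>) = t * (1 + c * y) + s * \<beta>" .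
    have "poly (line_poly ?a \<epsilon> H) s = hv (\<lambda>i. p $ i + s * v $ i) (\<tau> * \<zeta>) (\<tau> * (1 + c * \<zeta>))"
      unfolding poly_line_poly line_hpt e1 e2 by (simp add: v_def \<alpha>_def \<beta>_def)
    also have "\<dots> = \<tau> ^ degree P * hv (\<lambda>i. p $ i + s * v $ i) \<zeta> (1 + c * \<zeta>)" by (rule hv_scale)
    finally have "\<bar>poly (line_poly ?a \<epsilon> H) s\<bar> = \<bar>\<tau>\<bar> ^ degree P * \<bar>hv (\<lambda>i. p $ i + s * v $ i) \<zeta> (1 + c * \<zeta>)\<bar>"
      by (simp add: abs_mult power_abs)
    also have "\<dots> \<le> (\<bar>t\<bar> + 1) ^ degree P * (C * s ^ n)"
    proof (rule mult_mono)
      have "of_real y + of_real s * \<gamma> s = complex_of_real \<zeta>" by (simp add: \<gamma>_def \<zeta>_def \<tau>_def)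
      then have "poly (cchart c (p, v) (of_real s)) (of_real y + of_real s * \<gamma> s) = of_real (hv (\<lambda>i. p $ i + s * v $ i) \<zeta> (1 + c * \<zeta>))"
        using poly_cchart[of c "(p, v)" s \<zeta>] by simp
      then show "\<bar>hv (\<lambda>i. p $ i + s * v $ i) \<zeta> (1 + c * \<zeta>)\<bar> \<le> C * s ^ n"
        using elim(1) by (simp only: norm_of_real)
      show "\<bar>\<tau>\<bar> ^ degree P \<le> (\<bar>t\<bar> + 1) ^ degree P" using \<tau>(2) by (intro power_mono) auto
    qed auto
    finally show ?case by (simp only: mult.assoc)
  qed
  then have "\<forall>k<n. coeff (line_poly ?a \<epsilon> H) k = 0" unfolding poly_bound_at_right_iff[symmetric] by blast
  then show "taylor_form k H ?a \<epsilon> = 0" using k unfolding taylor_form_def by blast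
qed

text \<open>Passage from complex to real roots. The root near a real root is unique and its
  conjugate is equally near, so it is real. Conversely a real root cannot be near a nonreal root
  over \<open>x0\<close>, because \<eta> is at most the distance of those from the real
  axis.\<close>

lemma local_delineation:
  assumes x0: "x0 \<in> S" and c: "hv (($) x0) 1 c \<noteq> 0"
  shows "\<exists>\<eta> e. 0 < \<eta> \<and> 0 < e \<and>
    (\<forall>a b. poly (chart c x0) a = 0 \<longrightarrow> poly (chart c x0) b = 0 \<longrightarrow> a \<noteq> b \<longrightarrow> 2 * \<eta> \<le> dist a b) \<and>
    (\<forall>p\<in>S. dist p x0 < e \<longrightarrow> hv (($) p) 1 c \<noteq> 0 \<and>
      (\<forall>r. poly (chart c x0) r = 0 \<longrightarrow> (\<exists>!y. poly (chart c p) y = 0 \<and> dist y r < \<eta>)) \<and>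
      (\<forall>y. poly (chart c p) y = 0 \<longrightarrow> (\<exists>r. poly (chart c x0) r = 0 \<and> dist y r < \<eta>)) \<and>
      (\<forall>r y. poly (chart c x0) r = 0 \<longrightarrow> poly (chart c p) y = 0 \<longrightarrow> dist y r < \<eta> \<longrightarrow>
         order y (chart c p) = order r (chart c x0) \<and>
         (\<forall>t t'. t \<noteq> 0 \<longrightarrow> t' \<noteq> 0 \<longrightarrow>
            mp_ord H (hpt x0 (t * r) (t * (1 + c * r))) \<le> mp_ord H (hpt p (t' * y) (t' * (1 + c * y)))))) \<and>
    (\<forall>r. poly (chart c x0) r = 0 \<longrightarrow>
      continuous_on (S \<inter> ball x0 e) (\<lambda>p. THE y. poly (chart c p) y = 0 \<and> dist y r < \<eta>))"
proof -
  obtain w N R e0 where fam: "puiseux_family (cchart c) (S \<times> UNIV) (x0, w) (degree P) N R e0"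
    using puiseux_family_exists[OF x0 c] by blast
  interpret F: puiseux_family "cchart c" "S \<times> UNIV" "(x0, w)" "degree P" N R e0 by (rule fam)
  let ?Q = "\<lambda>p. cchart c (p, w) 0"
  have Qv: "cchart c (p, v) 0 = ?Q p" for p v by (simp add: cchart_0)
  have real_root: "poly (?Q p) (of_real y) = 0 \<longleftrightarrow> poly (chart c p) y = 0" for p y
    by (simp add: cchart_0 poly_of_real_of_real)
  have cnj_root: "poly (?Q p) (cnj z) = 0" if "poly (?Q p) z = 0" for p z
    using that by (simp add: cchart_0 poly_of_real_cnj)
  have in_ball: "(0::complex) \<in> ball 0 (R ^ N)" using F.R by simp
  have lcp: "coeff (?Q p) (degree P) \<noteq> 0" "degree (?Q p) = degree P" if "p \<in> S" "dist (p, w) (x0, w) < e0" for p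
    using F.lc[of "(p, w)" 0] F.deg[of "(p, w)" 0] that in_ball by auto
  have "?Q x0 \<noteq> 0" using lcp[OF x0] F.e0 by auto
  then have fin: "finite {a. poly (?Q x0) a = 0}" by (rule poly_roots_finite)
  \<comment> \<open>The least distance of a nonreal root over \<open>x0\<close> from the real axis;
    the 1 covers the case that there are none.\<close>
  define \<eta>0 where "\<eta>0 = Min (insert 1 ((\<lambda>a. \<bar>Im a\<bar>) ` {a. poly (?Q x0) a = 0 \<and> Im a \<noteq> 0}))"
  have fin': "finite (insert 1 ((\<lambda>a. \<bar>Im a\<bar>) ` {a. poly (?Q x0) a = 0 \<and> Im a \<noteq> 0}))"
    using finite_subset[OF _ fin, of "{a. poly (?Q x0) a = 0 \<and> Im a \<noteq> 0}"] by auto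
  have \<eta>0: "\<eta>0 > 0" unfolding \<eta>0_def using fin' by (subst Min_gr_iff) auto
  have \<eta>0_le: "\<eta>0 \<le> \<bar>Im a\<bar>" if "poly (?Q x0) a = 0" "Im a \<noteq> 0" for a
    unfolding \<eta>0_def using fin' that by (intro Min_le) auto
  obtain \<eta> e where \<eta>: "0 < \<eta>" "\<eta> \<le> \<eta>0" and e: "0 < e" "e \<le> e0"
    and sep: "\<forall>a b. poly (?Q x0) a = 0 \<longrightarrow> poly (?Q x0) b = 0 \<longrightarrow> a \<noteq> b \<longrightarrow> 2 * \<eta> \<le> dist a b"
    and near: "\<forall>p\<in>S \<times> UNIV. dist p (x0, w) < e \<longrightarrow>
      (\<forall>a. poly (?Q x0) a = 0 \<longrightarrow> (\<exists>!y. poly (cchart c p 0) y = 0 \<and> dist y a < \<eta>)) \<and>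
      (\<forall>y. poly (cchart c p 0) y = 0 \<longrightarrow> (\<exists>a. poly (?Q x0) a = 0 \<and> dist y a < \<eta>)) \<and>
      (\<forall>a y. poly (?Q x0) a = 0 \<longrightarrow> poly (cchart c p 0) y = 0 \<longrightarrow> dist y a < \<eta> \<longrightarrow>
         order y (cchart c p 0) = order a (?Q x0) \<and>
         (\<forall>n \<gamma> l. (\<forall>g::real. \<exists>C. \<forall>\<^sub>F s in at_right 0. norm (poly (cchart c (x0, w) (of_real s)) (a + of_real (g * s))) \<le> C * s ^ n) \<longrightarrow>
            (\<gamma> \<longlongrightarrow> l) (at_right (0::real)) \<longrightarrow>
            (\<exists>C. \<forall>\<^sub>F s in at_right 0. norm (poly (cchart c p (of_real s)) (y + of_real s * \<gamma> s)) \<le> C * s ^ n)))"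
    using F.roots_persist[OF \<eta>0] by (elim exE conjE) (rule that)
  \<comment> \<open>Half of \<open>e\<close> for the point and half for the direction.\<close>
  define e' where "e' = e / 2"
  have e': "e' > 0" using e by (simp add: e'_def)
  have dist_pair: "dist (p, v) (x0, w) < e" if "dist p x0 < e'" "dist v w < e'" for p v
  proof -
    have "dist (p, v) (x0, w) \<le> dist p x0 + dist v w"
      unfolding dist_Pair_Pair by (rule sqrt_sum_squares_le_sum) auto
    then show ?thesis using that by (simp add: e'_def)
  qed
  have dist0: "dist (p, w) (x0, w) < e" if "dist p x0 < e'" for p using dist_pair[OF that, of w] e' by simp
  have U: "\<exists>!y. poly (?Q p) y = 0 \<and> dist y a < \<eta>" if "p \<in> S" "dist p x0 < e'" "poly (?Q x0) a = 0" for p a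
    using near[rule_format, of "(p, w)"] that dist0[OF that(2)] by simp
  have B: "\<exists>a. poly (?Q x0) a = 0 \<and> dist y a < \<eta>" if "p \<in> S" "dist p x0 < e'" "poly (?Q p) y = 0" for p y
    using near[rule_format, of "(p, w)"] that dist0[OF that(2)] by simp
  have O: "order y (?Q p) = order a (?Q x0)"
    if "p \<in> S" "dist p x0 < e'" "poly (?Q x0) a = 0" "poly (?Q p) y = 0" "dist y a < \<eta>" for p a y
    using near[rule_format, of "(p, w)"] that dist0[OF that(2)] by simp
  have G: "\<exists>C. \<forall>\<^sub>F s in at_right 0. norm (poly (cchart c (p, v) (of_real s)) (y + of_real s * \<gamma> s)) \<le> C * s ^ n"
    if h: "p \<in> S" "dist p x0 < e'" "poly (?Q x0) a = 0" "poly (?Q p) y = 0" "dist y a < \<eta>" "dist v w < e'"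
      and g: "\<forall>g::real. \<exists>C. \<forall>\<^sub>F s in at_right 0. norm (poly (cchart c (x0, w) (of_real s)) (a + of_real (g * s))) \<le> C * s ^ n"
      and l: "(\<gamma> \<longlongrightarrow> l) (at_right (0::real))" for p a y v n \<gamma> l
  proof -
    have "(p, v) \<in> S \<times> UNIV" using h(1) by simp
    note nr = near[THEN bspec, OF this, THEN mp, OF dist_pair[OF h(2,6)]]
    have "poly (cchart c (p, v) 0) y = 0" using h(4) unfolding Qv[of p v] .
    from nr[THEN conjunct2, THEN conjunct2, THEN spec, THEN spec, THEN mp, OF h(3), THEN mp, OF this, THEN mp, OF h(5),
        THEN conjunct2, THEN spec, THEN spec, THEN spec, THEN mp, OF g, THEN mp, OF l]
    show ?thesis .
  qed
  have realU: "poly (?Q p) z = 0 \<and> dist z (of_real r) < \<eta> \<Longrightarrow> \<exists>y. z = of_real y"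
    if p: "p \<in> S" "dist p x0 < e'" and r: "poly (chart c x0) r = 0" for p r z
  proof -
    assume z: "poly (?Q p) z = 0 \<and> dist z (of_real r) < \<eta>"
    have r': "poly (?Q x0) (of_real r) = 0" using r real_root by simp
    have "dist (cnj z) (of_real r) = cmod (cnj (z - of_real r))" by (simp add: dist_norm)
    also have "\<dots> = dist z (of_real r)" by (simp only: complex_mod_cnj dist_norm)
    finally have "poly (?Q p) (cnj z) = 0 \<and> dist (cnj z) (of_real r) < \<eta>" using z cnj_root[of p z] by simp
    then have "cnj z = z" using z U[OF p r'] by blast
    then have "z \<in> \<real>" by (simp add: Reals_cnj_iff)
    then show ?thesis by (elim Reals_cases) blast
  qed
  have dist_of_real: "dist (complex_of_real a) (of_real b) = dist a b" for a b
    by (simp add: dist_norm of_real_diff[symmetric] del: of_real_diff)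
  have rU: "\<exists>!y. poly (chart c p) y = 0 \<and> dist y r < \<eta>"
    if p: "p \<in> S" "dist p x0 < e'" and r: "poly (chart c x0) r = 0" for p r
  proof -
    have r': "poly (?Q x0) (of_real r) = 0" using r real_root by simp
    obtain z where z: "poly (?Q p) z = 0 \<and> dist z (of_real r) < \<eta>" using U[OF p r'] by blast
    then obtain y where y: "z = of_real y" using realU[OF p r] by blast
    have "poly (chart c p) y = 0 \<and> dist y r < \<eta>"
      using z unfolding y real_root dist_of_real .
    moreover have "y' = y" if y': "poly (chart c p) y' = 0 \<and> dist y' r < \<eta>" for y'
    proof -
      have "poly (?Q p) (of_real y') = 0 \<and> dist (complex_of_real y') (of_real r) < \<eta>"
        using y' unfolding real_root dist_of_real .
      then have "complex_of_real y' = z" using z U[OF p r'] by blast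
      then show ?thesis by (simp add: y)
    qed
    ultimately show ?thesis by blast
  qed
  have rB: "\<exists>r. poly (chart c x0) r = 0 \<and> dist y r < \<eta>"
    if p: "p \<in> S" "dist p x0 < e'" and y: "poly (chart c p) y = 0" for p y
  proof -
    have "poly (?Q p) (of_real y) = 0" using y real_root by simp
    then obtain a where a: "poly (?Q x0) a = 0" "dist (of_real y) a < \<eta>" using B[OF p] by blast
    have "Im a = 0"
    proof (rule ccontr)
      assume "Im a \<noteq> 0"
      then have "\<eta>0 \<le> \<bar>Im a\<bar>" using \<eta>0_le a by blast
      also have "\<dots> = \<bar>Im (of_real y - a)\<bar>" by simp
      also have "\<dots> \<le> dist (of_real y) a" unfolding dist_norm by (rule abs_Im_le_cmod)
      finally show False using a(2) \<eta>(2) by simp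
    qed
    then have ar: "a = of_real (Re a)" by (simp add: complex_eq_iff)
    have "poly (chart c x0) (Re a) = 0" using a(1) ar real_root by metis
    moreover have "dist y (Re a) < \<eta>" using a(2) ar dist_of_real by metis
    ultimately show ?thesis by blast
  qed
  have rO: "order y (chart c p) = order r (chart c x0)"
    if h: "p \<in> S" "dist p x0 < e'" "poly (chart c x0) r = 0" "poly (chart c p) y = 0" "dist y r < \<eta>" for p r y
  proof -
    have "order (of_real y) (?Q p) = order (of_real r) (?Q x0)"
      by (rule O[OF h(1,2)]) (use h real_root dist_of_real in auto)
    then show ?thesis by (simp add: cchart_0 order_of_real)
  qed
  have rG: "mp_ord H (hpt x0 (t * r) (t * (1 + c * r))) \<le> mp_ord H (hpt p (t' * y) (t' * (1 + c * y)))"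
    if h: "p \<in> S" "dist p x0 < e'" "poly (chart c x0) r = 0" "poly (chart c p) y = 0" "dist y r < \<eta>"
      and t: "t \<noteq> 0" "t' \<noteq> 0" for p r y t t'
  proof (rule order_from_growth[OF hom_poly_nonzero[OF x0] t(2) e'])
    fix v and \<gamma> :: "real \<Rightarrow> complex" and l assume v: "dist v w < e'" and l: "(\<gamma> \<longlongrightarrow> l) (at_right (0::real))"
    show "\<exists>C. \<forall>\<^sub>F s in at_right 0. norm (poly (cchart c (p, v) (of_real s)) (of_real y + of_real s * \<gamma> s))
        \<le> C * s ^ mp_ord H (hpt x0 (t * r) (t * (1 + c * r)))"
    proof (rule G[OF h(1,2) _ _ _ v _ l])
      show "poly (?Q x0) (of_real r) = 0" "poly (?Q p) (of_real y) = 0" using h real_root by auto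
      show "dist (complex_of_real y) (of_real r) < \<eta>" unfolding dist_of_real by (rule h(5))
      show "\<forall>g::real. \<exists>C. \<forall>\<^sub>F s in at_right 0. norm (poly (cchart c (x0, w) (of_real s)) (of_real r + of_real (g * s)))
         \<le> C * s ^ mp_ord H (hpt x0 (t * r) (t * (1 + c * r)))"
        by (intro allI growth_from_order[OF t(1) refl])
    qed
  qed
  have rC: "continuous_on (S \<inter> ball x0 e') (\<lambda>p. THE y. poly (chart c p) y = 0 \<and> dist y r < \<eta>)"
    if r: "poly (chart c x0) r = 0" for r
  proof -
    let ?A = "S \<inter> ball x0 e'"
    define f where "f p = (THE y. poly (chart c p) y = 0 \<and> dist y r < \<eta>)" for p
    have A: "p \<in> S" "dist p x0 < e'" "dist (p, w) (x0, w) < e0" if "p \<in> ?A" for p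
      using that dist0[of p] e(2) by (auto simp: dist_commute)
    have f: "poly (chart c p) (f p) = 0 \<and> dist (f p) r < \<eta>" if "p \<in> ?A" for p
      unfolding f_def by (rule theI'[OF rU[OF A(1,2)[OF that] r]])
    have contQ: "continuous_on ?A (\<lambda>p. coeff (?Q p) k)" for k
    proof -
      have "continuous_on ?A (\<lambda>p. ((p, w), 0::complex))" by (intro continuous_intros)
      from continuous_on_compose2[OF continuous_coeff_cchart this] show ?thesis by simp
    qed
    have "continuous_on ?A f"
      unfolding continuous_on_iff
    proof (intro ballI allI impI)
      fix p1 and \<epsilon> :: real assume p1: "p1 \<in> ?A" and \<epsilon>: "\<epsilon> > 0"
      define \<epsilon>' where "\<epsilon>' = min \<epsilon> (\<eta> - dist (f p1) r)"
      have \<epsilon>': "\<epsilon>' > 0" using \<epsilon> f[OF p1] by (simp add: \<epsilon>'_def)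
      have Q1: "?Q p1 \<noteq> 0" using lcp(1)[OF A(1,3)[OF p1]] by auto
      have root1: "poly (?Q p1) (of_real (f p1)) = 0" using f[OF p1] real_root by simp
      have degA: "degree (?Q p) = degree P" if "p \<in> ?A" for p by (rule lcp(2)[OF A(1,3)[OF that]])
      obtain \<delta> where \<delta>: "\<delta> > 0" "\<And>p. p \<in> ?A \<Longrightarrow> dist p p1 < \<delta> \<Longrightarrow> \<exists>z. poly (?Q p) z = 0 \<and> dist z (of_real (f p1)) < \<epsilon>'"
        using eventually_root_near[OF contQ degA p1 Q1 root1 \<epsilon>'] by blast
      have "dist (f p) (f p1) < \<epsilon>" if p: "p \<in> ?A" "dist p p1 < \<delta>" for p
      proof -
        obtain z where z: "poly (?Q p) z = 0" "dist z (of_real (f p1)) < \<epsilon>'" using \<delta>(2)[OF p] by blast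
        have "dist z (of_real r) \<le> dist z (of_real (f p1)) + dist (complex_of_real (f p1)) (of_real r)" by (rule dist_triangle)
        also have "\<dots> < \<eta>" unfolding dist_of_real using z(2) by (simp add: \<epsilon>'_def)
        finally have "poly (?Q p) z = 0 \<and> dist z (of_real r) < \<eta>" using z(1) by simp
        moreover have "poly (?Q p) (of_real (f p)) = 0 \<and> dist (complex_of_real (f p)) (of_real r) < \<eta>"
          using f[OF p(1)] unfolding real_root dist_of_real .
        moreover have "poly (?Q x0) (of_real r) = 0" using r real_root by simp
        ultimately have "z = of_real (f p)" using U[OF A(1,2)[OF p(1)]] by blast
        then show ?thesis using z(2) unfolding \<epsilon>'_def by (simp add: dist_of_real)
      qed
      then show "\<exists>d>0. \<forall>x'\<in>?A. dist x' p1 < d \<longrightarrow> dist (f x') (f p1) < \<epsilon>" using \<delta>(1) by blast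
    qed
    then show ?thesis unfolding f_def .
  qed
  have rsep: "2 * \<eta> \<le> dist a b" if "poly (chart c x0) a = 0" "poly (chart c x0) b = 0" "a \<noteq> b" for a b
  proof -
    have "poly (?Q x0) (of_real a) = 0" "poly (?Q x0) (of_real b) = 0" "complex_of_real a \<noteq> of_real b"
      using that real_root by auto
    then have "2 * \<eta> \<le> dist (complex_of_real a) (of_real b)" using sep by blast
    then show ?thesis unfolding dist_of_real .
  qed
  have rlc: "hv (($) p) 1 c \<noteq> 0" if "p \<in> S" "dist p x0 < e'" for p
  proof -
    have "coeff (?Q p) (degree P) \<noteq> 0" using lcp(1)[OF that(1)] dist0[OF that(2)] e(2) by simp
    then show ?thesis unfolding cchart_0 by (simp add: coeff_chart_top)
  qed
  show ?thesis
  proof (rule exI[of _ \<eta>], rule exI[of _ e'], intro conjI allI impI ballI)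
  qed (fact \<eta>(1) e' | erule (2) rsep | erule (1) rlc | erule (2) rU | erule (2) rB | erule (4) rO | erule (6) rG | erule rC)+
qed

end

section \<open>Analytic submanifolds and the projective line\<close>

text \<open>A nonconstant monomial has at least one factor bounded by \<open>norm (x - a)\<close>,
  and the others are at most \<rho>. So its change is dominated by its absolute value at the corner
  where every coordinate exceeds that of \<open>a\<close> by \<rho>.\<close>

lemma power_series_term_bound:
  fixes x a :: "real^'n"
  assumes \<delta>: "norm (x - a) \<le> \<rho>" and \<rho>: "\<rho> > 0"
  shows "\<bar>c * (\<Prod>i\<in>UNIV. (x $ i - a $ i) ^ Poly_Mapping.lookup \<alpha> i) - c * (\<Prod>i\<in>UNIV. (a $ i - a $ i) ^ Poly_Mapping.lookup \<alpha> i)\<bar>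
    \<le> norm (x - a) / \<rho> * \<bar>c * (\<Prod>i\<in>(UNIV::'n set). \<rho> ^ Poly_Mapping.lookup \<alpha> i)\<bar>"
proof (cases "\<alpha> = 0")
  case True
  then show ?thesis using \<rho> by simp
next
  case False
  define n where "n = (\<Sum>i\<in>UNIV. Poly_Mapping.lookup \<alpha> i)"
  obtain j where j: "Poly_Mapping.lookup \<alpha> j \<noteq> 0" using False by (metis poly_mapping_eqI lookup_zero)
  have "Poly_Mapping.lookup \<alpha> j \<le> n" unfolding n_def by (rule member_le_sum) auto
  then obtain m where m: "n = Suc m" using j by (cases n) auto
  have z: "(\<Prod>i\<in>UNIV. (a $ i - a $ i) ^ Poly_Mapping.lookup \<alpha> i) = 0"
    by (rule prod_zero[OF finite]) (use j in \<open>auto intro!: bexI[of _ j]\<close>)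
  have "\<bar>\<Prod>i\<in>UNIV. (x $ i - a $ i) ^ Poly_Mapping.lookup \<alpha> i\<bar> = (\<Prod>i\<in>UNIV. \<bar>x $ i - a $ i\<bar> ^ Poly_Mapping.lookup \<alpha> i)"
    by (simp add: abs_prod power_abs)
  also have "\<dots> \<le> (\<Prod>i\<in>(UNIV::'n set). norm (x - a) ^ Poly_Mapping.lookup \<alpha> i)"
  proof (rule prod_mono)
    fix i :: 'n
    have "\<bar>x $ i - a $ i\<bar> \<le> norm (x - a)" using component_le_norm_cart[of "x - a" i] by simp
    then show "0 \<le> \<bar>x $ i - a $ i\<bar> ^ Poly_Mapping.lookup \<alpha> i \<and>
        \<bar>x $ i - a $ i\<bar> ^ Poly_Mapping.lookup \<alpha> i \<le> norm (x - a) ^ Poly_Mapping.lookup \<alpha> i"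
      by (simp add: power_mono)
  qed
  also have "\<dots> = norm (x - a) ^ n" by (simp add: n_def power_sum)
  also have "\<dots> \<le> norm (x - a) * \<rho> ^ m" unfolding m power_Suc using \<delta> by (intro mult_left_mono power_mono) auto
  also have "\<dots> = norm (x - a) / \<rho> * \<rho> ^ n" using \<rho> by (simp add: m)
  also have "\<rho> ^ n = (\<Prod>i\<in>(UNIV::'n set). \<rho> ^ Poly_Mapping.lookup \<alpha> i)" by (simp add: n_def power_sum)
  finally have "\<bar>\<Prod>i\<in>UNIV. (x $ i - a $ i) ^ Poly_Mapping.lookup \<alpha> i\<bar>
      \<le> norm (x - a) / \<rho> * (\<Prod>i\<in>(UNIV::'n set). \<rho> ^ Poly_Mapping.lookup \<alpha> i)" .
  then have "\<bar>c\<bar> * \<bar>\<Prod>i\<in>UNIV. (x $ i - a $ i) ^ Poly_Mapping.lookup \<alpha> i\<bar>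
      \<le> \<bar>c\<bar> * (norm (x - a) / \<rho> * (\<Prod>i\<in>(UNIV::'n set). \<rho> ^ Poly_Mapping.lookup \<alpha> i))"
    by (rule mult_left_mono) simp
  moreover have "(\<Prod>i\<in>(UNIV::'n set). \<rho> ^ Poly_Mapping.lookup \<alpha> i) \<ge> 0" using \<rho> by (intro prod_nonneg) simp
  ultimately show ?thesis unfolding z by (simp add: abs_mult mult.left_commute)
qed

text \<open>Convergence at the corner is absolute, and summing the termwise bound gives a Lipschitz
  estimate at \<open>a\<close>.\<close>

lemma real_analytic_imp_isCont:
  fixes f :: "real^'n \<Rightarrow> real"
  assumes "real_analytic_on U f" "a \<in> U"
  shows "isCont f a"
proof -
  let ?t = "\<lambda>c x \<alpha>. c \<alpha> * (\<Prod>i\<in>UNIV. (x $ i - a $ i) ^ Poly_Mapping.lookup \<alpha> i)"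
  obtain r c where r: "r > 0" and c: "\<And>x. x \<in> ball a r \<Longrightarrow> (?t c x has_sum f x) UNIV"
    using assms unfolding real_analytic_on_def by meson
  \<comment> \<open>Small enough for the corner \<open>b\<close>, whose distance from
    \<open>a\<close> is at most \<rho> times the number of coordinates, to lie in the ball of
    convergence.\<close>
  define \<rho> where "\<rho> = r / (1 + real CARD('n))"
  have \<rho>: "\<rho> > 0" using r by (simp add: \<rho>_def add_pos_nonneg)
  have \<rho>n: "real CARD('n) * \<rho> < r" using r by (simp add: \<rho>_def field_simps)
  have "real CARD('n) \<ge> 1" by (simp add: Suc_leI)
  then have "1 * \<rho> \<le> real CARD('n) * \<rho>" using \<rho> by (intro mult_right_mono) auto
  then have \<rho>r: "\<rho> < r" using \<rho>n by simp
  define b :: "real^'n" where "b = (\<chi> i. a $ i + \<rho>)"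
  have "norm (b - a) \<le> (\<Sum>i\<in>(UNIV::'n set). \<bar>(b - a) $ i\<bar>)" by (rule norm_le_l1_cart)
  also have "\<dots> = real CARD('n) * \<rho>" using \<rho> by (simp add: b_def)
  also have "\<dots> < r" by (rule \<rho>n)
  finally have "b \<in> ball a r" by (simp add: dist_norm norm_minus_commute)
  then have "?t c b summable_on UNIV" using has_sum_imp_summable[OF c] by simp
  then have "(\<lambda>\<alpha>. norm (?t c b \<alpha>)) summable_on UNIV" by (rule iffD1[OF summable_on_iff_abs_summable_on_real])
  then obtain M where M: "((\<lambda>\<alpha>. norm (?t c b \<alpha>)) has_sum M) UNIV" unfolding summable_on_def by (elim exE)
  have bound: "\<bar>f x - f a\<bar> \<le> norm (x - a) / \<rho> * M" if x: "norm (x - a) \<le> \<rho>" for x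
  proof -
    have xb: "x \<in> ball a r" using x \<rho>r by (simp add: dist_norm norm_minus_commute)
    have ab: "a \<in> ball a r" using r by simp
    have na: "((\<lambda>\<alpha>. - ?t c a \<alpha>) has_sum - f a) UNIV" unfolding has_sum_uminus using c[OF ab] by simp
    have d: "((\<lambda>\<alpha>. ?t c x \<alpha> + - ?t c a \<alpha>) has_sum (f x + - f a)) UNIV" by (rule has_sum_add[OF c[OF xb] na])
    have d': "((\<lambda>\<alpha>. - (?t c x \<alpha> + - ?t c a \<alpha>)) has_sum - (f x + - f a)) UNIV" unfolding has_sum_uminus using d by simp
    have B: "((\<lambda>\<alpha>. norm (x - a) / \<rho> * norm (?t c b \<alpha>)) has_sum (norm (x - a) / \<rho> * M)) UNIV"
      by (rule has_sum_cmult_right[OF M])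
    have le: "\<bar>?t c x \<alpha> - ?t c a \<alpha>\<bar> \<le> norm (x - a) / \<rho> * norm (?t c b \<alpha>)" for \<alpha>
      using power_series_term_bound[OF x \<rho>, of "c \<alpha>" \<alpha>] by (simp add: b_def)
    have "f x + - f a \<le> norm (x - a) / \<rho> * M"
    proof (rule has_sum_mono[OF d B])
      show "?t c x \<alpha> + - ?t c a \<alpha> \<le> norm (x - a) / \<rho> * norm (?t c b \<alpha>)" for \<alpha> using le[of \<alpha>] by linarith
    qed
    moreover have "- (f x + - f a) \<le> norm (x - a) / \<rho> * M"
    proof (rule has_sum_mono[OF d' B])
      show "- (?t c x \<alpha> + - ?t c a \<alpha>) \<le> norm (x - a) / \<rho> * norm (?t c b \<alpha>)" for \<alpha> using le[of \<alpha>] by linarith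
    qed
    ultimately show ?thesis by linarith
  qed
  have "((\<lambda>x. f x - f a) \<longlongrightarrow> 0) (at a)"
  proof (rule Lim_null_comparison)
    show "\<forall>\<^sub>F x in at a. norm (f x - f a) \<le> norm (x - a) / \<rho> * M"
      unfolding eventually_at by (rule exI[of _ \<rho>]) (use \<rho> bound in \<open>auto simp: dist_norm less_imp_le\<close>)
    have "((\<lambda>x. norm (x - a) / \<rho> * M) \<longlongrightarrow> norm (a - a) / \<rho> * M) (at a)" using \<rho> by (intro tendsto_intros) auto
    then show "((\<lambda>x. norm (x - a) / \<rho> * M) \<longlongrightarrow> 0) (at a)" by simp
  qed
  then show ?thesis unfolding isCont_def by (rule LIM_zero_cancel)
qed

lemma locally_if_openin_cover:
  assumes "\<And>x. x \<in> S \<Longrightarrow> \<exists>T. openin (top_of_set S) T \<and> x \<in> T \<and> locally Q T"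
  shows "locally Q S"
  unfolding locally_def
proof (intro allI impI, elim conjE)
  fix w x assume w: "openin (top_of_set S) w" and x: "x \<in> w"
  then have "x \<in> S" using openin_imp_subset by blast
  then obtain T where T: "openin (top_of_set S) T" "x \<in> T" "locally Q T" using assms by blast
  have TS: "T \<subseteq> S" using T(1) openin_imp_subset by blast
  obtain A where A: "open A" "w = S \<inter> A" using w unfolding openin_open by auto
  then have "T \<inter> w = T \<inter> A" using TS by auto
  then have "openin (top_of_set T) (T \<inter> w)" using A(1) by (simp add: openin_open_Int)
  moreover have "x \<in> T \<inter> w" using T(2) x by simp
  ultimately obtain u v where uv: "openin (top_of_set T) u" "Q v" "x \<in> u" "u \<subseteq> v" "v \<subseteq> T \<inter> w"
    by (rule locallyE[OF T(3)])
  have "openin (top_of_set S) u" using openin_trans[OF uv(1) T(1)] .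
  then show "\<exists>u v. openin (top_of_set S) u \<and> Q v \<and> x \<in> u \<and> u \<subseteq> v \<and> v \<subseteq> w" using uv by blast
qed

text \<open>Near each point \<open>S\<close> is homeomorphic to a relatively open subset of a
  coordinate subspace, which is convex.\<close>

lemma analytic_submanifold_locally_path_connected:
  fixes S :: "(real^'n) set"
  assumes "analytic_submanifold S"
  shows "locally path_connected S"
proof (rule locally_if_openin_cover)
  fix p assume "p \<in> S"
  then obtain U V \<phi> I where p: "p \<in> U" and dif: "analytic_diffeo U V \<phi>"
    and im: "\<phi> ` (S \<inter> U) = V \<inter> {y :: real^'n. \<forall>i. i \<notin> I \<longrightarrow> y $ i = 0}"
    using assms unfolding analytic_submanifold_def by meson
  obtain \<psi> :: "real^'n \<Rightarrow> real^'n" where UV: "open U" "open V" and bij: "bij_betw \<phi> U V" and an: "\<And>i. real_analytic_on U (\<lambda>x. \<phi> x $ i)"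
    and an': "\<And>i. real_analytic_on V (\<lambda>y. \<psi> y $ i)" and inv: "\<And>x. x \<in> U \<Longrightarrow> \<psi> (\<phi> x) = x"
    using dif unfolding analytic_diffeo_def by blast
  let ?L = "{y :: real^'n. \<forall>i. i \<notin> I \<longrightarrow> y $ i = 0}"
  have cont: "continuous_on A f" if "\<And>i. real_analytic_on A (\<lambda>x. f x $ i)" for A and f :: "real^'n \<Rightarrow> real^'n"
  proof -
    have "continuous_on A (\<lambda>x. \<chi> i. f x $ i)"
      by (intro continuous_on_vec_lambda continuous_at_imp_continuous_on ballI real_analytic_imp_isCont[OF that])
    then show ?thesis by simp
  qed
  have "homeomorphism (S \<inter> U) (V \<inter> ?L) \<phi> \<psi>"
    unfolding homeomorphism_def
  proof (intro conjI ballI)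
    show "\<psi> (\<phi> x) = x" if "x \<in> S \<inter> U" for x using inv that by simp
    show "\<phi> ` (S \<inter> U) = V \<inter> ?L" by (rule im)
    show "continuous_on (S \<inter> U) \<phi>" by (rule continuous_on_subset[OF cont[OF an]]) simp
    show "continuous_on (V \<inter> ?L) \<psi>" by (rule continuous_on_subset[OF cont[OF an']]) simp
    have "\<psi> ` \<phi> ` (S \<inter> U) = S \<inter> U"
      unfolding image_image by (rule trans[OF image_cong[OF refl, of _ _ "\<lambda>x. x"]]) (use inv in auto)
    then show "\<psi> ` (V \<inter> ?L) = S \<inter> U" unfolding im .
    show "\<phi> (\<psi> y) = y" if y: "y \<in> V \<inter> ?L" for y
    proof -
      obtain x where "x \<in> S \<inter> U" "y = \<phi> x" using y unfolding im[symmetric] by blast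
      then show ?thesis using inv by simp
    qed
  qed
  then have hom: "(S \<inter> U) homeomorphic (V \<inter> ?L)" unfolding homeomorphic_def by blast
  have "convex ?L" unfolding convex_def by simp
  then have "locally path_connected ?L" by (rule convex_imp_locally_path_connected)
  moreover have "openin (top_of_set ?L) (V \<inter> ?L)" 
    by (subst Int_commute) (rule openin_open_Int[OF UV(2)])
  ultimately have "locally path_connected (V \<inter> ?L)" by (rule locally_open_subset)
  then have "locally path_connected (S \<inter> U)"
    using homeomorphic_locally[OF hom, of path_connected path_connected] homeomorphic_path_connectedness by blast
  moreover have "openin (top_of_set S) (S \<inter> U)" using UV(1) by (simp add: openin_open_Int)
  ultimately show "\<exists>T. openin (top_of_set S) T \<and> p \<in> T \<and> locally path_connected T" using p \<open>p \<in> S\<close> by blast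
qed

section \<open>The topology of the projective line\<close>

lemma mem_rp_class: "(a, b) \<in> rp_class (u, v) \<longleftrightarrow> (\<exists>t. t \<noteq> 0 \<and> a = t * u \<and> b = t * v)"
  unfolding rp_class_def by auto

lemma self_mem_rp_class: "p \<in> rp_class p"
  unfolding rp_class_def by (cases p) (auto intro!: exI[of _ 1])

lemma rp_class_scale:
  assumes "t \<noteq> 0"
  shows "rp_class (t * u, t * v) = rp_class (u, v)"
proof -
  have "(a, b) \<in> rp_class (t * u, t * v) \<longleftrightarrow> (a, b) \<in> rp_class (u, v)" for a b
  proof
    assume "(a, b) \<in> rp_class (t * u, t * v)"
    then obtain s where "s \<noteq> 0" "a = s * (t * u)" "b = s * (t * v)" unfolding mem_rp_class by blast
    then show "(a, b) \<in> rp_class (u, v)" unfolding mem_rp_class using assms by (intro exI[of _ "s * t"]) simp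
  next
    assume "(a, b) \<in> rp_class (u, v)"
    then obtain s where "s \<noteq> 0" "a = s * u" "b = s * v" unfolding mem_rp_class by blast
    then show "(a, b) \<in> rp_class (t * u, t * v)" unfolding mem_rp_class using assms by (intro exI[of _ "s / t"]) simp
  qed
  then show ?thesis by auto
qed

lemma rp_class_eq_if_mem: "q \<in> rp_class p \<Longrightarrow> rp_class q = rp_class p"
  by (cases p, cases q) (auto simp: mem_rp_class rp_class_scale)

lemma rp_class_in_RP1: "p \<noteq> (0, 0) \<Longrightarrow> rp_class p \<in> RP1"
  unfolding RP1_def by blast

lemma mem_Union_RP1_iff:
  assumes "W \<subseteq> RP1"
  shows "p \<in> \<Union>W \<longleftrightarrow> rp_class p \<in> W"
proof
  assume "p \<in> \<Union>W"
  then obtain C where C: "C \<in> W" "p \<in> C" by blast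
  then obtain q where "C = rp_class q" using assms unfolding RP1_def by blast
  then show "rp_class p \<in> W" using C rp_class_eq_if_mem by metis
qed (use self_mem_rp_class in blast)

lemma zero_notin_RP1: "C \<in> RP1 \<Longrightarrow> (0, 0) \<notin> C"
proof
  assume "C \<in> RP1" "(0, 0) \<in> C"
  then obtain u v where "(u, v) \<noteq> (0, 0)" "(0, 0) \<in> rp_class (u, v)" unfolding RP1_def by auto
  then show False unfolding mem_rp_class by auto
qed

lemma openin_RP1_top: "openin RP1_top W \<longleftrightarrow> W \<subseteq> RP1 \<and> open (\<Union>W)"
proof -
  let ?L = "\<lambda>W. W \<subseteq> RP1 \<and> openin (top_of_set (- {(0, 0)})) (\<Union>W)"
  have "istopology ?L"
    unfolding istopology_def
  proof (intro conjI allI impI)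
    fix A B assume A: "?L A" and B: "?L B"
    \<comment> \<open>Distinct classes are disjoint, so the union of classes commutes with
      intersecting two sets of classes.\<close>
    have "p \<in> \<Union>(A \<inter> B) \<longleftrightarrow> p \<in> \<Union>A \<inter> \<Union>B" for p
      using mem_Union_RP1_iff[of A p] mem_Union_RP1_iff[of B p] mem_Union_RP1_iff[of "A \<inter> B" p] A B by blast
    then have "\<Union>(A \<inter> B) = \<Union>A \<inter> \<Union>B" by blast
    then show "A \<inter> B \<subseteq> RP1" "openin (top_of_set (- {(0, 0)})) (\<Union>(A \<inter> B))" using A B openin_Int by auto
  next
    fix K assume K: "\<forall>A\<in>K. ?L A"
    then show "\<Union>K \<subseteq> RP1" by blast
    have "\<Union>(\<Union>K) = \<Union>((\<lambda>A. \<Union>A) ` K)" by blast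
    then show "openin (top_of_set (- {(0, 0)})) (\<Union>(\<Union>K))" using K by auto
  qed
  then have "openin RP1_top W \<longleftrightarrow> ?L W" unfolding RP1_top_def by (simp add: topology_inverse')
  moreover have "\<Union>W \<subseteq> - {(0, 0)}" if "W \<subseteq> RP1" using zero_notin_RP1 that by blast
  moreover have "open (- {(0 :: real, 0 :: real)})" by (simp add: open_Compl)
  ultimately show ?thesis using openin_open_eq by blast
qed

lemma topspace_RP1_top: "topspace RP1_top = RP1"
proof -
  have "\<Union>RP1 = - {(0, 0)}"
  proof (intro equalityI subsetI)
    fix p assume "p \<in> - {(0 :: real, 0 :: real)}"
    then show "p \<in> \<Union>RP1" using self_mem_rp_class rp_class_in_RP1[of p] by blast
  qed (use zero_notin_RP1 in blast)
  then have "openin RP1_top RP1" unfolding openin_RP1_top by (simp add: open_Compl)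
  then show ?thesis unfolding topspace_def using openin_RP1_top by blast
qed

lemma openin_RP1_chart: "openin RP1_top {rp_class (z, 1 + c * z) | z. dist z r < \<eta>}"
proof -
  let ?W = "{rp_class (z, 1 + c * z) | z. dist z r < \<eta>}"
  have ne: "(z, 1 + c * z) \<noteq> (0, 0)" for z by auto
  have sub: "?W \<subseteq> RP1" using rp_class_in_RP1[OF ne] by blast
  \<comment> \<open>The chart coordinate is \<open>u / (v - c * u)\<close>; multiplying its
    inequality by the modulus of the denominator leaves a condition whose openness is
    evident.\<close>
  let ?X = "{p :: real \<times> real. snd p - c * fst p \<noteq> 0 \<and> dist (fst p) (r * (snd p - c * fst p)) < \<eta> * \<bar>snd p - c * fst p\<bar>}"
  have "\<Union>?W = ?X"
  proof (intro equalityI subsetI)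
    fix p assume "p \<in> \<Union>?W"
    then obtain z where z: "dist z r < \<eta>" "p \<in> rp_class (z, 1 + c * z)" by blast
    then obtain t where t: "t \<noteq> 0" "fst p = t * z" "snd p = t * (1 + c * z)" using mem_rp_class[of "fst p" "snd p"] by auto
    have \<tau>: "snd p - c * fst p = t" unfolding t by (simp add: algebra_simps)
    have "dist (fst p) (r * t) = \<bar>t\<bar> * dist z r" unfolding t dist_real_def abs_mult[symmetric] by (simp add: algebra_simps)
    also have "\<dots> < \<eta> * \<bar>t\<bar>" using z t by (simp add: mult.commute)
    finally show "p \<in> ?X" using \<tau> t(1) by simp
  next
    fix p assume p: "p \<in> ?X"
    define t where "t = snd p - c * fst p"
    have t: "t \<noteq> 0" "dist (fst p) (r * t) < \<eta> * \<bar>t\<bar>" using p by (auto simp: t_def)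
    define z where "z = fst p / t"
    have fp: "fst p = t * z" using t by (simp add: z_def)
    have "snd p = t + c * fst p" by (simp add: t_def)
    also have "\<dots> = t * (1 + c * z)" unfolding fp by (simp add: algebra_simps)
    finally have sp: "snd p = t * (1 + c * z)" .
    have "dist (fst p) (r * t) = \<bar>t\<bar> * dist z r" unfolding fp dist_real_def abs_mult[symmetric] by (simp add: algebra_simps)
    then have "dist z r < \<eta>" using t by (simp add: mult.commute)
    moreover have "(fst p, snd p) \<in> rp_class (z, 1 + c * z)" unfolding mem_rp_class using t(1) fp sp by blast
    then have "p \<in> rp_class (z, 1 + c * z)" by simp
    ultimately show "p \<in> \<Union>?W" by blast
  qed
  moreover have "open ?X"
    by (intro open_Collect_conj open_Collect_neq open_Collect_less continuous_intros)
  ultimately show ?thesis unfolding openin_RP1_top using sub by simp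
qed

text \<open>\<open>RP1\<close> is embedded in the plane by the entries of the orthogonal projection onto the line spanned
  by \<open>(u, v)\<close>; \<open>proj_inv\<close> recovers the line as the span of a nonzero column of the projection.\<close>

definition proj_line :: "real \<times> real \<Rightarrow> real \<times> real" where
  "proj_line p = (fst p ^ 2 / (fst p ^ 2 + snd p ^ 2), fst p * snd p / (fst p ^ 2 + snd p ^ 2))"

definition proj_inv :: "real \<times> real \<Rightarrow> (real \<times> real) set" where
  "proj_inv w = rp_class (if fst w \<noteq> 0 then w else (snd w, 1 - fst w))"

lemma proj_line_columns:
  assumes "(u, v) \<noteq> (0, 0)"
  shows "u \<noteq> 0 \<Longrightarrow> rp_class (proj_line (u, v)) = rp_class (u, v)"
    and "v \<noteq> 0 \<Longrightarrow> rp_class (snd (proj_line (u, v)), 1 - fst (proj_line (u, v))) = rp_class (u, v)"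
    and "u = 0 \<Longrightarrow> proj_line (u, v) = (0, 0)"
    and "v = 0 \<Longrightarrow> (snd (proj_line (u, v)), 1 - fst (proj_line (u, v))) = (0, 0)"
proof -
  define n where "n = u ^ 2 + v ^ 2"
  have n: "n \<noteq> 0" using assms by (simp add: n_def sum_power2_eq_zero_iff)
  have 1: "proj_line (u, v) = (u / n * u, u / n * v)" by (simp add: proj_line_def n_def power2_eq_square)
  have "1 - u / n * u = v / n * v" using n by (simp add: field_simps n_def power2_eq_square)
  then have 2: "(snd (proj_line (u, v)), 1 - fst (proj_line (u, v))) = (v / n * u, v / n * v)" unfolding 1 by simp
  show "u \<noteq> 0 \<Longrightarrow> rp_class (proj_line (u, v)) = rp_class (u, v)" unfolding 1 by (rule rp_class_scale) (use n in simp)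
  show "v \<noteq> 0 \<Longrightarrow> rp_class (snd (proj_line (u, v)), 1 - fst (proj_line (u, v))) = rp_class (u, v)"
    unfolding 2 by (rule rp_class_scale) (use n in simp)
  show "u = 0 \<Longrightarrow> proj_line (u, v) = (0, 0)" unfolding 1 by simp
  show "v = 0 \<Longrightarrow> (snd (proj_line (u, v)), 1 - fst (proj_line (u, v))) = (0, 0)" unfolding 2 by simp
qed

lemma proj_inv_proj_line:
  assumes "(u, v) \<noteq> (0, 0)"
  shows "proj_inv (proj_line (u, v)) = rp_class (u, v)"
proof (cases "u = 0")
  case True
  then have v: "v \<noteq> 0" using assms by simp
  then show ?thesis using proj_line_columns(2,3)[OF assms] True by (simp add: proj_inv_def)
next
  case False
  then have "fst (proj_line (u, v)) \<noteq> 0" by (simp add: proj_line_def sum_power2_eq_zero_iff)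
  then show ?thesis using proj_line_columns(1)[OF assms False] by (simp add: proj_inv_def)
qed

lemma proj_line_scale: "t \<noteq> 0 \<Longrightarrow> proj_line (t * u, t * v) = proj_line (u, v)"
  by (simp add: proj_line_def power_mult_distrib power2_eq_square distrib_left[symmetric] mult.assoc mult.left_commute)

text \<open>A column of the projection spans the line unless it is zero, and the zero vector lies in
  no class. So the preimage of \<open>W\<close> is the union of its preimages under the two columns,
  both continuous, and the case distinction in \<open>proj_inv\<close> disappears.\<close>

lemma continuous_map_proj_inv:
  assumes g: "continuous_on S g" and im: "\<And>x. x \<in> S \<Longrightarrow> \<exists>u v. (u, v) \<noteq> (0, 0) \<and> g x = proj_line (u, v)"
  shows "continuous_map (top_of_set S) RP1_top (\<lambda>x. proj_inv (g x))"
  unfolding continuous_map_def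
proof (intro conjI allI impI funcsetI)
  fix x assume "x \<in> topspace (top_of_set S)"
  then have "x \<in> S" by simp
  then obtain u v where "(u, v) \<noteq> (0, 0)" "g x = proj_line (u, v)" using im by blast
  then show "proj_inv (g x) \<in> topspace RP1_top"
    unfolding topspace_RP1_top by (simp add: proj_inv_proj_line rp_class_in_RP1)
next
  fix W assume "openin RP1_top W"
  then have W: "W \<subseteq> RP1" "open (\<Union>W)" by (auto simp: openin_RP1_top)
  have zW: "(0, 0) \<notin> \<Union>W" using W(1) zero_notin_RP1 by blast
  let ?h = "\<lambda>x. (snd (g x), 1 - fst (g x))"
  have "{x \<in> S. proj_inv (g x) \<in> W} = (S \<inter> g -` \<Union>W) \<union> (S \<inter> ?h -` \<Union>W)"
  proof -
    have "proj_inv (g x) \<in> W \<longleftrightarrow> g x \<in> \<Union>W \<or> ?h x \<in> \<Union>W" if xS: "x \<in> S" for x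
    proof -
      obtain u v where uv: "(u, v) \<noteq> (0, 0)" "g x = proj_line (u, v)" using im[OF xS] by blast
      have inv: "proj_inv (g x) = rp_class (u, v)" using proj_inv_proj_line[OF uv(1)] uv(2) by simp
      have a: "g x \<in> \<Union>W \<longleftrightarrow> u \<noteq> 0 \<and> rp_class (u, v) \<in> W"
      proof (cases "u = 0")
        case True
        then show ?thesis using proj_line_columns(3)[OF uv(1)] zW unfolding uv(2) by simp
      next
        case False
        show ?thesis unfolding mem_Union_RP1_iff[OF W(1)] uv(2) proj_line_columns(1)[OF uv(1) False] using False by simp
      qed
      have b: "?h x \<in> \<Union>W \<longleftrightarrow> v \<noteq> 0 \<and> rp_class (u, v) \<in> W"
      proof (cases "v = 0")
        case True
        then show ?thesis using proj_line_columns(4)[OF uv(1)] zW unfolding uv(2) by simp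
      next
        case False
        show ?thesis unfolding mem_Union_RP1_iff[OF W(1)] uv(2) proj_line_columns(2)[OF uv(1) False] using False by simp
      qed
      show ?thesis unfolding inv a b using uv(1) by auto
    qed
    then show ?thesis by blast
  qed
  moreover have "openin (top_of_set S) (S \<inter> g -` \<Union>W)" by (rule continuous_openin_preimage_gen[OF g W(2)])
  moreover have "continuous_on S ?h" by (intro continuous_intros g)
  then have "openin (top_of_set S) (S \<inter> ?h -` \<Union>W)" by (rule continuous_openin_preimage_gen[OF _ W(2)])
  ultimately show "openin (top_of_set S) {x \<in> topspace (top_of_set S). proj_inv (g x) \<in> W}"
    by (simp add: openin_Un)
qed

section \<open>Projective delineability\<close>

text \<open>Substitution of the chart into a binary form. Being multiplicative, it carries
  divisibility of forms over to polynomials.\<close>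

definition chart_hom :: "real \<Rightarrow> bool mpoly \<Rightarrow> real poly" where
  "chart_hom c f = mp_eval_hom (\<lambda>c. [:c:]) (\<lambda>b. if b then [:1, c:] else [:0, 1:]) f"

lemma poly_chart_hom: "poly (chart_hom c f) z = mp_eval (bpt z (1 + c * z)) f"
proof -
  have e: "poly (if b then [:1, c:] else [:0, 1:]) z = bpt z (1 + c * z) b" for b
    by (simp add: bpt_def mult.commute)
  show ?thesis
    unfolding chart_hom_def mp_eval_hom_def mp_eval_def by (simp add: poly_sum poly_prod e)
qed

lemma Greatest_le_eq: "(GREATEST j::nat. j \<le> m) = m"
  by (rule Greatest_equality) auto

section \<open>Multiplicities of projective roots\<close>

context disc_invariant
begin

lemma mp_eval_binform: "mp_eval (bpt u v) (binform (degree P) P x) = hv (($) x) u v"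
  unfolding binform_def hv_def by (simp add: mp_eval_simps bpt_def)

lemma chart_hom_binform: "chart_hom c (binform (degree P) P x) = chart c x"
  unfolding poly_eq_poly_eq_iff[symmetric]
  by (rule ext) (simp only: poly_chart_hom mp_eval_binform poly_chart)

text \<open>From forms to polynomials by \<open>chart_hom\<close>. For the converse the cofactor
  must be homogenised again, now with respect to \<open>u\<close> and \<open>v - c * u\<close>, and
  the degrees must match: this is where the degree bound for the chart polynomial enters.\<close>

lemma linear_power_dvd_binform_iff:
  assumes t: "t \<noteq> 0" and ne: "chart c x \<noteq> 0"
  shows "(mp_const (t * (1 + c * y)) * mp_var False - mp_const (t * y) * mp_var True) ^ j dvd binform (degree P) P x
    \<longleftrightarrow> j \<le> order y (chart c x)"
proof -
  let ?L = "mp_const (t * (1 + c * y)) * mp_var False - mp_const (t * y) * mp_var True :: bool mpoly"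
  let ?B = "binform (degree P) P x"
  have evL: "mp_eval (bpt u v) ?L = t * (u - y * (v - c * u))" for u v
    by (simp add: mp_eval_simps bpt_def algebra_simps)
  have hL: "chart_hom c ?L = Polynomial.smult t [:- y, 1:]"
    unfolding poly_eq_poly_eq_iff[symmetric]
    by (rule ext, unfold poly_chart_hom evL) (simp add: algebra_simps)
  have "?L ^ j dvd ?B \<longleftrightarrow> [:- y, 1:] ^ j dvd chart c x"
  proof
    assume "?L ^ j dvd ?B"
    then obtain K where "?B = ?L ^ j * K" by (elim dvdE)
    then have "chart_hom c ?B = chart_hom c (?L ^ j * K)" by (rule arg_cong)
    then have "chart c x = (Polynomial.smult t [:- y, 1:]) ^ j * chart_hom c K"
      unfolding chart_hom_binform hL[symmetric] by (simp only: chart_hom_def rpoly.eval_mult rpoly.eval_power)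
    also have "\<dots> = [:- y, 1:] ^ j * Polynomial.smult (t ^ j) (chart_hom c K)"
      by (simp only: smult_power mult_smult_left mult_smult_right)
    finally show "[:- y, 1:] ^ j dvd chart c x" by (rule dvdI)
  next
    assume "[:- y, 1:] ^ j dvd chart c x"
    then obtain q where q: "chart c x = [:- y, 1:] ^ j * q" by (elim dvdE)
    have q0: "q \<noteq> 0" using ne q by auto
    have "degree (chart c x) = j + degree q"
      unfolding q using q0 by (subst degree_mult_eq) (simp_all add: degree_linear_power)
    moreover have "degree (chart c x) \<le> degree P" unfolding chart_def by (rule degree_chart_poly)
    ultimately have dq: "j + degree q \<le> degree P" by simp
    define m where "m = degree P - j"
    have m: "degree q \<le> m" "degree P = j + m" using dq by (auto simp: m_def)
    define V where "V = mp_var True - mp_const c * mp_var False"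
    \<comment> \<open>The homogenised \<open>q\<close>; the constant undoes the factor
      \<open>t\<close> contained in each copy of \<open>?L\<close>.\<close>
    define K where "K = mp_const (1 / t ^ j) * (\<Sum>k\<le>m. mp_const (coeff q k) * mp_var False ^ k * V ^ (m - k))"
    have evV: "mp_eval (bpt u v) V = v - c * u" for u v by (simp add: V_def mp_eval_simps bpt_def)
    have evK: "mp_eval (bpt u v) K = 1 / t ^ j * (\<Sum>k\<le>m. coeff q k * u ^ k * (v - c * u) ^ (m - k))" for u v
      by (simp add: K_def mp_eval_simps evV) (simp add: bpt_def)
    \<comment> \<open>The chart proves the identity only where \<open>V\<close> is nonzero.
      Multiplied by \<open>V\<close> it holds at all points, and \<open>V\<close> is then
      cancelled.\<close>
    have "V * (?B - ?L ^ j * K) = 0"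
    proof (rule mpoly_eqI)
      fix a :: "bool \<Rightarrow> real"
      define u v where "u = a False" and "v = a True"
      have a: "a = bpt u v" by (rule ext) (auto simp: bpt_def u_def v_def)
      define \<tau> where "\<tau> = v - c * u"
      have "\<tau> * (hv (($) x) u v - (t * (u - y * \<tau>)) ^ j * (1 / t ^ j * (\<Sum>k\<le>m. coeff q k * u ^ k * \<tau> ^ (m - k)))) = 0"
      proof (cases "\<tau> = 0")
        case False
        define z where "z = u / \<tau>"
        have u: "u = \<tau> * z" using False by (simp add: z_def)
        have "v = \<tau> + c * u" by (simp add: \<tau>_def)
        also have "\<dots> = \<tau> * (1 + c * z)" unfolding u by (simp add: algebra_simps)
        finally have v: "v = \<tau> * (1 + c * z)" .
        have 1: "hv (($) x) u v = \<tau> ^ (j + m) * ((z - y) ^ j * poly q z)"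
        proof -
          have "hv (($) x) u v = \<tau> ^ degree P * poly (chart c x) z" unfolding u v hv_scale poly_chart ..
          then show ?thesis unfolding q m(2) by (simp add: algebra_simps)
        qed
        have "(\<Sum>k\<le>m. coeff q k * u ^ k * \<tau> ^ (m - k)) = (\<Sum>k\<le>m. \<tau> ^ m * (coeff q k * z ^ k))"
        proof (rule sum.cong[OF refl])
          fix k assume "k \<in> {..m}"
          then have "\<tau> ^ m = \<tau> ^ k * \<tau> ^ (m - k)" by (simp add: power_add[symmetric])
          then show "coeff q k * u ^ k * \<tau> ^ (m - k) = \<tau> ^ m * (coeff q k * z ^ k)"
            unfolding u by (simp add: power_mult_distrib)
        qed
        also have "\<dots> = \<tau> ^ m * (\<Sum>k\<le>m. coeff q k * z ^ k)" by (rule sum_distrib_left[symmetric])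
        also have "(\<Sum>k\<le>m. coeff q k * z ^ k) = poly q z"
          unfolding poly_altdef by (rule sum.mono_neutral_right) (use m in \<open>auto simp: coeff_eq_0\<close>)
        finally have 2: "(\<Sum>k\<le>m. coeff q k * u ^ k * \<tau> ^ (m - k)) = \<tau> ^ m * poly q z" .
        have 3: "t * (u - y * \<tau>) = t * (\<tau> * (z - y))" unfolding u by (simp add: algebra_simps)
        show ?thesis unfolding 1 2 3 using t by (simp add: power_mult_distrib power_add)
      qed simp
      then show "mp_eval a (V * (?B - ?L ^ j * K)) = mp_eval a 0"
        unfolding a by (simp only: mp_eval_simps evV evK mp_eval_binform evL[unfolded mp_eval_simps] \<tau>_def)
    qed
    moreover have "V \<noteq> 0"
    proof
      assume "V = 0"
      then show False using evV[of 0 1] by (simp add: mp_eval_simps)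
    qed
    ultimately have "?B - ?L ^ j * K = 0" using mpoly_no_zero_divisors by blast
    then have "?B = ?L ^ j * K" by simp
    then show "?L ^ j dvd ?B" by (rule dvdI)
  qed
  then show ?thesis using ne by (simp add: order_divides)
qed

lemma is_proj_root_mult_chart:
  assumes ne: "chart c x \<noteq> 0" and root: "poly (chart c x) y = 0"
  shows "is_proj_root_mult (binform (degree P) P x) (rp_class (y, 1 + c * y)) (order y (chart c x))"
  unfolding is_proj_root_mult_def
proof (intro conjI ballI)
  have "(y, 1 + c * y) \<noteq> (0, 0)" by auto
  then show "rp_class (y, 1 + c * y) \<in> RP1" by (rule rp_class_in_RP1)
  show "binform (degree P) P x \<noteq> 0"
  proof
    assume "binform (degree P) P x = 0"
    then have "chart c x = 0" using chart_hom_binform[of c x] by (simp add: chart_hom_def)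
    then show False using ne by simp
  qed
  fix p assume "p \<in> rp_class (y, 1 + c * y)"
  then obtain t where t: "t \<noteq> 0" "p = (t * y, t * (1 + c * y))" unfolding rp_class_def by auto
  have "hv (($) x) (t * y) (t * (1 + c * y)) = 0" unfolding hv_scale using root by (simp add: poly_chart)
  then show "case p of (u0, v0) \<Rightarrow> mp_eval (bpt u0 v0) (binform (degree P) P x) = 0 \<and>
      (GREATEST j. (mp_const v0 * mp_var False - mp_const u0 * mp_var True) ^ j dvd binform (degree P) P x) = order y (chart c x)"
    unfolding t(2) prod.case mp_eval_binform linear_power_dvd_binform_iff[OF t(1) ne] Greatest_le_eq by simp
qed

lemma is_proj_root_mult_unique:
  assumes "is_proj_root_mult g C m" "is_proj_root_mult g C m'"
  shows "m = m'"
proof -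
  obtain p where "C = rp_class p" using assms(1) unfolding is_proj_root_mult_def RP1_def by auto
  then have "p \<in> C" using self_mem_rp_class by simp
  then show ?thesis using assms unfolding is_proj_root_mult_def by (cases p) auto
qed

lemma chart_nonzero: "hv (($) x) 1 c \<noteq> 0 \<Longrightarrow> chart c x \<noteq> 0"
  using coeff_chart_top[of c x] by auto

text \<open>\<open>v - c * u = 0\<close> would make the root proportional to \<open>(1, c)\<close>,
  which is not a root.\<close>

lemma root_in_chart:
  assumes c: "hv (($) x) 1 c \<noteq> 0" and uv: "(u, v) \<noteq> (0, 0)" "hv (($) x) u v = 0"
  shows "\<exists>y t. t \<noteq> 0 \<and> u = t * y \<and> v = t * (1 + c * y) \<and> poly (chart c x) y = 0"
proof -
  define t where "t = v - c * u"
  have t: "t \<noteq> 0"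
  proof
    assume "t = 0"
    then have v: "v = u * c" by (simp add: t_def)
    then have "u \<noteq> 0" using uv(1) by auto
    moreover have "u ^ degree P * hv (($) x) 1 c = 0" using uv(2) hv_scale[of "($) x" u 1 c] by (simp add: v)
    ultimately show False using c by simp
  qed
  define y where "y = u / t"
  have u: "u = t * y" using t by (simp add: y_def)
  have "v = t + c * u" by (simp add: t_def)
  also have "\<dots> = t * (1 + c * y)" unfolding u by (simp add: algebra_simps)
  finally have v: "v = t * (1 + c * y)" .
  have "t ^ degree P * poly (chart c x) y = 0" using uv(2) unfolding u v hv_scale poly_chart .
  then show ?thesis using t u v by auto
qed

text \<open>Isolates what the constancy arguments use, so that they apply to the sections
  constructed here as well as to those of an arbitrary delineation.\<close>

definition root_section :: "(real^'n \<Rightarrow> (real \<times> real) set) \<Rightarrow> bool" where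
  "root_section \<theta> \<longleftrightarrow> continuous_map (top_of_set S) RP1_top \<theta> \<and>
     (\<forall>x\<in>S. \<theta> x \<in> RP1 \<and> (\<forall>(u, v)\<in>\<theta> x. hv (($) x) u v = 0))"

lemma root_section_in_chart:
  assumes \<theta>: "root_section \<theta>" and x0: "x0 \<in> S" and c: "hv (($) x0) 1 c \<noteq> 0"
  obtains r where "poly (chart c x0) r = 0" "\<theta> x0 = rp_class (r, 1 + c * r)"
    "\<And>\<epsilon>. \<epsilon> > 0 \<Longrightarrow> \<exists>T. openin (top_of_set S) T \<and> x0 \<in> T \<and>
       (\<forall>p\<in>T. \<exists>y. \<theta> p = rp_class (y, 1 + c * y) \<and> poly (chart c p) y = 0 \<and> dist y r < \<epsilon>)"
proof -
  have "\<theta> x0 \<in> RP1" using \<theta> x0 unfolding root_section_def by blast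
  then obtain u v where uv: "(u, v) \<noteq> (0, 0)" "\<theta> x0 = rp_class (u, v)" unfolding RP1_def by auto
  have "(u, v) \<in> \<theta> x0" unfolding uv(2) by (rule self_mem_rp_class)
  then have "hv (($) x0) u v = 0" using \<theta> x0 unfolding root_section_def by blast
  then obtain r t where r: "t \<noteq> 0" "u = t * r" "v = t * (1 + c * r)" "poly (chart c x0) r = 0"
    using root_in_chart[OF c uv(1)] by blast
  have \<theta>0: "\<theta> x0 = rp_class (r, 1 + c * r)" unfolding uv(2) r(2,3) by (rule rp_class_scale[OF r(1)])
  show ?thesis
  proof (rule that[OF r(4) \<theta>0])
    fix \<epsilon> :: real assume \<epsilon>: "\<epsilon> > 0"
    let ?W = "{rp_class (z, 1 + c * z) | z. dist z r < \<epsilon>}"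
    let ?T = "{x \<in> topspace (top_of_set S). \<theta> x \<in> ?W}"
    have "openin (top_of_set S) ?T"
      using \<theta> openin_RP1_chart[of c r \<epsilon>] unfolding root_section_def continuous_map_def by blast
    moreover have "\<theta> x0 \<in> ?W" unfolding \<theta>0 using \<epsilon> by (intro CollectI exI[of _ r]) simp
    then have "x0 \<in> ?T" using x0 by simp
    moreover have "\<exists>y. \<theta> p = rp_class (y, 1 + c * y) \<and> poly (chart c p) y = 0 \<and> dist y r < \<epsilon>" if p: "p \<in> ?T" for p
    proof -
      obtain y where y: "\<theta> p = rp_class (y, 1 + c * y)" "dist y r < \<epsilon>" using p by blast
      have pS: "p \<in> S" using p by simp
      have "(y, 1 + c * y) \<in> \<theta> p" unfolding y(1) by (rule self_mem_rp_class)
      then have "hv (($) p) y (1 + c * y) = 0" using \<theta> pS unfolding root_section_def by blast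
      then show ?thesis using y by (auto simp: poly_chart)
    qed
    ultimately show "\<exists>T. openin (top_of_set S) T \<and> x0 \<in> T \<and>
       (\<forall>p\<in>T. \<exists>y. \<theta> p = rp_class (y, 1 + c * y) \<and> poly (chart c p) y = 0 \<and> dist y r < \<epsilon>)" by blast
  qed
qed

text \<open>In a chart the multiplicity is the order of the chart polynomial at the root, which
  \<open>local_delineation\<close> preserves; so it is locally constant on a connected set.\<close>

lemma root_section_multiplicity:
  assumes conn: "connected S" and \<theta>: "root_section \<theta>"
  shows "\<exists>m\<ge>1. \<forall>x\<in>S. is_proj_root_mult (binform (degree P) P x) (\<theta> x) m"
proof (cases "S = {}")
  case False
  define M where "M x = (SOME m. is_proj_root_mult (binform (degree P) P x) (\<theta> x) m)" for x
  have loc: "\<exists>T m. openin (top_of_set S) T \<and> x0 \<in> T \<and> m \<ge> 1 \<and> (\<forall>p\<in>T. is_proj_root_mult (binform (degree P) P p) (\<theta> p) m)"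
    if x0: "x0 \<in> S" for x0
  proof -
    obtain c where c: "hv (($) x0) 1 c \<noteq> 0" using ex_good_chart[OF x0] by blast
    obtain \<eta> e where \<eta>: "0 < \<eta>" and e: "0 < e"
      and near: "\<forall>p\<in>S. dist p x0 < e \<longrightarrow> hv (($) p) 1 c \<noteq> 0 \<and>
      (\<forall>r. poly (chart c x0) r = 0 \<longrightarrow> (\<exists>!y. poly (chart c p) y = 0 \<and> dist y r < \<eta>)) \<and>
      (\<forall>y. poly (chart c p) y = 0 \<longrightarrow> (\<exists>r. poly (chart c x0) r = 0 \<and> dist y r < \<eta>)) \<and>
      (\<forall>r y. poly (chart c x0) r = 0 \<longrightarrow> poly (chart c p) y = 0 \<longrightarrow> dist y r < \<eta> \<longrightarrow>
         order y (chart c p) = order r (chart c x0) \<and>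
         (\<forall>t t'. t \<noteq> 0 \<longrightarrow> t' \<noteq> 0 \<longrightarrow>
            mp_ord H (hpt x0 (t * r) (t * (1 + c * r))) \<le> mp_ord H (hpt p (t' * y) (t' * (1 + c * y)))))"
      using local_delineation[OF x0 c] by (elim exE conjE) (rule that)
    obtain r where r: "poly (chart c x0) r = 0"
      and T: "\<And>\<epsilon>. \<epsilon> > 0 \<Longrightarrow> \<exists>T. openin (top_of_set S) T \<and> x0 \<in> T \<and>
       (\<forall>p\<in>T. \<exists>y. \<theta> p = rp_class (y, 1 + c * y) \<and> poly (chart c p) y = 0 \<and> dist y r < \<epsilon>)"
      using root_section_in_chart[OF \<theta> x0 c] by metis
    obtain T where T: "openin (top_of_set S) T" "x0 \<in> T"
      "\<And>p. p \<in> T \<Longrightarrow> \<exists>y. \<theta> p = rp_class (y, 1 + c * y) \<and> poly (chart c p) y = 0 \<and> dist y r < \<eta>"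
      using T[OF \<eta>] by blast
    let ?T = "T \<inter> (S \<inter> ball x0 e)"
    have "openin (top_of_set S) ?T" by (intro openin_Int T(1) openin_open_Int open_ball)
    moreover have "x0 \<in> ?T" using T(2) x0 e by simp
    moreover have "order r (chart c x0) \<ge> 1"
      using r chart_nonzero[OF c] order_root[of "chart c x0" r] by (simp add: Suc_leI)
    moreover have "is_proj_root_mult (binform (degree P) P p) (\<theta> p) (order r (chart c x0))" if p: "p \<in> ?T" for p
    proof -
      have pS: "p \<in> S" "dist p x0 < e" using p by (auto simp: dist_commute)
      obtain y where y: "\<theta> p = rp_class (y, 1 + c * y)" "poly (chart c p) y = 0" "dist y r < \<eta>" using T(3)[of p] p by blast
      note nr = near[THEN bspec, OF pS(1), THEN mp, OF pS(2)]
      have "order y (chart c p) = order r (chart c x0)"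
        using nr[THEN conjunct2, THEN conjunct2, THEN conjunct2, THEN spec, THEN spec, THEN mp, OF r, THEN mp, OF y(2),
            THEN mp, OF y(3), THEN conjunct1] .
      then show ?thesis using is_proj_root_mult_chart[OF chart_nonzero[OF conjunct1[OF nr]] y(2)] y(1) by simp
    qed
    ultimately show ?thesis by blast
  qed
  have MI: "is_proj_root_mult (binform (degree P) P x) (\<theta> x) (M x)" if "x \<in> S" for x
    unfolding M_def using loc[OF that] by (meson someI_ex)
  have "M constant_on S"
  proof (rule locally_constant_imp_constant[OF conn])
    fix x0 assume x0: "x0 \<in> S"
    obtain T m where T: "openin (top_of_set S) T" "x0 \<in> T" "\<And>p. p \<in> T \<Longrightarrow> is_proj_root_mult (binform (degree P) P p) (\<theta> p) m"
      using loc[OF x0] by blast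
    have "M p = m" if p: "p \<in> T" for p
    proof -
      have "p \<in> S" using p T(1) openin_imp_subset by blast
      then show ?thesis using is_proj_root_mult_unique[OF MI T(3)[OF p]] by simp
    qed
    then have "\<forall>p\<in>T. M p = M x0" using T(2) by simp
    then show "\<exists>T. openin (top_of_set S) T \<and> x0 \<in> T \<and> (\<forall>x\<in>T. M x = M x0)" using T(1,2) by blast
  qed
  then obtain m where m: "\<And>x. x \<in> S \<Longrightarrow> M x = m" unfolding constant_on_def by blast
  obtain x0 where x0: "x0 \<in> S" using False by blast
  obtain T m' where "x0 \<in> T" "m' \<ge> 1" "\<And>p. p \<in> T \<Longrightarrow> is_proj_root_mult (binform (degree P) P p) (\<theta> p) m'"
    using loc[OF x0] by blast
  then have "m \<ge> 1" using is_proj_root_mult_unique[OF MI[OF x0]] m[OF x0] by metis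
  then show ?thesis using MI m by auto
qed auto

lemma root_section_order:
  assumes conn: "connected S" and \<theta>: "root_section \<theta>"
  shows "\<exists>n. \<forall>x\<in>S. \<forall>(u, v)\<in>\<theta> x. mp_ord H (hpt x u v) = n"
proof (cases "S = {}")
  case False
  have loc: "\<exists>T n. openin (top_of_set S) T \<and> x0 \<in> T \<and> (\<forall>p\<in>T. \<forall>(u, v)\<in>\<theta> p. mp_ord H (hpt p u v) = n)"
    if x0: "x0 \<in> S" for x0
  proof -
    obtain c where c: "hv (($) x0) 1 c \<noteq> 0" using ex_good_chart[OF x0] by blast
    \<comment> \<open>Stated for every base point \<open>q\<close> in the chart because it is
      applied twice: at \<open>x0\<close>, and at the nearby point \<open>p\<close> itself.\<close>
    have scale: "\<exists>\<eta> e. 0 < \<eta> \<and> 0 < e \<and> (\<forall>p\<in>S. dist p q < e \<longrightarrow> hv (($) p) 1 c \<noteq> 0 \<and>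
        (\<forall>r y t t'. poly (chart c q) r = 0 \<longrightarrow> poly (chart c p) y = 0 \<longrightarrow> dist y r < \<eta> \<longrightarrow> t \<noteq> 0 \<longrightarrow> t' \<noteq> 0 \<longrightarrow>
            mp_ord H (hpt q (t * r) (t * (1 + c * r))) \<le> mp_ord H (hpt p (t' * y) (t' * (1 + c * y)))))"
      if q: "q \<in> S" "hv (($) q) 1 c \<noteq> 0" for q
    proof -
      obtain \<eta> e where \<eta>: "0 < \<eta>" and e: "0 < e"
        and near: "\<forall>p\<in>S. dist p q < e \<longrightarrow> hv (($) p) 1 c \<noteq> 0 \<and>
        (\<forall>r. poly (chart c q) r = 0 \<longrightarrow> (\<exists>!y. poly (chart c p) y = 0 \<and> dist y r < \<eta>)) \<and>
        (\<forall>y. poly (chart c p) y = 0 \<longrightarrow> (\<exists>r. poly (chart c q) r = 0 \<and> dist y r < \<eta>)) \<and>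
        (\<forall>r y. poly (chart c q) r = 0 \<longrightarrow> poly (chart c p) y = 0 \<longrightarrow> dist y r < \<eta> \<longrightarrow>
           order y (chart c p) = order r (chart c q) \<and>
           (\<forall>t t'. t \<noteq> 0 \<longrightarrow> t' \<noteq> 0 \<longrightarrow>
              mp_ord H (hpt q (t * r) (t * (1 + c * r))) \<le> mp_ord H (hpt p (t' * y) (t' * (1 + c * y)))))"
        using local_delineation[OF q] by (elim exE conjE) (rule that)
      have "hv (($) p) 1 c \<noteq> 0 \<and>
        (\<forall>r y t t'. poly (chart c q) r = 0 \<longrightarrow> poly (chart c p) y = 0 \<longrightarrow> dist y r < \<eta> \<longrightarrow> t \<noteq> 0 \<longrightarrow> t' \<noteq> 0 \<longrightarrow>
            mp_ord H (hpt q (t * r) (t * (1 + c * r))) \<le> mp_ord H (hpt p (t' * y) (t' * (1 + c * y))))"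
        if p: "p \<in> S" "dist p q < e" for p
      proof -
        note nr = near[THEN bspec, OF p(1), THEN mp, OF p(2)]
        show ?thesis
        proof (intro conjI allI impI)
          show "hv (($) p) 1 c \<noteq> 0" by (rule conjunct1[OF nr])
          show "mp_ord H (hpt q (t * r) (t * (1 + c * r))) \<le> mp_ord H (hpt p (t' * y) (t' * (1 + c * y)))"
            if h: "poly (chart c q) r = 0" "poly (chart c p) y = 0" "dist y r < \<eta>" "t \<noteq> 0" "t' \<noteq> 0" for r y t t'
            using nr[THEN conjunct2, THEN conjunct2, THEN conjunct2, THEN spec, THEN spec, THEN mp, OF h(1), THEN mp, OF h(2),
                THEN mp, OF h(3), THEN conjunct2, THEN spec, THEN spec, THEN mp, OF h(4), THEN mp, OF h(5)] .
        qed
      qed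
      then show ?thesis using \<eta> e by blast
    qed
    obtain \<eta> e where \<eta>: "0 < \<eta>" and e: "0 < e" and near: "\<forall>p\<in>S. dist p x0 < e \<longrightarrow> hv (($) p) 1 c \<noteq> 0 \<and>
        (\<forall>r y t t'. poly (chart c x0) r = 0 \<longrightarrow> poly (chart c p) y = 0 \<longrightarrow> dist y r < \<eta> \<longrightarrow> t \<noteq> 0 \<longrightarrow> t' \<noteq> 0 \<longrightarrow>
            mp_ord H (hpt x0 (t * r) (t * (1 + c * r))) \<le> mp_ord H (hpt p (t' * y) (t' * (1 + c * y))))"
      using scale[OF x0 c] by (elim exE conjE) (rule that)
    obtain r where r: "poly (chart c x0) r = 0"
      and T: "\<And>\<epsilon>. \<epsilon> > 0 \<Longrightarrow> \<exists>T. openin (top_of_set S) T \<and> x0 \<in> T \<and>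
       (\<forall>p\<in>T. \<exists>y. \<theta> p = rp_class (y, 1 + c * y) \<and> poly (chart c p) y = 0 \<and> dist y r < \<epsilon>)"
      using root_section_in_chart[OF \<theta> x0 c] by metis
    define n where "n = mp_ord H (hpt x0 r (1 + c * r))"
    \<comment> \<open>A derivative of order \<open>n\<close> that is nonzero at \<open>x0\<close>
      stays nonzero nearby, which bounds the order on the section from above.\<close>
    obtain js where js: "length js = n" "mp_eval (hpt x0 r (1 + c * r)) (foldr mp_pderiv js H) \<noteq> 0"
      using mp_ord_attained[OF hom_poly_nonzero[OF x0]] unfolding n_def by blast
    define \<Psi> where "\<Psi> q = mp_eval (hpt (fst q) (snd q) (1 + c * snd q)) (foldr mp_pderiv js H)" for q :: "(real^'n) \<times> real"
    have "continuous_on UNIV (\<lambda>q::(real^'n) \<times> real. hpt (fst q) (snd q) (1 + c * snd q) i)" for i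
    proof (cases i)
      case (Inl j)
      then show ?thesis unfolding hpt_def by (auto intro!: continuous_intros)
    next
      case (Inr b)
      then show ?thesis unfolding hpt_def by (cases b) (auto intro!: continuous_intros)
    qed
    then have "continuous_on UNIV \<Psi>" unfolding \<Psi>_def by (rule continuous_on_mp_eval)
    then have "isCont \<Psi> (x0, r)" by (simp add: continuous_on_eq_continuous_at)
    moreover have "\<Psi> (x0, r) \<noteq> 0" using js(2) by (simp add: \<Psi>_def)
    ultimately obtain \<epsilon> where \<epsilon>: "\<epsilon> > 0" "\<And>q. dist (x0, r) q < \<epsilon> \<Longrightarrow> \<Psi> q \<noteq> 0"
      using continuous_at_avoid[of "(x0, r)" \<Psi> 0] by blast
    define \<eta>' where "\<eta>' = min \<eta> (\<epsilon> / 2)"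
    define e' where "e' = min e (\<epsilon> / 2)"
    have "\<eta>' > 0" "e' > 0" using \<eta> e \<epsilon>(1) by (auto simp: \<eta>'_def e'_def)
    obtain T where T: "openin (top_of_set S) T" "x0 \<in> T"
      "\<And>p. p \<in> T \<Longrightarrow> \<exists>y. \<theta> p = rp_class (y, 1 + c * y) \<and> poly (chart c p) y = 0 \<and> dist y r < \<eta>'"
      using T[OF \<open>\<eta>' > 0\<close>] by blast
    let ?T = "T \<inter> (S \<inter> ball x0 e')"
    have "openin (top_of_set S) ?T" by (intro openin_Int T(1) openin_open_Int open_ball)
    moreover have "x0 \<in> ?T" using T(2) x0 \<open>e' > 0\<close> by simp
    moreover have "mp_ord H (hpt p u v) = n" if p: "p \<in> ?T" and uv: "(u, v) \<in> \<theta> p" for p u v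
    proof -
      have pS: "p \<in> S" "dist p x0 < e" "dist x0 p < \<epsilon> / 2" using p by (auto simp: dist_commute e'_def)
      obtain y where y: "\<theta> p = rp_class (y, 1 + c * y)" "poly (chart c p) y = 0" "dist y r < \<eta>'" using T(3)[of p] p by blast
      obtain t where t: "t \<noteq> 0" "u = t * y" "v = t * (1 + c * y)" using uv unfolding y(1) mem_rp_class by blast
      have y\<eta>: "dist y r < \<eta>" "dist r y < \<epsilon> / 2" using y(3) by (auto simp: \<eta>'_def dist_commute)
      note nr = near[THEN bspec, OF pS(1), THEN mp, OF pS(2)]
      have "mp_ord H (hpt x0 (1 * r) (1 * (1 + c * r))) \<le> mp_ord H (hpt p (t * y) (t * (1 + c * y)))"
        using nr[THEN conjunct2, rule_format, OF r y(2) y\<eta>(1) one_neq_zero t(1)] .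
      then have ge: "n \<le> mp_ord H (hpt p u v)" by (simp add: n_def t)
      have "dist (x0, r) (p, y) \<le> dist x0 p + dist r y"
        unfolding dist_Pair_Pair by (rule sqrt_sum_squares_le_sum) auto
      then have "\<Psi> (p, y) \<noteq> 0" using \<epsilon>(2)[of "(p, y)"] pS(3) y\<eta>(2) by simp
      then have "mp_ord H (hpt p y (1 + c * y)) \<le> n"
        using mp_ord_le[of "hpt p y (1 + c * y)" js H] js(1) by (simp add: \<Psi>_def)
      \<comment> \<open>Comparing the point \<open>p\<close> with itself shows that the order does
        not depend on the representative of the class.\<close>
      moreover have "mp_ord H (hpt p (t * y) (t * (1 + c * y))) \<le> mp_ord H (hpt p (1 * y) (1 * (1 + c * y)))"
      proof -
        obtain \<eta>1 e1 where s1: "0 < \<eta>1" "0 < e1" "\<forall>q\<in>S. dist q p < e1 \<longrightarrow> hv (($) q) 1 c \<noteq> 0 \<and>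
          (\<forall>r y t t'. poly (chart c p) r = 0 \<longrightarrow> poly (chart c q) y = 0 \<longrightarrow> dist y r < \<eta>1 \<longrightarrow> t \<noteq> 0 \<longrightarrow> t' \<noteq> 0 \<longrightarrow>
            mp_ord H (hpt p (t * r) (t * (1 + c * r))) \<le> mp_ord H (hpt q (t' * y) (t' * (1 + c * y))))"
          using scale[OF pS(1) conjunct1[OF nr]] by (elim exE conjE) (rule that)
        have "dist p p < e1" "dist y y < \<eta>1" using s1 by simp_all
        from s1(3)[THEN bspec, OF pS(1), THEN mp, OF this(1), THEN conjunct2, rule_format, OF y(2) y(2) this(2) t(1) one_neq_zero]
        show ?thesis .
      qed
      ultimately show ?thesis using ge by (simp add: t)
    qed
    ultimately have "openin (top_of_set S) ?T \<and> x0 \<in> ?T \<and> (\<forall>p\<in>?T. \<forall>(u, v)\<in>\<theta> p. mp_ord H (hpt p u v) = n)"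
      by (simp add: case_prod_unfold)
    then show ?thesis by (intro exI)
  qed
  define C where "C p n \<longleftrightarrow> (\<forall>(u, v)\<in>\<theta> p. mp_ord H (hpt p u v) = n)" for p n
  have loc': "\<exists>T n. openin (top_of_set S) T \<and> x0 \<in> T \<and> (\<forall>p\<in>T. C p n)" if "x0 \<in> S" for x0
    unfolding C_def by (rule loc[OF that])
  have uniq: "n = n'" if "p \<in> S" "C p n" "C p n'" for p n n'
  proof -
    have "\<theta> p \<in> RP1" using \<theta> that(1) unfolding root_section_def by blast
    then obtain q where q: "\<theta> p = rp_class q" unfolding RP1_def by (rule imageE)
    have "q \<in> \<theta> p" unfolding q by (rule self_mem_rp_class)
    then show ?thesis using that(2,3) unfolding C_def by (cases q) auto
  qed
  define N where "N p = (SOME n. C p n)" for p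
  have CN: "C p (N p)" if p: "p \<in> S" for p
  proof -
    obtain T n where "p \<in> T" "\<forall>p\<in>T. C p n" using loc'[OF p] by (elim exE conjE) (rule that)
    then have "C p n" by simp
    then show ?thesis unfolding N_def by (rule someI)
  qed
  have "N constant_on S"
  proof (rule locally_constant_imp_constant[OF conn])
    fix x0 assume x0: "x0 \<in> S"
    obtain T n where T: "openin (top_of_set S) T" "x0 \<in> T" "\<forall>p\<in>T. C p n"
      using loc'[OF x0] by (elim exE conjE) (rule that)
    have TS: "T \<subseteq> S" using T(1) by (rule openin_imp_subset)
    have "N p = n" if p: "p \<in> T" for p
      using uniq[OF _ CN] bspec[OF T(3) p] subsetD[OF TS p] by blast
    then have "\<forall>p\<in>T. N p = N x0" using T(2) by simp
    then show "\<exists>T. openin (top_of_set S) T \<and> x0 \<in> T \<and> (\<forall>x\<in>T. N x = N x0)" using T(1,2) by blast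
  qed
  then obtain n where n: "\<forall>x\<in>S. N x = n" unfolding constant_on_def by (elim exE) (rule that)
  have "\<forall>x\<in>S. C x n"
  proof
    fix x assume x: "x \<in> S"
    show "C x n" using CN[OF x] bspec[OF n x] by simp
  qed
  then show ?thesis unfolding C_def by (rule exI)
qed auto

text \<open>The projective roots transported into the plane, where the covering results for normed
  spaces apply.\<close>

definition root_points :: "real^'n \<Rightarrow> (real \<times> real) set" where
  "root_points x = {proj_line (u, v) | u v. (u, v) \<noteq> (0, 0) \<and> hv (($) x) u v = 0}"

lemma local_sections_root_points: "local_sections S root_points"
  unfolding local_sections_def
proof
  fix x0 assume x0: "x0 \<in> S"
  obtain c where c: "hv (($) x0) 1 c \<noteq> 0" using ex_good_chart[OF x0] by blast
  obtain \<eta> e where \<eta>: "0 < \<eta>" and e: "0 < e"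
    and sep: "\<forall>a b. poly (chart c x0) a = 0 \<longrightarrow> poly (chart c x0) b = 0 \<longrightarrow> a \<noteq> b \<longrightarrow> 2 * \<eta> \<le> dist a b"
    and near: "\<forall>p\<in>S. dist p x0 < e \<longrightarrow> hv (($) p) 1 c \<noteq> 0 \<and>
      (\<forall>r. poly (chart c x0) r = 0 \<longrightarrow> (\<exists>!y. poly (chart c p) y = 0 \<and> dist y r < \<eta>)) \<and>
      (\<forall>y. poly (chart c p) y = 0 \<longrightarrow> (\<exists>r. poly (chart c x0) r = 0 \<and> dist y r < \<eta>)) \<and>
      (\<forall>r y. poly (chart c x0) r = 0 \<longrightarrow> poly (chart c p) y = 0 \<longrightarrow> dist y r < \<eta> \<longrightarrow>
         order y (chart c p) = order r (chart c x0) \<and>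
         (\<forall>t t'. t \<noteq> 0 \<longrightarrow> t' \<noteq> 0 \<longrightarrow>
            mp_ord H (hpt x0 (t * r) (t * (1 + c * r))) \<le> mp_ord H (hpt p (t' * y) (t' * (1 + c * y)))))"
    and cont: "\<forall>r. poly (chart c x0) r = 0 \<longrightarrow>
      continuous_on (S \<inter> ball x0 e) (\<lambda>p. THE y. poly (chart c p) y = 0 \<and> dist y r < \<eta>)"
    using local_delineation[OF x0 c] by (elim exE conjE) (rule that)
  let ?Z = "{r. poly (chart c x0) r = 0}"
  have fin: "finite ?Z" by (rule poly_roots_finite[OF chart_nonzero[OF c]])
  define k where "k = card ?Z"
  obtain b where b: "bij_betw b {..<k} ?Z"
    using ex_bij_betw_nat_finite[OF fin] unfolding k_def atLeast0LessThan by blast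
  have broot: "poly (chart c x0) (b i) = 0" if "i < k" for i using b that unfolding bij_betw_def by auto
  define Y where "Y i p = (THE y. poly (chart c p) y = 0 \<and> dist y (b i) < \<eta>)" for i p
  let ?A = "S \<inter> ball x0 e"
  have A: "p \<in> S" "dist p x0 < e" if "p \<in> ?A" for p using that by (auto simp: dist_commute)
  have ex1: "\<exists>!y. poly (chart c p) y = 0 \<and> dist y (b i) < \<eta>" if "p \<in> ?A" "i < k" for p i
    using near[THEN bspec, OF A(1)[OF that(1)], THEN mp, OF A(2)[OF that(1)],
        THEN conjunct2, THEN conjunct1, THEN spec, THEN mp, OF broot[OF that(2)]] .
  have Y: "poly (chart c p) (Y i p) = 0 \<and> dist (Y i p) (b i) < \<eta>" if "p \<in> ?A" "i < k" for p i
    unfolding Y_def by (rule theI'[OF ex1[OF that]])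
  define f where "f i p = proj_line (Y i p, 1 + c * Y i p)" for i p
  have ne: "(z, 1 + c * z) \<noteq> (0, 0)" for z by auto
  have proj_inj: "z = z'" if "proj_line (z, 1 + c * z) = proj_line (z', 1 + c * z')" for z z'
  proof -
    have "rp_class (z, 1 + c * z) = rp_class (z', 1 + c * z')"
      using that proj_inv_proj_line[OF ne] by metis
    then have "(z, 1 + c * z) \<in> rp_class (z', 1 + c * z')" using self_mem_rp_class by blast
    then obtain t where t: "z = t * z'" "1 + c * z = t * (1 + c * z')" unfolding mem_rp_class by blast
    \<comment> \<open>\<open>v - c * u\<close> equals 1 for both representatives, so the factor
      between them is 1.\<close>
    have "t = t * (1 + c * z') - c * (t * z')" by (simp add: algebra_simps)
    also have "\<dots> = 1" unfolding t[symmetric] by simp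
    finally show ?thesis using t(1) by simp
  qed
  show "\<exists>U k f. open U \<and> x0 \<in> U \<and> (\<forall>i<k::nat. continuous_on (S \<inter> U) (f i)) \<and>
     (\<forall>x\<in>S \<inter> U. inj_on (\<lambda>i. f i x) {..<k} \<and> root_points x = (\<lambda>i. f i x) ` {..<k})"
  proof (intro exI[of _ "ball x0 e"] exI[of _ k] exI[of _ f] conjI allI impI ballI)
    show "open (ball x0 e)" "x0 \<in> ball x0 e" using e by auto
    show "continuous_on ?A (f i)" if i: "i < k" for i
    proof -
      have cY: "continuous_on ?A (Y i)" unfolding Y_def using cont broot[OF i] by blast
      have "(Y i p)\<^sup>2 + (1 + c * Y i p)\<^sup>2 \<noteq> 0" for p using ne[of "Y i p"] by (simp add: sum_power2_eq_zero_iff)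
      then show ?thesis unfolding f_def proj_line_def fst_conv snd_conv by (intro continuous_intros cY) auto
    qed
    fix p assume p: "p \<in> ?A"
    show "inj_on (\<lambda>i. f i p) {..<k}"
    proof (rule inj_onI, rule ccontr)
      fix i j assume ij: "i \<in> {..<k}" "j \<in> {..<k}" "f i p = f j p" "i \<noteq> j"
      have eq: "Y i p = Y j p" using proj_inj ij(3) unfolding f_def by blast
      have "b i \<noteq> b j" using b ij unfolding bij_betw_def inj_on_def by blast
      then have "2 * \<eta> \<le> dist (b i) (b j)" using sep broot ij by blast
      also have "\<dots> \<le> dist (Y i p) (b i) + dist (Y i p) (b j)" by (metis dist_commute dist_triangle)
      also have "\<dots> < 2 * \<eta>" using Y[OF p, of i] Y[OF p, of j] eq ij(1,2) by simp
      finally show False by simp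
    qed
    show "root_points p = (\<lambda>i. f i p) ` {..<k}"
    proof (intro equalityI subsetI)
      fix w assume "w \<in> root_points p"
      then obtain u v where uv: "w = proj_line (u, v)" "(u, v) \<noteq> (0, 0)" "hv (($) p) u v = 0"
        unfolding root_points_def by blast
      note nr = near[THEN bspec, OF A(1)[OF p], THEN mp, OF A(2)[OF p]]
      obtain y t where y: "t \<noteq> 0" "u = t * y" "v = t * (1 + c * y)" "poly (chart c p) y = 0"
        using root_in_chart[OF conjunct1[OF nr] uv(2,3)] by blast
      obtain r where r: "poly (chart c x0) r = 0" "dist y r < \<eta>"
        using nr[THEN conjunct2, THEN conjunct2, THEN conjunct1, THEN spec, THEN mp, OF y(4)] by blast
      have "r \<in> b ` {..<k}" using b r(1) unfolding bij_betw_def by simp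
      then obtain i where i: "i < k" "b i = r" by auto
      have "poly (chart c p) y = 0 \<and> dist y (b i) < \<eta>" using y(4) r(2) i(2) by simp
      then have "y = Y i p" using ex1[OF p i(1)] Y[OF p i(1)] by blast
      then have "w = f i p" unfolding uv(1) y(2,3) f_def proj_line_scale[OF y(1)] by simp
      then show "w \<in> (\<lambda>i. f i p) ` {..<k}" using i(1) by blast
    next
      fix w assume "w \<in> (\<lambda>i. f i p) ` {..<k}"
      then obtain i where i: "i < k" "w = f i p" by blast
      have "hv (($) p) (Y i p) (1 + c * Y i p) = 0" using Y[OF p i(1)] by (simp add: poly_chart)
      then show "w \<in> root_points p" unfolding i(2) f_def root_points_def using ne[of "Y i p"] by blast
    qed
  qed
qed

lemma Z_RP1_eq: "Z_RP1 P S = {(x, C). x \<in> S \<and> C \<in> RP1 \<and> (\<forall>(u, v)\<in>C. hv (($) x) u v = 0)}"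
  unfolding Z_RP1_def mp_eval_hpt ..

lemma proj_delineable_if_simply_connected:
  assumes sc: "simply_connected S" and lpc: "locally path_connected S"
  shows "proj_delineable P S"
proof -
  have conn: "connected S" by (rule simply_connected_imp_connected[OF sc])
  obtain k g where g: "\<And>i. i < k \<Longrightarrow> continuous_on S (g i)"
    and fib: "\<And>x. x \<in> S \<Longrightarrow> inj_on (\<lambda>i::nat. g i x) {..<k} \<and> root_points x = (\<lambda>i. g i x) ` {..<k}"
    using global_sections[OF local_sections_root_points sc lpc] by blast
  define \<theta> where "\<theta> i x = proj_inv (g i x)" for i x
  have rep: "\<exists>u v. (u, v) \<noteq> (0, 0) \<and> hv (($) x) u v = 0 \<and> g i x = proj_line (u, v) \<and> \<theta> i x = rp_class (u, v)"
    if x: "x \<in> S" and i: "i < k" for x i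
  proof -
    have "g i x \<in> root_points x" using fib[OF x] i by blast
    then obtain u v where uv: "g i x = proj_line (u, v)" "(u, v) \<noteq> (0, 0)" "hv (($) x) u v = 0"
      unfolding root_points_def by blast
    then have "\<theta> i x = rp_class (u, v)" unfolding \<theta>_def by (simp add: proj_inv_proj_line)
    then show ?thesis using uv by blast
  qed
  have class_root: "hv (($) x) a b = 0" if "(a, b) \<in> rp_class (u, v)" "hv (($) x) u v = 0" for x a b u v
    using that unfolding mem_rp_class by (auto simp: hv_scale)
  have sec: "root_section (\<theta> i)" if i: "i < k" for i
    unfolding root_section_def
  proof (intro conjI ballI)
    show "continuous_map (top_of_set S) RP1_top (\<theta> i)"
      unfolding \<theta>_def by (rule continuous_map_proj_inv[OF g[OF i]]) (use rep i in blast)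
    fix x assume x: "x \<in> S"
    obtain u v where uv: "(u, v) \<noteq> (0, 0)" "hv (($) x) u v = 0" "\<theta> i x = rp_class (u, v)" using rep[OF x i] by blast
    show "\<theta> i x \<in> RP1" unfolding uv(3) by (rule rp_class_in_RP1[OF uv(1)])
    show "case p of (a, b) \<Rightarrow> hv (($) x) a b = 0" if "p \<in> \<theta> i x" for p
      using class_root[OF _ uv(2), of "fst p" "snd p"] that unfolding uv(3) by (simp add: case_prod_unfold)
  qed
  have "proj_delineable_by P S k \<theta>"
    unfolding proj_delineable_by_def
  proof (intro conjI allI impI)
    show "continuous_map (top_of_set S) RP1_top (\<theta> l)" if "l < k" for l
      using sec[OF that] unfolding root_section_def by blast
    show "\<exists>m\<ge>1. \<forall>x\<in>S. is_proj_root_mult (binform (degree P) P x) (\<theta> l x) m" if "l < k" for l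
      by (rule root_section_multiplicity[OF conn sec[OF that]])
    show "{(x, \<theta> l x) | x. x \<in> S} \<inter> {(x, \<theta> l' x) | x. x \<in> S} = {}" if l: "l < k" "l' < k" "l \<noteq> l'" for l l'
    proof -
      have False if x: "x \<in> S" and eq: "\<theta> l x = \<theta> l' x" for x
      proof -
        obtain u v where uv: "(u, v) \<noteq> (0, 0)" "g l x = proj_line (u, v)" "\<theta> l x = rp_class (u, v)" using rep[OF x l(1)] by blast
        obtain u' v' where uv': "g l' x = proj_line (u', v')" "\<theta> l' x = rp_class (u', v')" using rep[OF x l(2)] by blast
        have "(u, v) \<in> rp_class (u', v')" using eq uv(3) uv'(2) self_mem_rp_class by metis
        then obtain t where t: "t \<noteq> 0" "u = t * u'" "v = t * v'" unfolding mem_rp_class by blast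
        then have "g l x = g l' x" unfolding uv(2) uv'(1) t(2,3) by (simp add: proj_line_scale)
        then show False using inj_onD[OF conjunct1[OF fib[OF x]], of l l'] l by simp
      qed
      then show ?thesis by blast
    qed
    show "Z_RP1 P S = (\<Union>l<k. {(x, \<theta> l x) | x. x \<in> S})"
    proof (intro equalityI subsetI)
      fix q assume "q \<in> Z_RP1 P S"
      then obtain x C where q: "q = (x, C)" "x \<in> S" "C \<in> RP1" "\<forall>(u, v)\<in>C. hv (($) x) u v = 0"
        unfolding Z_RP1_eq by blast
      obtain u v where uv: "(u, v) \<noteq> (0, 0)" "C = rp_class (u, v)" using q(3) unfolding RP1_def by auto
      have "(u, v) \<in> C" unfolding uv(2) by (rule self_mem_rp_class)
      then have "hv (($) x) u v = 0" using q(4) by blast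
      then have "proj_line (u, v) \<in> root_points x" unfolding root_points_def using uv(1) by blast
      then obtain l where l: "l < k" "proj_line (u, v) = g l x" using fib[OF q(2)] by blast
      have "\<theta> l x = C" unfolding \<theta>_def l(2)[symmetric] uv(2) by (rule proj_inv_proj_line[OF uv(1)])
      then show "q \<in> (\<Union>l<k. {(x, \<theta> l x) | x. x \<in> S})" using q(1,2) l(1) by blast
    next
      fix q assume "q \<in> (\<Union>l<k. {(x, \<theta> l x) | x. x \<in> S})"
      then obtain l x where l: "l < k" "x \<in> S" "q = (x, \<theta> l x)" by blast
      have "\<theta> l x \<in> RP1 \<and> (\<forall>(u, v)\<in>\<theta> l x. hv (($) x) u v = 0)"
        using sec[OF l(1)] l(2) unfolding root_section_def by blast
      then show "q \<in> Z_RP1 P S" unfolding Z_RP1_eq l(3) using l(2) by blast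
    qed
  qed
  then show ?thesis unfolding proj_delineable_def by blast
qed

text \<open>The sections of any delineation are continuous selections of projective roots, which is
  what \<open>root_section_order\<close> asks for.\<close>

lemma order_invariant_on_sections:
  assumes conn: "connected S" and del: "proj_delineable_by P S k \<theta>" and l: "l < k"
  shows "H_order_invariant_on_section P S (\<theta> l)"
proof -
  note d = del[unfolded proj_delineable_by_def]
  have "root_section (\<theta> l)"
    unfolding root_section_def
  proof
    show "continuous_map (top_of_set S) RP1_top (\<theta> l)" using conjunct1[OF d] l by simp
    show "\<forall>x\<in>S. \<theta> l x \<in> RP1 \<and> (\<forall>(u, v)\<in>\<theta> l x. hv (($) x) u v = 0)"
    proof
      fix x assume "x \<in> S"
      then have "(x, \<theta> l x) \<in> Z_RP1 P S" unfolding d[THEN conjunct2, THEN conjunct1] using l by blast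
      then show "\<theta> l x \<in> RP1 \<and> (\<forall>(u, v)\<in>\<theta> l x. hv (($) x) u v = 0)" unfolding Z_RP1_eq by blast
    qed
  qed
  from root_section_order[OF conn this] show ?thesis unfolding H_order_invariant_on_section_def .
qed

end

theorem mainTheorem9:
  fixes S :: "(real^'n) set" and P :: "'n mpoly poly"
  assumes "analytic_submanifold S"
    and "simply_connected S"
    and "never_nullifies P S"
    and "disc_xn (degree P) P \<noteq> 0"
    and "mp_order_invariant (disc_xn (degree P) P) ((\<lambda>x. ($) x) ` S)"
  shows "proj_delineable P S \<and>
    (\<forall>k \<theta>. proj_delineable_by P S k \<theta> \<longrightarrow> (\<forall>l<k. H_order_invariant_on_section P S (\<theta> l)))"
proof -
  interpret disc_invariant S P by unfold_locales (use assms in auto)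
  have "proj_delineable P S"
    using assms(1,2) by (intro proj_delineable_if_simply_connected analytic_submanifold_locally_path_connected)
  moreover have "H_order_invariant_on_section P S (\<theta> l)" if "proj_delineable_by P S k \<theta>" "l < k" for k \<theta> l
    by (rule order_invariant_on_sections[OF simply_connected_imp_connected[OF assms(2)] that])
  ultimately show ?thesis by blast
qed

end
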